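(* For all integers $g,a\geq 0$, $p\geq 1$ and $k\geq 2$, there is an integer $n\geq a+\frac14 k\sqrt{p+g}$ such that $K_n$ is a minor of some graph in $\mathcal{G}(g,p,k,a)$.
   Context: All graphs are finite and simple. Vortices: Let $\Omega=(v_1,\dots,v_t)$ be a circular ordering of a subset $V(\Omega)$ of the vertices of a graph $G$. A circular decomposition of $G$ with perimeter $\Omega$ is a multiset $\{C\langle w\rangle\subseteq V(G): w\in V(\Omega)\}$ of bags such that: each $w\in V(\Omega)$ lies in $C\langle w\rangle$; each vertex of $G$ lies in some bag; for each edge some bag contains both endpoints; and for each vertex $u$, the set of $w$ with $u\in C\langle w\rangle$ forms a set of cyclically consecutive elements of $\Omega$. Its width is the maximum bag size minus 1; the vortex $(G,\Omega)$ has width equal to the minimum width of such a decomposition. A graph $G$ is $(g,p,k)$-almost embeddable if there exist a graph $G_0$ embedded in a surface $\Sigma$ of Euler genus at most $g$ and $q\leq p$ vortices $(G_1,\Omega_1),\dots,(G_q,\Omega_q)$ of width at most $k$ with $G=G_0\cup\dots\cup G_q$; $G_1,\dots,G_q$ pairwise vertex-disjoint; $V(G_i)\cap V(G_0)=V(\Omega_i)$; and $q$ pairwise disjoint closed discs in $\Sigma$ with interiors $D_1,\dots,D_q$ disjoint from $G_0$, boundaries meeting $G_0$ only in vertices, $\partial D_i\cap V(G_0)=V(\Omega_i)$, and $\Omega_i$ compatible with the cyclic order along $\partial D_i$. $\mathcal{G}(g,p,k)$ is the set of such graphs, and $\mathcal{G}(g,p,k,a)$ is the set of graphs $G$ such that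 $G\setminus A\in\mathcal{G}(g,p,k)$ for some $A\subseteq V(G)$ with $|A|\leq a$. *)

theory Defs
  imports "HOL-Analysis.Analysis"
begin

section \<open>Finite simple graphs\<close>

record 'v graph =
  verts :: "'v set"
  edges :: "'v set set"

definition simple_graph :: "'v graph \<Rightarrow> bool" where
  "simple_graph G \<longleftrightarrow>
     finite (verts G) \<and> (\<forall>e \<in> edges G. e \<subseteq> verts G \<and> card e = 2)"

definition complete_graph :: "nat \<Rightarrow> nat graph" where
  "complete_graph n =
     \<lparr>verts = {..<n}, edges = {{u, v} | u v. u < n \<and> v < n \<and> u \<noteq> v}\<rparr>"

definition delete_verts :: "'v graph \<Rightarrow> 'v set \<Rightarrow> 'v graph" where
  "delete_verts G A =
     \<lparr>verts = verts G - A, edges = {e \<in> edges G. e \<inter> A = {}}\<rparr>"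

definition connected_in :: "'v graph \<Rightarrow> 'v set \<Rightarrow> bool" where
  "connected_in G B \<longleftrightarrow>
     B \<noteq> {} \<and> B \<subseteq> verts G \<and>
     (\<forall>x \<in> B. \<forall>y \<in> B. (x, y) \<in> {(u, v). u \<in> B \<and> v \<in> B \<and> {u, v} \<in> edges G}\<^sup>*)"

text \<open>\<open>H\<close> is a minor of \<open>G\<close>; the sets \<open>B u\<close> are the branch sets, which are contracted
  to the vertices of \<open>H\<close>.\<close>

definition is_minor :: "'u graph \<Rightarrow> 'v graph \<Rightarrow> bool" where
  "is_minor H G \<longleftrightarrow>
     (\<exists>B. (\<forall>u \<in> verts H. connected_in G (B u)) \<and>
          (\<forall>u \<in> verts H. \<forall>v \<in> verts H. u \<noteq> v \<longrightarrow> B u \<inter> B v = {}) \<and>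
          (\<forall>u v. {u, v} \<in> edges H \<longrightarrow> (\<exists>x \<in> B u. \<exists>y \<in> B v. {x, y} \<in> edges G)))"


section \<open>Vortices\<close>

text \<open>A circular ordering is represented by a list without repetitions, read cyclically.\<close>

definition is_vortex :: "'v graph \<Rightarrow> 'v list \<Rightarrow> bool" where
  "is_vortex G \<Omega> \<longleftrightarrow> simple_graph G \<and> \<Omega> \<noteq> [] \<and> distinct \<Omega> \<and> set \<Omega> \<subseteq> verts G"

definition cyclically_consecutive :: "'v list \<Rightarrow> 'v set \<Rightarrow> bool" where
  "cyclically_consecutive \<Omega> S \<longleftrightarrow>
     (\<exists>i l. S = (\<lambda>j. \<Omega> ! ((i + j) mod length \<Omega>)) ` {..<l})"

text \<open>The multiset of bags is given as a family \<open>C\<close> indexed by the vertices of the perimeter.\<close>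

definition circular_decomposition :: "'v graph \<Rightarrow> 'v list \<Rightarrow> ('v \<Rightarrow> 'v set) \<Rightarrow> bool" where
  "circular_decomposition G \<Omega> C \<longleftrightarrow>
     (\<forall>w \<in> set \<Omega>. w \<in> C w \<and> C w \<subseteq> verts G) \<and>
     (\<forall>u \<in> verts G. \<exists>w \<in> set \<Omega>. u \<in> C w) \<and>
     (\<forall>e \<in> edges G. \<exists>w \<in> set \<Omega>. e \<subseteq> C w) \<and>
     (\<forall>u \<in> verts G. cyclically_consecutive \<Omega> {w \<in> set \<Omega>. u \<in> C w})"

definition decomposition_width :: "'v list \<Rightarrow> ('v \<Rightarrow> 'v set) \<Rightarrow> nat" where
  "decomposition_width \<Omega> C = Max ((\<lambda>w. card (C w)) ` set \<Omega>) - 1"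

text \<open>For a vortex the minimum is over a nonempty set: all bags may be taken to be
  the whole vertex set.\<close>

definition vortex_width :: "'v graph \<Rightarrow> 'v list \<Rightarrow> nat" where
  "vortex_width G \<Omega> =
     (LEAST m. \<exists>C. circular_decomposition G \<Omega> C \<and> decomposition_width \<Omega> C = m)"


section \<open>Surfaces and embedded graphs\<close>

definition surface :: "'s topology \<Rightarrow> bool" where
  "surface X \<longleftrightarrow>
     topspace X \<noteq> {} \<and> compact_space X \<and> connected_space X \<and> Hausdorff_space X \<and>
     (\<forall>x \<in> topspace X. \<exists>U. openin X U \<and> x \<in> U \<and>
        subtopology X U homeomorphic_space top_of_set (ball (0::complex) 1))"

definition drawing :: "'v graph \<Rightarrow> ('v \<Rightarrow> 's) \<Rightarrow> ('v set \<Rightarrow> real \<Rightarrow> 's) \<Rightarrow> 's set" where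
  "drawing G loc \<gamma> = loc ` verts G \<union> (\<Union>e \<in> edges G. \<gamma> e ` {0..1})"

text \<open>Vertices are distinct points, edges are simple arcs joining their ends, and the interior
  of an edge meets no vertex and no other edge.\<close>

definition embedded_graph ::
  "'s topology \<Rightarrow> 'v graph \<Rightarrow> ('v \<Rightarrow> 's) \<Rightarrow> ('v set \<Rightarrow> real \<Rightarrow> 's) \<Rightarrow> bool" where
  "embedded_graph X G loc \<gamma> \<longleftrightarrow>
     simple_graph G \<and> inj_on loc (verts G) \<and> loc ` verts G \<subseteq> topspace X \<and>
     (\<forall>e \<in> edges G.
        embedding_map (top_of_set {0..1}) X (\<gamma> e) \<and>
        {\<gamma> e 0, \<gamma> e 1} = loc ` e \<and>
        \<gamma> e ` {0<..<1} \<inter> loc ` verts G = {}) \<and>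
     (\<forall>e \<in> edges G. \<forall>f \<in> edges G. e \<noteq> f \<longrightarrow>
        \<gamma> e ` {0<..<1} \<inter> \<gamma> f ` {0<..<1} = {})"

definition faces ::
  "'s topology \<Rightarrow> 'v graph \<Rightarrow> ('v \<Rightarrow> 's) \<Rightarrow> ('v set \<Rightarrow> real \<Rightarrow> 's) \<Rightarrow> 's set set" where
  "faces X G loc \<gamma> =
     connected_components_of (subtopology X (topspace X - drawing G loc \<gamma>))"

definition cellular_embedding ::
  "'s topology \<Rightarrow> 'v graph \<Rightarrow> ('v \<Rightarrow> 's) \<Rightarrow> ('v set \<Rightarrow> real \<Rightarrow> 's) \<Rightarrow> bool" where
  "cellular_embedding X G loc \<gamma> \<longleftrightarrow>
     embedded_graph X G loc \<gamma> \<and> finite (faces X G loc \<gamma>) \<and>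
     (\<forall>F \<in> faces X G loc \<gamma>.
        subtopology X F homeomorphic_space top_of_set (ball (0::complex) 1))"

text \<open>The Euler genus of a surface is \<open>2 - \<chi>\<close>, where the Euler characteristic \<open>\<chi>\<close> is
  \<open>|V| - |E| + |F|\<close> for a cell decomposition. Every surface has such a decomposition, and the
  number does not depend on it, so that for each surface exactly one \<open>h\<close> qualifies.\<close>

definition has_euler_genus :: "'s topology \<Rightarrow> nat \<Rightarrow> bool" where
  "has_euler_genus X h \<longleftrightarrow>
     (\<exists>(H :: nat graph) loc \<gamma>. cellular_embedding X H loc \<gamma> \<and>
        int (card (verts H)) - int (card (edges H)) + int (card (faces X H loc \<gamma>))
          = 2 - int h)"


section \<open>Almost embeddable graphs\<close>

text \<open>A closed disc \<open>D\<close> in \<open>X\<close> is given by a homeomorphism \<open>\<phi>\<close> from the closed unit disc of the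
  complex plane onto \<open>D\<close>; then the images of the open unit disc and of the unit circle are
  the interior and the boundary of \<open>D\<close>. In \<open>disc_for_vortex\<close> the listed vertices occur on the
  boundary in the cyclic order of \<open>\<Omega>\<close>. As \<open>\<phi>\<close> can be composed with rotations and a reflection,
  neither the starting point nor the direction of travel matters.\<close>

definition closed_disc :: "'s topology \<Rightarrow> (complex \<Rightarrow> 's) \<Rightarrow> bool" where
  "closed_disc X \<phi> \<longleftrightarrow> embedding_map (top_of_set (cball 0 1)) X \<phi>"

definition disc_for_vortex ::
  "'v graph \<Rightarrow> ('v \<Rightarrow> 's) \<Rightarrow> ('v set \<Rightarrow> real \<Rightarrow> 's) \<Rightarrow> 'v list \<Rightarrow> (complex \<Rightarrow> 's) \<Rightarrow> bool" where
  "disc_for_vortex G0 loc \<gamma> \<Omega> \<phi> \<longleftrightarrow>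
     \<phi> ` ball 0 1 \<inter> drawing G0 loc \<gamma> = {} \<and>
     \<phi> ` sphere 0 1 \<inter> drawing G0 loc \<gamma> \<subseteq> loc ` verts G0 \<and>
     \<phi> ` sphere 0 1 \<inter> loc ` verts G0 = loc ` set \<Omega> \<and>
     (\<exists>\<theta> :: nat \<Rightarrow> real.
        strict_mono_on {..<length \<Omega>} \<theta> \<and>
        (\<forall>j < length \<Omega>. 0 \<le> \<theta> j \<and> \<theta> j < 2 * pi \<and> loc (\<Omega> ! j) = \<phi> (cis (\<theta> j))))"

text \<open>Surfaces are taken on the point type \<open>complex \<times> complex\<close>. This is no restriction: the topology
  \<open>X\<close> is arbitrary (not necessarily induced by the Euclidean one), its carrier may be any subset
  of the type, and a surface has exactly continuum many points.\<close>

definition almost_embeddable :: "nat \<Rightarrow> nat \<Rightarrow> nat \<Rightarrow> 'v graph set" where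
  "almost_embeddable g p k =
     {G. \<exists>(X :: (complex \<times> complex) topology) h G0 loc \<gamma> q
           (Gs :: nat \<Rightarrow> 'v graph) (\<Omega>s :: nat \<Rightarrow> 'v list) (\<phi>s :: nat \<Rightarrow> complex \<Rightarrow> complex \<times> complex).
        surface X \<and> has_euler_genus X h \<and> h \<le> g \<and>
        embedded_graph X G0 loc \<gamma> \<and>
        q \<le> p \<and>
        (\<forall>i<q. is_vortex (Gs i) (\<Omega>s i) \<and> vortex_width (Gs i) (\<Omega>s i) \<le> k) \<and>
        G = \<lparr>verts = verts G0 \<union> (\<Union>i<q. verts (Gs i)),
             edges = edges G0 \<union> (\<Union>i<q. edges (Gs i))\<rparr> \<and>
        (\<forall>i<q. \<forall>j<q. i \<noteq> j \<longrightarrow> verts (Gs i) \<inter> verts (Gs j) = {}) \<and>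
        (\<forall>i<q. verts (Gs i) \<inter> verts G0 = set (\<Omega>s i)) \<and>
        (\<forall>i<q. closed_disc X (\<phi>s i)) \<and>
        (\<forall>i<q. \<forall>j<q. i \<noteq> j \<longrightarrow> \<phi>s i ` cball 0 1 \<inter> \<phi>s j ` cball 0 1 = {}) \<and>
        (\<forall>i<q. disc_for_vortex G0 loc \<gamma> (\<Omega>s i) (\<phi>s i))}"

definition apex_almost_embeddable :: "nat \<Rightarrow> nat \<Rightarrow> nat \<Rightarrow> nat \<Rightarrow> 'v graph set" where
  "apex_almost_embeddable g p k a =
     {G. simple_graph G \<and>
         (\<exists>A \<subseteq> verts G. card A \<le> a \<and> delete_verts G A \<in> almost_embeddable g p k)}"

end

theory Submission
  imports Defs "HOL-Complex_Analysis.Riemann_Mapping" "HOL-Library.Discrete_Functions"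
begin

text \<open>Two constructions give a minor \<open>K\<^bsub>km\<^esub>\<close>; apex vertices then add \<open>a\<close>.

  If \<open>m\<^sup>2 \<le> p\<close>, put vortices on the sphere at the nodes of an \<open>m\<close> by \<open>m\<close> grid and lead \<open>k\<close> tracks
  along each row and each column. In a vortex, half of the tracks of either line pass on each side;
  hence width \<open>k\<close> suffices for all \<open>2k\<close> tracks to cross, and every track of the row meets every track
  of the column. Row \<open>i\<close> and column \<open>i\<close> together give \<open>k\<close> branch sets.

  If \<open>2m\<^sup>2 \<le> g\<close>, one vortex is enough. Its boundary is divided into groups
  \<open>A\<^sub>1, \<dots>, A\<^sub>m, B\<^sub>1, \<dots>, B\<^sub>m\<close> with \<open>k\<close> tracks each, and \<open>k\<^sup>2\<close> edges run from \<open>A\<^sub>i\<close> to \<open>B\<^sub>j\<close> through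
  the hole \<open>(i, j)\<close> of a surface that is the double of a square with \<open>m\<^sup>2\<close> square holes: they are
  vertical in the upper sheet and of slope 1 in the lower sheet, so that they leave the vortex
  ordered by \<open>(i, j)\<close> and come back ordered by \<open>(j, i)\<close>. The tracks of \<open>A\<^sub>i\<close> and \<open>B\<^sub>i\<close> together
  give \<open>k\<close> branch sets.

  The double consists of the graphs of \<open>h\<close> and \<open>-h\<close>, where \<open>h\<close> is a continuous function that vanishes
  exactly at the boundary of the square with holes. So it is a compact subset of \<open>\<complex>\<^sup>2\<close>, and
  reflections in the boundary squares give its charts. After a slit from each hole to the outer
  boundary, either sheet is an open disc by the Riemann mapping theorem; this yields the Euler
  genus.\<close>

section \<open>The double of a square with square holes\<close>

text \<open>Glued along the outer square alone, the two sheets form a sphere. Each hole adds a tube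
  between them, worth 2 in Euler genus; hence \<open>m^2\<close> holes cost \<open>2 * m^2\<close>.

  Width \<open>k\<close> allows \<open>k + 1\<close> vertices in a bag. In the one-vortex
  construction a bag holds a rim vertex and the \<open>k\<close> tracks of its group, so different
  groups never share a bag. Every contact between groups must then be an edge of the surface, and
  \<open>k^2\<close> edges for each pair of groups provide one for each pair of tracks.

  The factor 1/4 pays for rounding: \<open>k * m \<ge> 1 / 4 * k * sqrt (p + g)\<close> amounts to
  \<open>p + g \<le> 16 * m^2\<close>. If the integer part of \<open>sqrt p\<close> fails this test,
  then \<open>g\<close> is more than \<open>3 * p\<close>, and the integer part of
  \<open>sqrt (g / 2)\<close> passes with room to spare.

  Surfaces, curves and discs have to be given as actual maps. The shapes are therefore chosen so
  that most claims of disjointness become linear arithmetic: square holes with disjoint shadows on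
  the real axis, vertical and diagonal ribbons, axis-parallel links between unit discs.\<close>

definition sqn :: "complex \<Rightarrow> real" where
  "sqn z = max \<bar>Re z\<bar> \<bar>Im z\<bar>"

lemma sqn_0 [simp]: "sqn 0 = 0"
  and sqn_ge_0 [simp]: "0 \<le> sqn z"
  and sqn_eq_0_iff [simp]: "sqn z = 0 \<longleftrightarrow> z = 0"
  by (auto simp: sqn_def complex_eq_iff max_def)

lemma sqn_of_real_mult: "sqn (of_real t * z) = \<bar>t\<bar> * sqn z"
  by (auto simp: sqn_def abs_mult max_def mult_left_mono dest: mult_left_le_imp_le
      intro: antisym mult_left_mono)

lemma continuous_on_sqn [continuous_intros]:
  "continuous_on A f \<Longrightarrow> continuous_on A (\<lambda>x. sqn (f x))"
  unfolding sqn_def by (intro continuous_intros)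

lemma abs_Re_le_sqn: "\<bar>Re z\<bar> \<le> sqn z" and abs_Im_le_sqn: "\<bar>Im z\<bar> \<le> sqn z"
  by (auto simp: sqn_def)

lemma norm_le_sqn: "norm z \<le> 2 * sqn z"
  using cmod_le[of z] by (simp add: sqn_def)

text \<open>Inversion in the square of half-side \<open>\<rho>\<close> around \<open>c\<close>:
  points move along rays from \<open>c\<close>, and distance \<open>t\<close> in the maximum norm
  becomes \<open>\<rho>^2 / t\<close>. The boundary of the square is fixed.\<close>

definition sq_inv :: "complex \<Rightarrow> real \<Rightarrow> complex \<Rightarrow> complex" where
  "sq_inv c \<rho> z = c + of_real (\<rho>\<^sup>2 / (sqn (z - c))\<^sup>2) * (z - c)"

lemma sqn_sq_inv: "sqn (sq_inv c \<rho> z - c) = \<rho>\<^sup>2 / sqn (z - c)"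
  unfolding sq_inv_def add_diff_cancel_left' sqn_of_real_mult
  by (simp add: power2_eq_square)

lemma sq_inv_sq_inv:
  assumes "z \<noteq> c" "\<rho> \<noteq> 0"
  shows "sq_inv c \<rho> (sq_inv c \<rho> z) = z"
proof -
  have n: "sqn (z - c) \<noteq> 0" using assms by simp
  have "\<rho>\<^sup>2 / (\<rho>\<^sup>2 / sqn (z - c))\<^sup>2 * (\<rho>\<^sup>2 / (sqn (z - c))\<^sup>2) = 1"
    using assms n by (simp add: divide_simps power2_eq_square)
  then have "of_real (\<rho>\<^sup>2 / (\<rho>\<^sup>2 / sqn (z - c))\<^sup>2) * (of_real (\<rho>\<^sup>2 / (sqn (z - c))\<^sup>2) * (z - c)) = z - c"
    by (metis mult.assoc mult_1 of_real_1 of_real_mult)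
  moreover have "sq_inv c \<rho> z - c = of_real (\<rho>\<^sup>2 / (sqn (z - c))\<^sup>2) * (z - c)"
    by (simp add: sq_inv_def)
  ultimately have "sq_inv c \<rho> (sq_inv c \<rho> z) = c + (z - c)"
    by (metis sq_inv_def sqn_sq_inv)
  then show ?thesis by simp
qed

lemma sq_inv_fixed: "sqn (z - c) = \<rho> \<Longrightarrow> \<rho> \<noteq> 0 \<Longrightarrow> sq_inv c \<rho> z = z"
  by (simp add: sq_inv_def)

lemma continuous_on_sq_inv:
  assumes "c \<notin> A" shows "continuous_on A (sq_inv c \<rho>)"
  unfolding sq_inv_def using assms by (auto intro!: continuous_intros)

lemma homeomorphic_space_top_of_set:
  "homeomorphism S T f g \<Longrightarrow> top_of_set S homeomorphic_space top_of_set T"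
  unfolding homeomorphism_def homeomorphic_space_def homeomorphic_maps_def
  by (intro exI[of _ f] exI[of _ g]) auto

abbreviation disc_neighbourhood :: "'a::topological_space set \<Rightarrow> 'a \<Rightarrow> bool" where
  "disc_neighbourhood S x \<equiv> \<exists>U. openin (top_of_set S) U \<and> x \<in> U \<and>
     subtopology (top_of_set S) U homeomorphic_space top_of_set (ball (0::complex) 1)"

text \<open>\<open>surface\<close> asks for neighbourhoods homeomorphic to the unit disc, whereas
  the charts below have arbitrary open images; a small ball around the image of \<open>x\<close> is
  pulled back.\<close>

lemma chart_ball:
  fixes V :: "complex set"
  assumes U: "openin (top_of_set S) U" "U homeomorphic V" "open V" "x \<in> U"
  shows "disc_neighbourhood S x"
proof -
  obtain f g where fg: "homeomorphism U V f g"
    using U(2) unfolding homeomorphic_def by blast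
  have "f x \<in> V" using fg U(4) by (auto simp: homeomorphism_def)
  then obtain e where e: "e > 0" "ball (f x) e \<subseteq> V"
    using U(3) by (meson openE)
  let ?U = "g ` ball (f x) e"
  have h: "homeomorphism (ball (f x) e) ?U g f"
    using homeomorphism_of_subsets[OF homeomorphism_symD[OF fg] e(2) _ refl]
      fg unfolding homeomorphism_def using e(2) by (auto simp: image_subset_iff)
  have "openin (top_of_set V) (ball (f x) e)"
    using e(2) by (simp add: U(3) openin_open_eq)
  then have "openin (top_of_set U) ?U"
    using homeomorphism_imp_open_map[OF homeomorphism_symD[OF fg]] by blast
  then have o: "openin (top_of_set S) ?U"
    using U(1) openin_trans by blast
  have "x \<in> ?U"
    using fg U(4) e(1) unfolding homeomorphism_def by (metis centre_in_ball image_eqI)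
  moreover have "?U homeomorphic ball (0::complex) 1"
    using homeomorphic_balls(1)[OF e(1) zero_less_one, of "f x" "0::complex"] h
    by (meson homeomorphic_def homeomorphic_sym homeomorphic_trans)
  then have "subtopology (top_of_set S) ?U homeomorphic_space top_of_set (ball (0::complex) 1)"
    using openin_imp_subset[OF o]
    using homeomorphic_space_top_of_set unfolding homeomorphic_def
    by (auto simp: subtopology_subtopology Int_absorb1)
  ultimately show ?thesis using o by blast
qed

text \<open>The margins \<open>2 * r\<close> leave a collar of width \<open>r\<close> between a hole
  and the outer square, which a reflection needs. The gap \<open>3 * r\<close> keeps the shadows of
  the holes on the real axis at least \<open>r\<close> apart, so a vertical line through one hole
  misses all others and there is room to pass between neighbours.\<close>

locale square_holes =
  fixes M :: nat and L r :: real and c :: "nat \<Rightarrow> complex"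
  assumes r_pos: "0 < r" and r_less: "r < L"
    and c_Re: "s < M \<Longrightarrow> \<bar>Re (c s)\<bar> + 2 * r \<le> L"
    and c_Im: "s < M \<Longrightarrow> \<bar>Im (c s)\<bar> + 2 * r \<le> L"
    and c_gap: "s < s' \<Longrightarrow> s' < M \<Longrightarrow> Re (c s) + 3 * r \<le> Re (c s')"
begin

definition sheet :: "complex set" where
  "sheet = {z. sqn z \<le> L \<and> (\<forall>s<M. r \<le> sqn (z - c s))}"

definition isheet :: "complex set" where
  "isheet = {z. sqn z < L \<and> (\<forall>s<M. r < sqn (z - c s))}"

definition ht :: "complex \<Rightarrow> real" where
  "ht z = (L - sqn z) * (\<Prod>s<M. sqn (z - c s) - r)"

definition up :: "complex \<Rightarrow> complex \<times> complex" where
  "up z = (z, of_real (ht z))"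

definition dn :: "complex \<Rightarrow> complex \<times> complex" where
  "dn z = (z, - of_real (ht z))"

definition surf :: "(complex \<times> complex) set" where
  "surf = up ` sheet \<union> dn ` sheet"

lemma L_pos: "0 < L" using r_pos r_less by simp

lemma isheet_subset_sheet: "isheet \<subseteq> sheet"
  by (auto simp: isheet_def sheet_def intro: less_imp_le)

lemma ht_nonneg: "z \<in> sheet \<Longrightarrow> 0 \<le> ht z"
  by (auto simp: ht_def sheet_def intro!: mult_nonneg_nonneg prod_nonneg)

lemma ht_eq_0_iff: "z \<in> sheet \<Longrightarrow> ht z = 0 \<longleftrightarrow> z \<notin> isheet"
  by (auto simp: ht_def sheet_def isheet_def order.order_iff_strict dest: sym)

lemma ht_pos: "z \<in> isheet \<Longrightarrow> 0 < ht z"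
  using ht_nonneg ht_eq_0_iff isheet_subset_sheet by (metis order.order_iff_strict subsetD)

lemma continuous_on_ht [continuous_intros]: 
  "continuous_on A f \<Longrightarrow> continuous_on A (\<lambda>x. ht (f x))"
  unfolding ht_def by (intro continuous_intros)

lemma continuous_on_up [continuous_intros]: 
  "continuous_on A f \<Longrightarrow> continuous_on A (\<lambda>x. up (f x))"
  unfolding up_def by (intro continuous_intros)

lemma continuous_on_dn [continuous_intros]: 
  "continuous_on A f \<Longrightarrow> continuous_on A (\<lambda>x. dn (f x))"
  unfolding dn_def by (intro continuous_intros)

lemma fst_up [simp]: "fst (up z) = z" and fst_dn [simp]: "fst (dn z) = z"
  by (simp_all add: up_def dn_def)

lemma up_inj [simp]: "up z = up z' \<longleftrightarrow> z = z'" and dn_inj [simp]: "dn z = dn z' \<longleftrightarrow> z = z'"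
  by (auto simp: up_def dn_def)

lemma up_eq_dn_iff: "z \<in> sheet \<Longrightarrow> up z = dn z' \<longleftrightarrow> z = z' \<and> z \<notin> isheet"
  by (auto simp: up_def dn_def ht_eq_0_iff[symmetric])

lemma up_eq_dn: "z \<in> sheet \<Longrightarrow> z \<notin> isheet \<Longrightarrow> up z = dn z"
  by (simp add: up_eq_dn_iff)

lemma closed_sheet: "closed sheet"
proof -
  have "sheet = {z. sqn z \<le> L} \<inter> (\<Inter>s\<in>{..<M}. {z. r \<le> sqn (z - c s)})"
    by (auto simp: sheet_def)
  then show ?thesis
    by (auto intro!: closed_Int closed_INT closed_Collect_le continuous_intros)
qed

lemma open_isheet: "open isheet"
proof -
  have "isheet = {z. sqn z < L} \<inter> (\<Inter>s\<in>{..<M}. {z. r < sqn (z - c s)})"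
    by (auto simp: isheet_def)
  then show ?thesis
    by (auto intro!: open_Int open_INT open_Collect_less continuous_intros)
qed

lemma compact_sheet: "compact sheet"
proof -
  have "bounded sheet"
    unfolding bounded_iff
    by (rule exI[of _ "2 * L"]) (auto simp: sheet_def intro: order_trans[OF norm_le_sqn])
  then show ?thesis using closed_sheet by (simp add: compact_eq_bounded_closed)
qed

lemma compact_surf: "compact surf"
  unfolding surf_def
  by (intro compact_Un compact_continuous_image compact_sheet continuous_intros)

lemma surf_cases:
  assumes "p \<in> surf"
  obtains (up) z where "z \<in> sheet" "p = up z" | (dn) z where "z \<in> sheet" "p = dn z"
  using assms by (auto simp: surf_def)

lemma Re_snd_up [simp]: "Re (snd (up z)) = ht z" and Re_snd_dn [simp]: "Re (snd (dn z)) = - ht z"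
  by (simp_all add: up_def dn_def)

lemma homeomorphism_up: "A \<subseteq> sheet \<Longrightarrow> homeomorphism A (up ` A) up fst"
  and homeomorphism_dn: "A \<subseteq> sheet \<Longrightarrow> homeomorphism A (dn ` A) dn fst"
  by (auto simp: homeomorphism_def image_image intro!: continuous_intros)

text \<open>Unfolding the surface along a boundary component: the lower sheet is moved by the
  reflection \<open>\<iota>\<close> to the other side of the component.\<close>

lemma reflection_chart:
  assumes W: "open W" and cont: "continuous_on W \<iota>"
    and inv: "\<And>z. z \<in> W \<Longrightarrow> \<iota> z \<in> W" "\<And>z. z \<in> W \<Longrightarrow> \<iota> (\<iota> z) = z"
    and cover: "\<And>z. z \<in> W \<Longrightarrow> z \<in> sheet \<or> \<iota> z \<in> sheet"
    and both: "\<And>z. z \<in> W \<Longrightarrow> z \<in> sheet \<Longrightarrow> \<iota> z \<in> sheet \<longleftrightarrow> z \<notin> isheet"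
    and fixed: "\<And>z. z \<in> W \<Longrightarrow> z \<in> sheet \<Longrightarrow> z \<notin> isheet \<Longrightarrow> \<iota> z = z"
    and p: "p \<in> surf" "fst p \<in> W"
  shows "disc_neighbourhood surf p"
proof -
  define U where "U = surf \<inter> fst -` W"
  \<comment> \<open>The test has the form in which \<open>continuous_on_cases_le\<close> glues two
    branches. They agree where the second coordinate is 0, since such points lie on the boundary and
    are fixed by \<open>\<iota>\<close>.\<close>
  define f where "f = (\<lambda>p. if - Re (snd p) \<le> 0 then fst p else \<iota> (fst p))"
  define g where "g = (\<lambda>z. if z \<in> sheet then up z else dn (\<iota> z))"
  have U: "openin (top_of_set surf) U"
    unfolding U_def by (intro continuous_openin_preimage_gen W continuous_intros)
  have f_up: "f (up z) = z" if "z \<in> sheet" for z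
    using that ht_nonneg by (simp add: f_def)
  have f_dn: "f (dn z) = \<iota> z" if "z \<in> sheet" "z \<in> W" for z
    using that ht_eq_0_iff[of z] ht_nonneg[of z] fixed[of z] by (auto simp: f_def)
  have g_dn: "g (\<iota> z) = dn z" if "z \<in> sheet" "z \<in> W" for z
    using both[OF that(2,1)] fixed[OF that(2,1)] that inv up_eq_dn[of z] by (auto simp: g_def)
  have contf: "continuous_on U f"
  proof -
    show ?thesis
      unfolding f_def
      by (rule continuous_on_cases_le)
        (use fixed ht_eq_0_iff in \<open>auto simp: U_def elim!: surf_cases
          intro!: continuous_intros continuous_on_compose2[OF cont]\<close>)
  qed
  have contg: "continuous_on W g"
  proof -
    have cl: "closedin (top_of_set W) (W \<inter> sheet)" "closedin (top_of_set W) (W \<inter> \<iota> -` sheet)"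
      by (simp_all add: closed_sheet cont closedin_closed_Int continuous_closedin_preimage)
    have eq: "W = (W \<inter> sheet) \<union> (W \<inter> \<iota> -` sheet)" using cover by auto
    have "continuous_on ((W \<inter> sheet) \<union> (W \<inter> \<iota> -` sheet)) g"
      unfolding g_def
    proof (rule continuous_on_cases_local)
      show "closedin (top_of_set (W \<inter> sheet \<union> W \<inter> \<iota> -` sheet)) (W \<inter> sheet)"
        "closedin (top_of_set (W \<inter> sheet \<union> W \<inter> \<iota> -` sheet)) (W \<inter> \<iota> -` sheet)"
        using cl eq by simp_all
    qed (use both fixed up_eq_dn in \<open>auto intro!: continuous_intros 
           continuous_on_subset[OF cont]\<close>)
    then show ?thesis using eq by simp
  qed
  have "homeomorphism U W f g"
  proof (rule homeomorphismI[OF contf contg])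
    show "f ` U \<subseteq> W"
      using f_up f_dn inv by (auto simp: U_def elim!: surf_cases)
    show "g ` W \<subseteq> U"
    proof
      fix q assume "q \<in> g ` W"
      then obtain z where z: "z \<in> W" "q = g z" by blast
      show "q \<in> U"
        using cover[OF z(1)] inv(1)[OF z(1)] z
        by (cases "z \<in> sheet") (auto simp: U_def g_def surf_def)
    qed
    show "g (f p) = p" if "p \<in> U" for p
      using that f_up f_dn g_dn by (auto simp: U_def elim!: surf_cases) (simp add: g_def)
    show "f (g z) = z" if "z \<in> W" for z
      using that f_up f_dn inv cover[of z] by (auto simp: g_def)
  qed
  then show ?thesis
    using chart_ball[OF U _ W, of p] p unfolding homeomorphic_def U_def by blast
qed

lemma near_hole:
  assumes "s < M" "sqn (z - c s) < 2 * r"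
  shows "sqn z < L" and "s' < M \<Longrightarrow> s' \<noteq> s \<Longrightarrow> r < sqn (z - c s')"
proof -
  show "sqn z < L"
    using assms c_Re[of s] c_Im[of s] by (auto simp: sqn_def)
  show "r < sqn (z - c s')" if "s' < M" "s' \<noteq> s"
    using assms that c_gap[of s s'] c_gap[of s' s] abs_Re_le_sqn[of "z - c s"]
      abs_Re_le_sqn[of "z - c s'"] by (cases "s < s'") auto
qed

lemma near_outside: "L - r < sqn z \<Longrightarrow> s < M \<Longrightarrow> r < sqn (z - c s)"
  using c_Re[of s] c_Im[of s] by (auto simp: sqn_def max_def split: if_splits)

text \<open>By \<open>\<alpha> * \<beta> = \<rho>^2\<close> the square annulus \<open>W\<close> is
  invariant under the inversion. The two alternatives of \<open>side\<close> are a hole, with the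
  sheet outside the square, and the outer boundary, with the sheet inside.\<close>

lemma square_reflection_chart:
  fixes d :: complex
  assumes \<rho>: "0 < \<rho>" and ab: "0 < \<alpha>" "\<alpha> * \<beta> = \<rho>\<^sup>2"
  defines "W \<equiv> {z. \<alpha> < sqn (z - d) \<and> sqn (z - d) < \<beta>}"
  assumes side: "(\<forall>z\<in>W. (z \<in> sheet \<longleftrightarrow> \<rho> \<le> sqn (z - d)) \<and> (z \<in> isheet \<longleftrightarrow> \<rho> < sqn (z - d))) \<or>
      (\<forall>z\<in>W. (z \<in> sheet \<longleftrightarrow> sqn (z - d) \<le> \<rho>) \<and> (z \<in> isheet \<longleftrightarrow> sqn (z - d) < \<rho>))"
    and p: "p \<in> surf" "fst p \<in> W"
  shows "disc_neighbourhood surf p"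
proof (rule reflection_chart[OF _ _ _ _ _ _ _ p, of "sq_inv d \<rho>"])
  have pos: "0 < sqn (z - d)" if "z \<in> W" for z
    using that ab(1) by (auto simp: W_def)
  have le: "\<rho> \<le> \<rho>\<^sup>2 / t \<longleftrightarrow> t \<le> \<rho>" "\<rho>\<^sup>2 / t \<le> \<rho> \<longleftrightarrow> \<rho> \<le> t" if "0 < t" for t
    using \<rho> that by (simp_all add: field_simps power2_eq_square)
  have "W = {z. \<alpha> < sqn (z - d)} \<inter> {z. sqn (z - d) < \<beta>}"
    by (auto simp: W_def)
  then show "open W"
    by (auto intro!: open_Int open_Collect_less continuous_intros)
  show "continuous_on W (sq_inv d \<rho>)"
    using pos by (intro continuous_on_sq_inv) fastforce
  show inW: "sq_inv d \<rho> z \<in> W" if "z \<in> W" for z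
  proof -
    let ?t = "sqn (z - d)"
    have t: "\<alpha> < ?t" "?t < \<beta>" using that by (auto simp: W_def)
    then have "\<alpha> * ?t < \<rho>\<^sup>2" "\<rho>\<^sup>2 < ?t * \<beta>"
      using ab mult_strict_left_mono[of ?t \<beta> \<alpha>] mult_strict_right_mono[of \<alpha> ?t \<beta>] by auto
    then show ?thesis
      using pos[OF that] by (simp add: W_def sqn_sq_inv less_divide_eq divide_less_eq mult.commute)
  qed
  fix z assume z: "z \<in> W"
  note t = le[OF pos[OF z]]
  show "sq_inv d \<rho> (sq_inv d \<rho> z) = z"
    using pos[OF z] \<rho> by (intro sq_inv_sq_inv) auto
  have side_z: "(z \<in> sheet \<longleftrightarrow> \<rho> \<le> sqn (z - d)) \<and> (z \<in> isheet \<longleftrightarrow> \<rho> < sqn (z - d)) \<and>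
        (sq_inv d \<rho> z \<in> sheet \<longleftrightarrow> sqn (z - d) \<le> \<rho>) \<or>
      (z \<in> sheet \<longleftrightarrow> sqn (z - d) \<le> \<rho>) \<and> (z \<in> isheet \<longleftrightarrow> sqn (z - d) < \<rho>) \<and>
        (sq_inv d \<rho> z \<in> sheet \<longleftrightarrow> \<rho> \<le> sqn (z - d))"
    using side z inW[OF z] t unfolding sqn_sq_inv[of d, symmetric] by blast
  then show "z \<in> sheet \<or> sq_inv d \<rho> z \<in> sheet" by linarith
  assume s: "z \<in> sheet"
  show "sq_inv d \<rho> z \<in> sheet \<longleftrightarrow> z \<notin> isheet"
    using side_z s by auto
  show "sq_inv d \<rho> z = z" if "z \<notin> isheet"
    using side_z s that \<rho> by (intro sq_inv_fixed) auto
qed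

text \<open>Off the boundary the sign of the second coordinate tells the sheets apart, so either
  lift of \<open>isheet\<close> is open in \<open>surf\<close>.\<close>

lemma chart_sheet:
  assumes "z \<in> isheet" "p = up z \<or> p = dn z"
  shows "disc_neighbourhood surf p"
proof -
  have pos: "z \<in> isheet" if "z \<in> sheet" "ht z \<noteq> 0" for z
    using that ht_eq_0_iff by blast
  have neg: "\<not> ht z < 0" if "z \<in> sheet" for z
    using ht_nonneg[OF that] by simp
  have "up ` isheet = surf \<inter> (\<lambda>p. Re (snd p)) -` {0<..}"
    using ht_pos pos isheet_subset_sheet by (auto simp: surf_def neg)
  moreover have "dn ` isheet = surf \<inter> (\<lambda>p. Re (snd p)) -` {..<0}"
    using ht_pos pos isheet_subset_sheet by (auto simp: surf_def neg)
  ultimately have o: "openin (top_of_set surf) (up ` isheet)" "openin (top_of_set surf) (dn ` isheet)"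
    by (auto intro!: continuous_openin_preimage_gen continuous_intros)
  have h: "up ` isheet homeomorphic isheet" "dn ` isheet homeomorphic isheet"
    using homeomorphism_up[OF isheet_subset_sheet] homeomorphism_dn[OF isheet_subset_sheet]
      homeomorphic_sym unfolding homeomorphic_def by blast+
  show ?thesis
    using assms chart_ball[OF o(1) h(1) open_isheet, of p]
      chart_ball[OF o(2) h(2) open_isheet, of p] by blast
qed

lemma locally_disc:
  assumes p: "p \<in> surf"
  shows "disc_neighbourhood surf p"
proof -
  define z where "z = fst p"
  have z: "z \<in> sheet" "p = up z \<or> p = dn z"
    using p by (auto simp: z_def elim!: surf_cases)
  consider "z \<in> isheet" | s where "s < M" "sqn (z - c s) = r" | "sqn z = L"
    using z(1) by (force simp: isheet_def sheet_def)
  then show ?thesis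
  proof cases
    case 1
    then show ?thesis using chart_sheet z(2) by blast
  next
    case (2 s)
    have near: "(z \<in> sheet \<longleftrightarrow> r \<le> sqn (z - c s)) \<and> (z \<in> isheet \<longleftrightarrow> r < sqn (z - c s))"
      if "sqn (z - c s) < 2 * r" for z
    proof -
      note n = near_hole[OF \<open>s < M\<close> that]
      have "r \<le> sqn (z - c s) \<Longrightarrow> s' < M \<Longrightarrow> r \<le> sqn (z - c s')"
        "r < sqn (z - c s) \<Longrightarrow> s' < M \<Longrightarrow> r < sqn (z - c s')" for s'
        using n(2)[of s'] by (cases "s' = s"; simp)+
      then show ?thesis
        using n(1) \<open>s < M\<close> unfolding sheet_def isheet_def by auto
    qed
    show ?thesis
      \<comment> \<open>The radius \<open>2 * r\<close> is what \<open>near_hole\<close> allows, and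
        \<open>r / 2\<close> is its mirror image.\<close>
      by (rule square_reflection_chart[of r "r / 2" "2 * r" "c s"])
        (use near p 2 r_pos in \<open>auto simp: power2_eq_square z_def\<close>)
  next
    case 3
    have near: "(z \<in> sheet \<longleftrightarrow> sqn (z - 0) \<le> L) \<and> (z \<in> isheet \<longleftrightarrow> sqn (z - 0) < L)"
      if "L - r < sqn (z - 0)" for z
      using near_outside[of z] that by (auto simp: sheet_def isheet_def intro: less_imp_le)
    have "L * (L - r) < L\<^sup>2"
      using r_pos L_pos by (simp add: power2_eq_square)
    then have "L < L\<^sup>2 / (L - r)" using r_less by (simp add: less_divide_eq)
    then show ?thesis
      \<comment> \<open>\<open>L - r\<close> keeps the annulus away from all holes by
        \<open>near_outside\<close>; the outer radius is its mirror image.\<close>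
      by (intro square_reflection_chart[of L "L - r" "L\<^sup>2 / (L - r)" 0])
        (use near p 3 r_pos r_less L_pos in \<open>auto simp: z_def\<close>)
  qed
qed

end

section \<open>Connectedness of the surface\<close>

lemma segment_horizontal:
  "w \<in> closed_segment (Complex x y) (Complex x' y) \<longleftrightarrow> Im w = y \<and> min x x' \<le> Re w \<and> Re w \<le> max x x'"
  by (auto simp: closed_segment_same_Im closed_segment_eq_real_ivl)

lemma segment_vertical:
  "w \<in> closed_segment (Complex x y) (Complex x y') \<longleftrightarrow> Re w = x \<and> min y y' \<le> Im w \<and> Im w \<le> max y y'"
  by (auto simp: closed_segment_same_Re closed_segment_eq_real_ivl)

text \<open>The line at height \<open>b\<close> is the spine of a comb; each point reaches it by a
  horizontal move followed by a vertical one.\<close>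

lemma connected_comb:
  fixes S :: "complex set"
  assumes comb: "\<And>z. z \<in> S \<Longrightarrow> \<exists>x. closed_segment z (Complex x (Im z)) \<subseteq> S \<and>
        closed_segment (Complex x (Im z)) (Complex x b) \<subseteq> S"
    and spine: "\<And>x x'. Complex x b \<in> S \<Longrightarrow> Complex x' b \<in> S \<Longrightarrow>
        closed_segment (Complex x b) (Complex x' b) \<subseteq> S"
  shows "connected S"
proof -
  have seg: "connected_component S z w" if "closed_segment z w \<subseteq> S" for z w
    using that by (meson connected_component_def connected_segment ends_in_segment)
  have foot: "\<exists>x. Complex x b \<in> S \<and> connected_component S z (Complex x b)" if "z \<in> S" for z
    using comb[OF that] seg by (meson connected_component_trans connected_component_in)
  have "connected_component S z w" if zw: "z \<in> S" "w \<in> S" for z w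
  proof -
    obtain x y where "Complex x b \<in> S" "connected_component S z (Complex x b)"
      "Complex y b \<in> S" "connected_component S w (Complex y b)"
      using foot zw by meson
    with seg[OF spine] show ?thesis
      by (meson connected_component_trans connected_component_sym)
  qed
  then show ?thesis by (simp add: connected_iff_connected_component)
qed

context square_holes
begin

lemma less_sqn_iff: "t < sqn z \<longleftrightarrow> t < \<bar>Re z\<bar> \<or> t < \<bar>Im z\<bar>"
  and le_sqn_iff: "t \<le> sqn z \<longleftrightarrow> t \<le> \<bar>Re z\<bar> \<or> t \<le> \<bar>Im z\<bar>"
  by (auto simp: sqn_def)

lemma gap_cases:
  assumes "s < M" "s' < M"
  obtains "s' = s" | "Re (c s) + 3 * r \<le> Re (c s')" | "Re (c s') + 3 * r \<le> Re (c s)"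
  using assms c_gap by (metis nat_neq_iff)

lemma sheetI:
  assumes "\<bar>Re w\<bar> \<le> L" "\<bar>Im w\<bar> \<le> L"
    and "\<And>s. s < M \<Longrightarrow> r \<le> \<bar>Re w - Re (c s)\<bar> \<or> r \<le> \<bar>Im w - Im (c s)\<bar>"
  shows "w \<in> sheet"
  using assms by (auto simp: sheet_def le_sqn_iff) (simp add: sqn_def)

lemma sheetD:
  assumes "w \<in> sheet"
  shows "\<bar>Re w\<bar> \<le> L" "\<bar>Im w\<bar> \<le> L"
    and "s < M \<Longrightarrow> r \<le> \<bar>Re w - Re (c s)\<bar> \<or> r \<le> \<bar>Im w - Im (c s)\<bar>"
  using assms by (auto simp: sheet_def le_sqn_iff sqn_def)

lemma connected_sheet: "connected sheet"
proof (rule connected_comb[where b = "-L"])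
  fix z assume z: "z \<in> sheet"
  note zD = sheetD[OF z]
  show "\<exists>x. closed_segment z (Complex x (Im z)) \<subseteq> sheet \<and>
    closed_segment (Complex x (Im z)) (Complex x (-L)) \<subseteq> sheet"
  \<comment> \<open>Only a hole below \<open>z\<close> can block the descent to the spine.\<close>
  proof (cases "\<exists>s<M. \<bar>Re z - Re (c s)\<bar> < r \<and> Im (c s) \<le> Im z")
    case False
    have "closed_segment z (Complex (Re z) (-L)) \<subseteq> sheet"
    proof
      fix w assume "w \<in> closed_segment z (Complex (Re z) (-L))"
      then have w: "Re w = Re z" "-L \<le> Im w" "Im w \<le> Im z"
        using segment_vertical[of w "Re z" "Im z"] zD by auto
      show "w \<in> sheet"
      proof (rule sheetI)
        fix s assume s: "s < M"
        show "r \<le> \<bar>Re w - Re (c s)\<bar> \<or> r \<le> \<bar>Im w - Im (c s)\<bar>"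
          using False s w zD(3)[OF s] by (cases "r \<le> \<bar>Re z - Re (c s)\<bar>") force+
      qed (use w zD in auto)
    qed
    then show ?thesis using z by (intro exI[of _ "Re z"]) auto
  next
    case True
    then obtain s where s: "s < M" "\<bar>Re z - Re (c s)\<bar> < r" "Im (c s) \<le> Im z" by blast
    \<comment> \<open>The detour leads to the right side of the blocking hole, which belongs to the
      closed sheet. By the gap between the shadows no other hole has its interior over this
      stretch.\<close>
    have far: "r \<le> \<bar>x - Re (c s')\<bar>" if "s' < M" "s' \<noteq> s" "Re z \<le> x" "x \<le> Re (c s) + r" for x s'
      by (cases rule: gap_cases[OF s(1) that(1)]) (use that s in linarith)+
    have h: "r \<le> Im z - Im (c s)"
      using zD(3)[OF s(1)] s by auto
    show ?thesis
    proof (intro exI conjI subsetI)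
      fix w assume "w \<in> closed_segment z (Complex (Re (c s) + r) (Im z))"
      then have w: "Im w = Im z" "Re z \<le> Re w" "Re w \<le> Re (c s) + r"
        using s segment_horizontal[of w "Re z" "Im z"] by auto
      show "w \<in> sheet"
      proof (rule sheetI)
        fix s' assume "s' < M"
        then show "r \<le> \<bar>Re w - Re (c s')\<bar> \<or> r \<le> \<bar>Im w - Im (c s')\<bar>"
          using far[of s' "Re w"] w h by (cases "s' = s") auto
      qed (use w zD c_Re[OF s(1)] r_pos in auto)
    next
      fix w assume "w \<in> closed_segment (Complex (Re (c s) + r) (Im z)) (Complex (Re (c s) + r) (-L))"
      then have w: "Re w = Re (c s) + r" "-L \<le> Im w" "Im w \<le> Im z"
        using zD segment_vertical[of w "Re (c s) + r" "Im z" "-L"] by auto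
      show "w \<in> sheet"
      proof (rule sheetI)
        fix s' assume "s' < M"
        then show "r \<le> \<bar>Re w - Re (c s')\<bar> \<or> r \<le> \<bar>Im w - Im (c s')\<bar>"
          using far[of s' "Re w"] w s r_pos by (cases "s' = s") auto
      qed (use w zD c_Re[OF s(1)] r_pos in auto)
    qed
  qed
next
  fix x x' assume "Complex x (-L) \<in> sheet" "Complex x' (-L) \<in> sheet"
  then have x: "\<bar>x\<bar> \<le> L" "\<bar>x'\<bar> \<le> L" by (auto dest: sheetD)
  show "closed_segment (Complex x (-L)) (Complex x' (-L)) \<subseteq> sheet"
  proof
    fix w assume "w \<in> closed_segment (Complex x (-L)) (Complex x' (-L))"
    then have "Im w = -L" "\<bar>Re w\<bar> \<le> L"
      using x segment_horizontal[of w x "-L" x'] by auto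
    then have w: "sqn w = L" using L_pos by (simp add: sqn_def)
    then show "w \<in> sheet"
      using near_outside[of w] r_pos by (auto simp: sheet_def intro: less_imp_le)
  qed
qed

lemma right_edge: "Complex L 0 \<in> sheet" "Complex L 0 \<notin> isheet"
proof -
  have "sqn (Complex L 0) = L" using L_pos by (simp add: sqn_def)
  then show "Complex L 0 \<in> sheet" "Complex L 0 \<notin> isheet"
    using near_outside[of "Complex L 0"] r_pos by (auto simp: sheet_def isheet_def intro: less_imp_le)
qed

lemma connected_surf: "connected surf"
  unfolding surf_def
proof (rule connected_Un)
  show "up ` sheet \<inter> dn ` sheet \<noteq> {}"
    using up_eq_dn right_edge by (metis disjoint_iff image_eqI)
qed (auto intro!: connected_continuous_image connected_sheet continuous_intros)

lemma surface_surf: "surface (top_of_set surf)"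
  unfolding surface_def
proof (intro conjI ballI)
  show "topspace (top_of_set surf) \<noteq> {}"
    using right_edge by (auto simp: surf_def)
  show "compact_space (top_of_set surf)"
    using compact_surf by (simp add: compact_space_subtopology compactin_euclidean_iff)
  show "connected_space (top_of_set surf)"
    using connected_surf by (simp add: connected_space_subtopology connectedin_iff_connected)
  show "Hausdorff_space (top_of_set surf)"
    by (simp add: Hausdorff_space_subtopology)
qed (use locally_disc in auto)

end

section \<open>The slit sheet is an open disc\<close>

lemma connected_Un_family:
  assumes "connected A" "\<And>i. i \<in> I \<Longrightarrow> connected (B i)" "\<And>i. i \<in> I \<Longrightarrow> A \<inter> B i \<noteq> {}"
  shows "connected (A \<union> (\<Union>i\<in>I. B i))"
proof (cases "I = {}")
  case True
  then show ?thesis using assms by auto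
next
  case False
  have "connected (\<Union>i\<in>I. A \<union> B i)"
    using assms False by (intro connected_Union) (auto intro!: connected_Un)
  moreover have "(\<Union>i\<in>I. A \<union> B i) = A \<union> (\<Union>i\<in>I. B i)"
    using False by auto
  ultimately show ?thesis by simp
qed

lemma bounded_open_homeomorphic_disc:
  fixes S :: "complex set"
  assumes "open S" "bounded S" "S \<noteq> {}" "connected S" "connected (- S)"
  shows "S homeomorphic ball (0::complex) 1"
  using assms simply_connected_iff_simple[OF assms(1,2)]
    simply_connected_eq_homeomorphic_to_disc[OF assms(1)] by blast

context square_holes
begin

text \<open>The slit starts at mid-height on the left side of the hole and continues beyond the
  outer square. So it meets both the closed hole and the exterior, and the complement of
  \<open>cut_sheet\<close> becomes connected.\<close>

definition slit :: "nat \<Rightarrow> complex set" where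
  "slit s = {z. Re z = Re (c s) - r \<and> Im (c s) \<le> Im z}"

definition cut_sheet :: "complex set" where
  "cut_sheet = isheet - (\<Union>s<M. slit s)"

lemma cut_sheet_iff:
  "w \<in> cut_sheet \<longleftrightarrow> \<bar>Re w\<bar> < L \<and> \<bar>Im w\<bar> < L \<and>
     (\<forall>s<M. (r < \<bar>Re w - Re (c s)\<bar> \<or> r < \<bar>Im w - Im (c s)\<bar>) \<and>
            (Re w = Re (c s) - r \<longrightarrow> Im w < Im (c s)))"
proof -
  have "sqn w < L \<longleftrightarrow> \<bar>Re w\<bar> < L \<and> \<bar>Im w\<bar> < L" by (simp add: sqn_def)
  moreover have "w \<notin> slit s \<longleftrightarrow> (Re w = Re (c s) - r \<longrightarrow> Im w < Im (c s))" for s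
    by (auto simp: slit_def)
  ultimately show ?thesis
    unfolding cut_sheet_def isheet_def Diff_iff UN_iff mem_Collect_eq less_sqn_iff
    by auto
qed

lemma cut_sheetI:
  assumes "\<bar>Re w\<bar> < L" "\<bar>Im w\<bar> < L"
    and "\<And>s. s < M \<Longrightarrow> r < \<bar>Re w - Re (c s)\<bar> \<or> r < \<bar>Im w - Im (c s)\<bar>"
    and "\<And>s. s < M \<Longrightarrow> Re w = Re (c s) - r \<Longrightarrow> Im w < Im (c s)"
  shows "w \<in> cut_sheet"
  using assms unfolding cut_sheet_iff by blast

lemma cut_sheetD:
  assumes "w \<in> cut_sheet"
  shows "\<bar>Re w\<bar> < L" "\<bar>Im w\<bar> < L"
    and "s < M \<Longrightarrow> r < \<bar>Re w - Re (c s)\<bar> \<or> r < \<bar>Im w - Im (c s)\<bar>"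
    and "s < M \<Longrightarrow> Re w = Re (c s) - r \<Longrightarrow> Im w < Im (c s)"
  using assms unfolding cut_sheet_iff by blast+

lemma cut_sheet_subset: "cut_sheet \<subseteq> isheet"
  by (auto simp: cut_sheet_def)

lemma open_cut_sheet: "open cut_sheet"
proof -
  have "slit s = {z. Re z = Re (c s) - r} \<inter> {z. Im (c s) \<le> Im z}" for s
    by (auto simp: slit_def)
  then have "closed (slit s)" for s
    by (auto intro!: closed_Int closed_Collect_le closed_Collect_eq continuous_intros)
  then show ?thesis
    unfolding cut_sheet_def by (intro open_Diff open_isheet closed_UN) auto
qed

lemma connected_cut_sheet: "connected cut_sheet"
\<comment> \<open>The holes end at least \<open>r\<close> above the lower side, so the spine at half
  that height passes below them. The detours now go to \<open>Re (c s) + 3 / 2 * r\<close>, strictly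
  between the right side of the hole and \<open>Re (c s) + 2 * r\<close>, before which no further
  slit or hole can occur.\<close>
proof (rule connected_comb[where b = "- L + r / 2"])
  fix z assume z: "z \<in> cut_sheet"
  note zD = cut_sheetD[OF z]
  have low: "r < Im (c s) - (- L + r / 2)" if "s < M" for s
    using c_Im[OF that] r_pos by linarith
  show "\<exists>x. closed_segment z (Complex x (Im z)) \<subseteq> cut_sheet \<and>
    closed_segment (Complex x (Im z)) (Complex x (- L + r / 2)) \<subseteq> cut_sheet"
  proof (cases "\<exists>s<M. \<bar>Re z - Re (c s)\<bar> \<le> r \<and> Im (c s) \<le> Im z")
    case False
    have "closed_segment z (Complex (Re z) (- L + r / 2)) \<subseteq> cut_sheet"
    proof
      fix w assume "w \<in> closed_segment z (Complex (Re z) (- L + r / 2))"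
      then have w: "Re w = Re z" "min (Im z) (-L + r / 2) \<le> Im w" "Im w \<le> max (Im z) (-L + r / 2)"
        using segment_vertical[of w "Re z" "Im z"] by auto
      show "w \<in> cut_sheet"
      proof (rule cut_sheetI)
        fix s assume s: "s < M"
        show "r < \<bar>Re w - Re (c s)\<bar> \<or> r < \<bar>Im w - Im (c s)\<bar>"
        proof (cases "r < \<bar>Re z - Re (c s)\<bar>")
          case False
          then have "Im z < Im (c s)" using \<open>\<not> (\<exists>s<M. _ s)\<close> s by force
          then show ?thesis
            using zD(3)[OF s] False w low[OF s] by auto
        qed (use w in auto)
        assume "Re w = Re (c s) - r"
        then show "Im w < Im (c s)"
          using zD(4)[OF s] w low[OF s] r_pos by auto
      qed (use w zD(1,2) r_pos r_less in auto)
    qed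
    then show ?thesis using z by (intro exI[of _ "Re z"]) auto
  next
    case True
    then obtain s where s: "s < M" "\<bar>Re z - Re (c s)\<bar> \<le> r" "Im (c s) \<le> Im z" by blast
    have far: "r < \<bar>x - Re (c s')\<bar>" "x \<noteq> Re (c s') - r"
      if "s' < M" "s' \<noteq> s" "Re z \<le> x" "x \<le> Re (c s) + 3 / 2 * r" for x s'
      by (cases rule: gap_cases[OF s(1) that(1)]; use that s r_pos in linarith)+
    have h: "r < Im z - Im (c s)" "Re (c s) - r < Re z"
      using zD(3)[OF s(1)] zD(4)[OF s(1)] s by linarith+
    show ?thesis
    proof (intro exI conjI subsetI)
      fix w assume "w \<in> closed_segment z (Complex (Re (c s) + 3 / 2 * r) (Im z))"
      then have w: "Im w = Im z" "Re z \<le> Re w" "Re w \<le> Re (c s) + 3 / 2 * r"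
        using s r_pos segment_horizontal[of w "Re z" "Im z"] by auto
      show "w \<in> cut_sheet"
      proof (rule cut_sheetI)
        fix s' assume "s' < M"
        then show "r < \<bar>Re w - Re (c s')\<bar> \<or> r < \<bar>Im w - Im (c s')\<bar>"
          "Re w = Re (c s') - r \<Longrightarrow> Im w < Im (c s')"
          using far[of s' "Re w"] w h by (cases "s' = s"; simp)+
      qed (use w zD(1,2) c_Re[OF s(1)] r_pos in auto)
    next
      fix w assume "w \<in> closed_segment (Complex (Re (c s) + 3 / 2 * r) (Im z))
        (Complex (Re (c s) + 3 / 2 * r) (- L + r / 2))"
      then have w: "Re w = Re (c s) + 3 / 2 * r" "-L + r / 2 \<le> Im w" "Im w \<le> Im z"
        using zD(1,2) h low[OF s(1)] r_pos
          segment_vertical[of w "Re (c s) + 3 / 2 * r" "Im z" "-L + r / 2"] by auto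
      show "w \<in> cut_sheet"
      proof (rule cut_sheetI)
        fix s' assume s': "s' < M"
        have "r < \<bar>Re w - Re (c s')\<bar> \<and> Re w \<noteq> Re (c s') - r"
        proof (cases "s' = s")
          case True
          have "r < Re w - Re (c s)" using w(1) r_pos by linarith
          then show ?thesis using True r_pos by auto
        next
          case False
          have "Re z \<le> Re w" using w(1) s(2) r_pos by linarith
          with far[OF s' False, of "Re w"] w(1) r_pos show ?thesis by auto
        qed
        then show "r < \<bar>Re w - Re (c s')\<bar> \<or> r < \<bar>Im w - Im (c s')\<bar>"
          "Re w = Re (c s') - r \<Longrightarrow> Im w < Im (c s')"
          by simp_all
      qed (use w zD(1,2) c_Re[OF s(1)] r_pos in auto)
    qed
  qed
next
  fix x x' assume "Complex x (- L + r / 2) \<in> cut_sheet" "Complex x' (- L + r / 2) \<in> cut_sheet"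
  then have x: "\<bar>x\<bar> < L" "\<bar>x'\<bar> < L" by (auto dest: cut_sheetD)
  show "closed_segment (Complex x (- L + r / 2)) (Complex x' (- L + r / 2)) \<subseteq> cut_sheet"
  proof
    fix w assume "w \<in> closed_segment (Complex x (- L + r / 2)) (Complex x' (- L + r / 2))"
    then have w: "Im w = - L + r / 2" "\<bar>Re w\<bar> < L"
      using x segment_horizontal[of w x "- L + r / 2" x'] by auto
    show "w \<in> cut_sheet"
    proof (rule cut_sheetI)
      fix s assume "s < M"
      then have "r < Im (c s) - Im w"
        using c_Im[of s] r_pos w by linarith
      then show "r < \<bar>Re w - Re (c s)\<bar> \<or> r < \<bar>Im w - Im (c s)\<bar>" "Im w < Im (c s)"
        using r_pos by linarith+
    qed (use w r_pos r_less in auto)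
  qed
qed

lemma cut_sheet_ne: "cut_sheet \<noteq> {}"
proof -
  have "Complex 0 (- L + r / 2) \<in> cut_sheet"
  proof (rule cut_sheetI)
    fix s assume "s < M"
    then have "r < Im (c s) - Im (Complex 0 (- L + r / 2))"
      using c_Im[of s] r_pos by simp
    then show "r < \<bar>Re (Complex 0 (- L + r / 2)) - Re (c s)\<bar> \<or> r < \<bar>Im (Complex 0 (- L + r / 2)) - Im (c s)\<bar>"
      "Im (Complex 0 (- L + r / 2)) < Im (c s)"
      using r_pos by linarith+
  qed (use r_pos r_less in auto)
  then show ?thesis by blast
qed

lemma cut_sheet_complement:
  "- cut_sheet = - box (Complex (-L) (-L)) (Complex L L) \<union>
     (\<Union>s\<in>{..<M}. cbox (c s - Complex r r) (c s + Complex r r) \<union> slit s)" (is "_ = ?R")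
proof (rule set_eqI)
  fix z
  have "z \<notin> cbox (c s - Complex r r) (c s + Complex r r) \<union> slit s \<longleftrightarrow>
      (r < \<bar>Re z - Re (c s)\<bar> \<or> r < \<bar>Im z - Im (c s)\<bar>) \<and>
      (Re z = Re (c s) - r \<longrightarrow> Im z < Im (c s))" for s
    unfolding Un_iff in_cbox_complex_iff slit_def by auto
  moreover have "z \<in> box (Complex (-L) (-L)) (Complex L L) \<longleftrightarrow> \<bar>Re z\<bar> < L \<and> \<bar>Im z\<bar> < L"
    unfolding in_box_complex_iff by auto
  ultimately have "z \<in> cut_sheet \<longleftrightarrow> z \<notin> ?R"
    unfolding cut_sheet_iff by blast
  then show "z \<in> - cut_sheet \<longleftrightarrow> z \<in> ?R" by blast
qed

lemma connected_cut_sheet_complement: "connected (- cut_sheet)"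
  unfolding cut_sheet_complement
proof (rule connected_Un_family)
  show "connected (- box (Complex (-L) (-L)) (Complex L L))"
    by (rule connected_complement_bounded_convex) (auto simp: bounded_box convex_box)
next
  fix s assume "s \<in> {..<M}"
  then have s: "s < M" by simp
  have "slit s = {z. Re z \<le> Re (c s) - r} \<inter> {z. Re z \<ge> Re (c s) - r} \<inter> {z. Im z \<ge> Im (c s)}"
    by (auto simp: slit_def)
  then have "convex (slit s)"
    by (simp add: convex_Int convex_halfspace_Re_le convex_halfspace_Re_ge convex_halfspace_Im_ge)
  then have "connected (slit s)" by (rule convex_connected)
  moreover have "Complex (Re (c s) - r) (Im (c s)) \<in> cbox (c s - Complex r r) (c s + Complex r r) \<inter> slit s"
    using r_pos by (auto simp: in_cbox_complex_iff slit_def)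
  ultimately show "connected (cbox (c s - Complex r r) (c s + Complex r r) \<union> slit s)"
    by (intro connected_Un convex_connected[OF convex_box(1)]) auto
  have "Complex (Re (c s) - r) L \<in> - box (Complex (-L) (-L)) (Complex L L) \<inter> slit s"
    using c_Im[OF s] r_pos by (auto simp: slit_def in_box_complex_iff)
  then show "- box (Complex (-L) (-L)) (Complex L L) \<inter> (cbox (c s - Complex r r) (c s + Complex r r) \<union> slit s) \<noteq> {}"
    by blast
qed

lemma cut_sheet_disc: "cut_sheet homeomorphic ball (0::complex) 1"
proof (rule bounded_open_homeomorphic_disc)
  show "bounded cut_sheet"
    using compact_sheet cut_sheet_subset isheet_subset_sheet
    by (meson bounded_subset compact_imp_bounded)
qed (use open_cut_sheet cut_sheet_ne connected_cut_sheet connected_cut_sheet_complement in auto)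

end

section \<open>Systems of arcs\<close>

lemma embedding_map_compact:
  fixes f :: "'a::topological_space \<Rightarrow> 'b::metric_space"
  assumes "compact K" "continuous_on K f" "inj_on f K" "f ` K \<subseteq> S"
  shows "embedding_map (top_of_set K) (top_of_set S) f"
proof (rule injective_closed_imp_embedding_map)
  show c: "continuous_map (top_of_set K) (top_of_set S) f"
    using assms by auto
  show "closed_map (top_of_set K) (top_of_set S) f"
    using c assms(1) by (intro T1_Spaces.continuous_imp_closed_map)
      (simp_all add: compact_space_subtopology compactin_euclidean_iff Hausdorff_space_subtopology)
qed (use assms in auto)

definition arc_graph :: "'v set \<Rightarrow> 'i set \<Rightarrow> ('i \<Rightarrow> 'v) \<Rightarrow> ('i \<Rightarrow> 'v) \<Rightarrow> 'v graph" where
  "arc_graph V I a b = \<lparr>verts = V, edges = (\<lambda>i. {a i, b i}) ` I\<rparr>"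

text \<open>\<open>embedded_graph\<close> indexes curves by edges as sets of vertices. The index of
  an arc is recovered from its pair of ends, which is unambiguous under the assumption
  \<open>inj_edges\<close> below.\<close>

definition arc_map ::
  "'i set \<Rightarrow> ('i \<Rightarrow> 'v) \<Rightarrow> ('i \<Rightarrow> 'v) \<Rightarrow> ('i \<Rightarrow> real \<Rightarrow> 's) \<Rightarrow> 'v set \<Rightarrow> real \<Rightarrow> 's" where
  "arc_map I a b p e = p (inv_into I (\<lambda>i. {a i, b i}) e)"

locale arc_system =
  fixes S :: "'s::metric_space set" and V :: "'v set" and I :: "'i set" and a b :: "'i \<Rightarrow> 'v"
    and loc :: "'v \<Rightarrow> 's" and p :: "'i \<Rightarrow> real \<Rightarrow> 's"
  assumes fin_V: "finite V"
    and ends: "\<And>i. i \<in> I \<Longrightarrow> a i \<in> V" "\<And>i. i \<in> I \<Longrightarrow> b i \<in> V" "\<And>i. i \<in> I \<Longrightarrow> a i \<noteq> b i"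
    and inj_edges: "inj_on (\<lambda>i. {a i, b i}) I"
    and inj_loc: "inj_on loc V" and loc_S: "loc ` V \<subseteq> S"
    and arc_cont: "\<And>i. i \<in> I \<Longrightarrow> continuous_on {0..1} (p i)"
    and arc_inj: "\<And>i. i \<in> I \<Longrightarrow> inj_on (p i) {0..1}"
    and arc_S: "\<And>i. i \<in> I \<Longrightarrow> p i ` {0..1} \<subseteq> S"
    and arc_ends: "\<And>i. i \<in> I \<Longrightarrow> p i 0 = loc (a i)" "\<And>i. i \<in> I \<Longrightarrow> p i 1 = loc (b i)"
    and arc_vertex: "\<And>i t v. i \<in> I \<Longrightarrow> 0 < t \<Longrightarrow> t < 1 \<Longrightarrow> v \<in> V \<Longrightarrow> p i t \<noteq> loc v"
    and arc_arc: "\<And>i j t u. i \<in> I \<Longrightarrow> j \<in> I \<Longrightarrow> i \<noteq> j \<Longrightarrow> 0 < t \<Longrightarrow> t < 1 \<Longrightarrow> 0 < u \<Longrightarrow> u < 1 \<Longrightarrow>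
        p i t \<noteq> p j u"
begin

abbreviation "gr \<equiv> arc_graph V I a b"
abbreviation "\<gamma> \<equiv> arc_map I a b p"

lemma arc_map_edge: "i \<in> I \<Longrightarrow> \<gamma> {a i, b i} = p i"
  using inj_edges by (simp add: arc_map_def inv_into_f_f[where f = "\<lambda>i. {a i, b i}"])

lemma simple_gr: "simple_graph gr"
  using fin_V ends by (auto simp: simple_graph_def arc_graph_def)

lemma embedded: "embedded_graph (top_of_set S) gr loc \<gamma>"
  unfolding embedded_graph_def
proof (intro conjI ballI impI)
  show "simple_graph gr" by (rule simple_gr)
  show "inj_on loc (verts gr)" "loc ` verts gr \<subseteq> topspace (top_of_set S)"
    using inj_loc loc_S by (simp_all add: arc_graph_def)
next
  fix e assume "e \<in> edges gr"
  then obtain i where i: "i \<in> I" "e = {a i, b i}" by (auto simp: arc_graph_def)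
  show "embedding_map (top_of_set {0..1}) (top_of_set S) (\<gamma> e)"
    using i arc_cont arc_inj arc_S by (simp add: arc_map_edge embedding_map_compact)
  show "{\<gamma> e 0, \<gamma> e 1} = loc ` e"
    using i by (simp add: arc_map_edge arc_ends)
  show "\<gamma> e ` {0<..<1} \<inter> loc ` verts gr = {}"
    using i arc_vertex by (auto simp: arc_map_edge arc_graph_def)
next
  fix e f assume "e \<in> edges gr" "f \<in> edges gr" "e \<noteq> f"
  then obtain i j where "i \<in> I" "e = {a i, b i}" "j \<in> I" "f = {a j, b j}" "i \<noteq> j"
    by (auto simp: arc_graph_def)
  then show "\<gamma> e ` {0<..<1} \<inter> \<gamma> f ` {0<..<1} = {}"
    using arc_arc[of i j] by (auto simp: arc_map_edge)
qed

lemma drawing_eq: "drawing gr loc \<gamma> = loc ` V \<union> (\<Union>i\<in>I. p i ` {0..1})"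
proof -
  have "(\<Union>i\<in>I. \<gamma> {a i, b i} ` {0..1}) = (\<Union>i\<in>I. p i ` {0..1})"
    by (intro SUP_cong refl) (simp add: arc_map_edge)
  then show ?thesis by (simp add: drawing_def arc_graph_def)
qed

lemma card_edges: "card (edges gr) = card I"
  using inj_edges by (simp add: arc_graph_def card_image)

end

section \<open>Renaming the vertices of an embedded graph\<close>

definition map_graph :: "('u \<Rightarrow> 'v) \<Rightarrow> 'u graph \<Rightarrow> 'v graph" where
  "map_graph f G = \<lparr>verts = f ` verts G, edges = (`) f ` edges G\<rparr>"

lemma simple_graph_map_graph:
  assumes "inj f" "simple_graph G"
  shows "simple_graph (map_graph f G)"
proof -
  have "card (f ` e) = card e" for e
    using assms(1) by (intro card_image inj_on_subset[of f UNIV e]) auto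
  then show ?thesis
    using assms(2) by (simp add: simple_graph_def map_graph_def image_mono)
qed

context
  fixes f :: "'u \<Rightarrow> 'v"
  assumes inj: "inj f"
begin

lemma inv_image_image [simp]: "inv f ` f ` A = A"
  using inj by (simp add: image_image)

lemma drawing_map_graph:
  "drawing (map_graph f G) (loc \<circ> inv f) (\<gamma> \<circ> (`) (inv f)) = drawing G loc \<gamma>"
  using inj by (simp add: drawing_def map_graph_def image_image image_comp[symmetric])

lemma embedded_graph_map_graph:
  assumes "embedded_graph X G loc \<gamma>"
  shows "embedded_graph X (map_graph f G) (loc \<circ> inv f) (\<gamma> \<circ> (`) (inv f))"
proof -
  have eq: "(\<lambda>x. loc (inv f x)) ` f ` A = loc ` A" for A
    using inj by (simp add: image_image)
  have "inj_on (loc \<circ> inv f) (f ` verts G)"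
    using assms inj by (auto simp: embedded_graph_def inj_on_def)
  moreover have "simple_graph (map_graph f G)"
    using assms inj simple_graph_map_graph by (auto simp: embedded_graph_def)
  moreover have "(loc \<circ> inv f) ` verts (map_graph f G) = loc ` verts G"
    by (simp add: map_graph_def eq o_def)
  moreover have "edges (map_graph f G) = (`) f ` edges G"
    by (simp add: map_graph_def)
  ultimately show ?thesis
    using assms unfolding embedded_graph_def
    by (simp add: eq map_graph_def inj_image_eq_iff[OF inj] o_def)
qed

lemma card_map_graph:
  "card (verts (map_graph f G)) = card (verts G)" "card (edges (map_graph f G)) = card (edges G)"
  using inj by (auto simp: map_graph_def inj_on_def intro!: card_image)
    (metis inv_image_image)+

end

text \<open>\<open>has_euler_genus\<close> admits graphs on natural numbers only. Renaming by
  \<open>to_nat\<close> changes neither the drawing nor the faces.\<close>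

lemma has_euler_genusI:
  fixes H :: "'v::countable graph"
  assumes "cellular_embedding X H loc \<gamma>"
    and "int (card (verts H)) - int (card (edges H)) + int (card (faces X H loc \<gamma>)) = 2 - int h"
  shows "has_euler_genus X h"
proof -
  have inj: "inj (to_nat :: 'v \<Rightarrow> nat)" by simp
  let ?H = "map_graph to_nat H" and ?loc = "loc \<circ> inv to_nat" and ?\<gamma> = "\<gamma> \<circ> (`) (inv to_nat)"
  have "faces X ?H ?loc ?\<gamma> = faces X H loc \<gamma>"
    unfolding faces_def drawing_map_graph[OF inj] ..
  moreover have "cellular_embedding X ?H ?loc ?\<gamma>"
    using assms(1) embedded_graph_map_graph[OF inj, of X H loc \<gamma>] calculation
    by (simp add: cellular_embedding_def)
  ultimately show ?thesis
    using assms(2) unfolding has_euler_genus_def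
    by (intro exI[of _ ?H] exI[of _ ?loc] exI[of _ ?\<gamma>]) (simp add: card_map_graph[OF inj])
qed

lemma connected_components_of_two_open:
  assumes "topspace X = A \<union> B" "A \<inter> B = {}" "A \<noteq> {}" "B \<noteq> {}"
    and "openin X A" "openin X B" "connectedin X A" "connectedin X B"
  shows "connected_components_of X = {A, B}"
proof -
  have *: "connected_component_of_set X x = A" if "x \<in> A" "topspace X = A \<union> B" "A \<inter> B = {}"
    "openin X A" "openin X B" "connectedin X A" for A B x
  proof
    have "closedin X A"
      using that by (metis Diff_cancel Un_Diff Un_Diff_Int Diff_triv inf_commute sup_bot_left
          closedin_def openin_subset sup_ge1 Un_commute)
    then have "connected_component_of_set X x \<subseteq> A \<or> disjnt (connected_component_of_set X x) A"
      using that by (intro connectedin_clopen_cases[of X]) (auto simp: connectedin_connected_component_of)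
    moreover have "x \<in> connected_component_of_set X x"
      using that by (auto simp: connected_component_of_refl)
    ultimately show "connected_component_of_set X x \<subseteq> A"
      using that(1) by (auto simp: disjnt_iff)
    show "A \<subseteq> connected_component_of_set X x"
      using that by (intro connected_component_of_maximal) auto
  qed
  have "connected_components_of X = connected_component_of_set X ` (A \<union> B)"
    using assms(1) by (simp add: connected_components_of_def)
  also have "\<dots> = {A, B}"
  proof -
    have "connected_component_of_set X x = A" if "x \<in> A" for x
      using *[OF that, of B] assms by blast
    moreover have "connected_component_of_set X x = B" if "x \<in> B" for x
      using *[OF that, of A] assms by blast
    ultimately show ?thesis using assms(3,4) by (auto simp: image_iff)
  qed
  finally show ?thesis .
qed

section \<open>The Euler genus of the double\<close>

definition corner :: "real \<Rightarrow> nat \<Rightarrow> complex" where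
  "corner \<rho> i = (if i = 0 then Complex (-\<rho>) \<rho> else if i = 1 then Complex \<rho> \<rho>
     else if i = 2 then Complex \<rho> (-\<rho>) else Complex (-\<rho>) (-\<rho>))"

text \<open>The position on the boundary of the square of half-side \<open>\<rho>\<close>, measured clockwise from
  the upper left corner, which has position \<open>- \<rho>\<close>.\<close>

definition perim :: "real \<Rightarrow> complex \<Rightarrow> real" where
  "perim \<rho> z = (if Im z = \<rho> then Re z else if Re z = \<rho> then 2 * \<rho> - Im z
     else if Im z = -\<rho> then 4 * \<rho> - Re z else 6 * \<rho> + Im z)"

abbreviation next4 :: "nat \<Rightarrow> nat" where
  "next4 i \<equiv> if i = 3 then 0 else Suc i"

lemma less_4_cases: "i < 4 \<Longrightarrow> i = 0 \<or> i = 1 \<or> i = 2 \<or> i = (3::nat)"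
  by auto

lemma corner_perim:
  assumes "0 < \<rho>" "i < 4"
  shows "sqn (corner \<rho> i) = \<rho>" "perim \<rho> (corner \<rho> i) = (2 * real i - 1) * \<rho>"
  using assms less_4_cases[OF assms(2)] by (auto simp: corner_def perim_def sqn_def)

lemma linepath_coords:
  "linepath a b t = Complex (Re a + t * (Re b - Re a)) (Im a + t * (Im b - Im a))"
  by (simp add: complex_eq_iff linepath_def algebra_simps)

lemma side_perim:
  assumes "0 < \<rho>" "i < 4" "0 < t" "t < 1"
  defines "z \<equiv> linepath (corner \<rho> i) (corner \<rho> (next4 i)) t"
  shows "sqn z = \<rho>" (is ?A) "(2 * real i - 1) * \<rho> < perim \<rho> z" (is ?B)
    "perim \<rho> z < (2 * real (Suc i) - 1) * \<rho>" (is ?C)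
proof -
  define u where "u = t * \<rho>"
  have u: "0 < u" "u < \<rho>" using assms by (simp_all add: u_def)
  have "?A \<and> ?B \<and> ?C"
    using less_4_cases[OF assms(2)]
  proof (elim disjE)
    assume i: "i = 0"
    then have "z = Complex (2 * u - \<rho>) \<rho>"
      unfolding z_def linepath_coords by (simp add: corner_def u_def)
    then show ?thesis using u i by (simp add: perim_def sqn_def)
  next
    assume i: "i = 1"
    then have "z = Complex \<rho> (\<rho> - 2 * u)"
      unfolding z_def linepath_coords by (simp add: corner_def u_def)
    then show ?thesis using u i by (simp add: perim_def sqn_def)
  next
    assume i: "i = 2"
    then have "z = Complex (\<rho> - 2 * u) (-\<rho>)"
      unfolding z_def linepath_coords by (simp add: corner_def u_def)
    then show ?thesis using u i by (simp add: perim_def sqn_def)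
  next
    assume i: "i = 3"
    then have "z = Complex (-\<rho>) (2 * u - \<rho>)"
      unfolding z_def linepath_coords by (simp add: corner_def u_def)
    then show ?thesis using u i by (simp add: perim_def sqn_def)
  qed
  then show ?A ?B ?C by blast+
qed

lemma square_sides:
  assumes "sqn z = \<rho>"
  obtains i where "i < 4" "z \<in> closed_segment (corner \<rho> i) (corner \<rho> (next4 i))"
proof -
  have z: "z = Complex (Re z) (Im z)" by simp
  have "\<bar>Re z\<bar> \<le> \<rho>" "\<bar>Im z\<bar> \<le> \<rho>" and "Re z = \<rho> \<or> Re z = -\<rho> \<or> Im z = \<rho> \<or> Im z = -\<rho>"
    using assms by (auto simp: sqn_def max_def split: if_splits)
  then have "\<exists>i\<in>{0, 1, 2, 3}. z \<in> closed_segment (corner \<rho> i) (corner \<rho> (next4 i))"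
    by (auto simp: corner_def segment_horizontal segment_vertical)
  then obtain i where "i \<in> {0, 1, 2, 3}" "z \<in> closed_segment (corner \<rho> i) (corner \<rho> (next4 i))"
    by blast
  moreover from this(1) have "i < 4" by auto
  ultimately show thesis using that by blast
qed

text \<open>The midpoints \<open>Mid\<close> are needed because both lifts of a slit have the same ends, and the
  graph must be simple.\<close>

datatype hvertex = Outer nat | Hole nat nat | Mid bool nat

instance hvertex :: countable by countable_datatype

datatype hedge = OuterE nat | HoleE nat nat | LowE bool nat | HighE bool nat

context square_holes
begin

text \<open>The vertices on the upper side of the outer square are its two corners and the upper ends
  of the slits.\<close>

definition top_x :: "nat \<Rightarrow> real" where
  "top_x j = (if j = 0 then - L else if j \<le> M then Re (c (j - 1)) - r else L)"

lemma abs_top_x: "\<bar>top_x j\<bar> \<le> L"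
proof (cases "j = 0 \<or> j > M")
  case False
  then have "j - 1 < M" by auto
  from c_Re[OF this] show ?thesis using False r_pos by (simp add: top_x_def)
qed (use L_pos in \<open>auto simp: top_x_def\<close>)

lemma top_x_less:
  assumes "j \<le> M"
  shows "top_x j < top_x (Suc j)"
proof (cases "j = 0")
  case True
  then show ?thesis using c_Re[of 0] r_pos L_pos by (auto simp: top_x_def)
next
  case False
  then have j: "j - 1 < M" "j - 1 < j" using assms by auto
  show ?thesis
  proof (cases "j < M")
    case True
    with False c_gap[OF j(2)] r_pos show ?thesis by (simp add: top_x_def)
  next
    case False
    with \<open>j \<noteq> 0\<close> c_Re[OF j(1)] r_pos assms show ?thesis by (simp add: top_x_def)
  qed
qed

text \<open>\<open>Outer 0\<close>, \<open>Outer (M + 1)\<close>, \<open>Outer (M + 2)\<close> and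
  \<open>Outer (M + 3)\<close> are the corners of the outer square, and \<open>Outer (s + 1)\<close>
  with \<open>s < M\<close> is the upper end of slit \<open>s\<close>, which leaves its hole at the
  corner \<open>Hole s 0\<close>.\<close>

fun hpos :: "hvertex \<Rightarrow> complex" where
  "hpos (Outer j) = (if j \<le> Suc M then Complex (top_x j) L else corner L (j - M))"
| "hpos (Hole s i) = c s + corner r i"
| "hpos (Mid b s) = Complex (Re (c s) - r) ((Im (c s) + r + L) / 2)"

definition lift :: "bool \<Rightarrow> complex \<Rightarrow> complex \<times> complex" where
  "lift b = (if b then up else dn)"

text \<open>On the boundary both lifts coincide, so \<open>True\<close> is an arbitrary choice for
  outer and hole vertices, and likewise in \<open>esheet\<close> for outer and hole edges.\<close>

fun vsheet :: "hvertex \<Rightarrow> bool" where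
  "vsheet (Mid b s) = b" | "vsheet _ = True"

fun esheet :: "hedge \<Rightarrow> bool" where
  "esheet (LowE b s) = b" | "esheet (HighE b s) = b" | "esheet _ = True"

fun src :: "hedge \<Rightarrow> hvertex" where
  "src (OuterE j) = Outer j" | "src (HoleE s i) = Hole s i"
| "src (LowE b s) = Hole s 0" | "src (HighE b s) = Mid b s"

fun tgt :: "hedge \<Rightarrow> hvertex" where
  "tgt (OuterE j) = Outer (if j = M + 3 then 0 else Suc j)" | "tgt (HoleE s i) = Hole s (next4 i)"
| "tgt (LowE b s) = Mid b s" | "tgt (HighE b s) = Outer (Suc s)"

definition hloc :: "hvertex \<Rightarrow> complex \<times> complex" where
  "hloc v = lift (vsheet v) (hpos v)"

definition eline :: "hedge \<Rightarrow> real \<Rightarrow> complex" where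
  "eline e = linepath (hpos (src e)) (hpos (tgt e))"

definition harc :: "hedge \<Rightarrow> real \<Rightarrow> complex \<times> complex" where
  "harc e t = lift (esheet e) (eline e t)"

definition HV :: "hvertex set" where
  "HV = Outer ` {..<M + 4} \<union> (\<lambda>(s, i). Hole s i) ` ({..<M} \<times> {..<4}) \<union>
        (\<lambda>(b, s). Mid b s) ` (UNIV \<times> {..<M})"

definition HE :: "hedge set" where
  "HE = OuterE ` {..<M + 4} \<union> (\<lambda>(s, i). HoleE s i) ` ({..<M} \<times> {..<4}) \<union>
        (\<lambda>(b, s). LowE b s) ` (UNIV \<times> {..<M}) \<union> (\<lambda>(b, s). HighE b s) ` (UNIV \<times> {..<M})"

lemma HV_simps [simp]:
  "Outer j \<in> HV \<longleftrightarrow> j < M + 4" "Hole s i \<in> HV \<longleftrightarrow> s < M \<and> i < 4" "Mid b s \<in> HV \<longleftrightarrow> s < M"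
  by (auto simp: HV_def)

lemma HE_simps [simp]:
  "OuterE j \<in> HE \<longleftrightarrow> j < M + 4" "HoleE s i \<in> HE \<longleftrightarrow> s < M \<and> i < 4"
  "LowE b s \<in> HE \<longleftrightarrow> s < M" "HighE b s \<in> HE \<longleftrightarrow> s < M"
  by (auto simp: HE_def)

lemma card_HV: "card HV = 7 * M + 4"
proof -
  have "card HV = card (Outer ` {..<M + 4}) + card ((\<lambda>(s, i). Hole s i) ` ({..<M} \<times> {..<4::nat})) +
      card ((\<lambda>(b, s). Mid b s) ` ((UNIV :: bool set) \<times> {..<M}))"
    unfolding HV_def by (subst card_Un_disjoint; (subst card_Un_disjoint)?) auto
  also have "\<dots> = 7 * M + 4"
    by (subst card_image, force simp: inj_on_def)+ (simp add: card_cartesian_product)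
  finally show ?thesis .
qed

lemma card_HE: "card HE = 9 * M + 4"
proof -
  have "card HE = card (OuterE ` {..<M + 4}) + card ((\<lambda>(s, i). HoleE s i) ` ({..<M} \<times> {..<4::nat})) +
      card ((\<lambda>(b, s). LowE b s) ` ((UNIV :: bool set) \<times> {..<M})) +
      card ((\<lambda>(b, s). HighE b s) ` ((UNIV :: bool set) \<times> {..<M}))"
    unfolding HE_def by (subst card_Un_disjoint; (subst card_Un_disjoint)?; (subst card_Un_disjoint)?) auto
  also have "\<dots> = 9 * M + 4"
    by (subst card_image, force simp: inj_on_def)+ (simp add: card_cartesian_product)
  finally show ?thesis .
qed

text \<open>The 1-skeleton is divided into zones: the outer square, the squares around the holes, and
  the slits in each sheet. In each zone the vertices and edges follow each other along a real
  coordinate, and \<open>mark\<close> lists the coordinates of the vertices.\<close>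

definition zone :: "complex \<times> complex \<Rightarrow> nat \<times> nat" where
  "zone p = (if sqn (fst p) = L then (0, 0)
     else if \<exists>s<M. sqn (fst p - c s) = r then (1, THE s. s < M \<and> sqn (fst p - c s) = r)
     else (if 0 < Re (snd p) then 2 else 3, THE s. s < M \<and> Re (fst p) = Re (c s) - r))"

fun coord :: "nat \<times> nat \<Rightarrow> complex \<Rightarrow> real" where
  "coord (k, s) z = (if k = 0 then perim L z else if k = 1 then perim r (z - c s) else Im z)"

text \<open>Some marks bound the last edge of a zone instead of belonging to a vertex of it: on a
  slit, index 2 is the upper end; on the outer square, index \<open>M + 4\<close> is the starting
  corner after a full turn, and so is index 4 around a hole. The formulas go on so that
  \<open>mark\<close> is strictly increasing on all indices.\<close>

fun mark :: "nat \<times> nat \<Rightarrow> nat \<Rightarrow> real" where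
  "mark (k, s) j = (if k = 0 then if j \<le> Suc M then top_x j else (2 * real (j - M) - 1) * L
     else if k = 1 then (2 * real j - 1) * r
     else if j = 0 then Im (c s) + r else if j = 1 then (Im (c s) + r + L) / 2 else L + real (j - 2))"

fun vzone :: "hvertex \<Rightarrow> nat \<times> nat" where
  "vzone (Outer j) = (0, 0)" | "vzone (Hole s i) = (1, s)" | "vzone (Mid b s) = (if b then 2 else 3, s)"

fun vindex :: "hvertex \<Rightarrow> nat" where
  "vindex (Outer j) = j" | "vindex (Hole s i) = i" | "vindex (Mid b s) = 1"

fun ezone :: "hedge \<Rightarrow> nat \<times> nat" where
  "ezone (OuterE j) = (0, 0)" | "ezone (HoleE s i) = (1, s)"
| "ezone (LowE b s) = (if b then 2 else 3, s)" | "ezone (HighE b s) = (if b then 2 else 3, s)"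

fun eindex :: "hedge \<Rightarrow> nat" where
  "eindex (OuterE j) = j" | "eindex (HoleE s i) = i" | "eindex (LowE b s) = 0" | "eindex (HighE b s) = 1"

lemma strict_mono_mark:
  assumes "k \<le> 1 \<or> s < M"
  shows "strict_mono (mark (k, s))"
  unfolding strict_mono_Suc_iff
proof
  fix j
  consider "k = 0" "j \<le> M" | "k = 0" "j > M" | "k = 1" | "k > 1" "s < M" using assms by linarith
  then show "mark (k, s) j < mark (k, s) (Suc j)"
  proof cases
    case 1
    then show ?thesis using top_x_less[of j] by simp
  next
    case 2
    \<comment> \<open>At the upper right corner, \<open>j = Suc M\<close>, both formulas for the
      mark give \<open>L\<close>.\<close>
    then have "top_x j = (2 * real (j - M) - 1) * L" if "j \<le> Suc M"
      using that by (cases "j = Suc M") (auto simp: top_x_def)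
    then have "mark (k, s) j = (2 * real (j - M) - 1) * L"
      using 2 by simp
    then show ?thesis using 2 L_pos by (simp add: Suc_diff_le)
  next
    case 3
    then show ?thesis using r_pos by simp
  next
    case 4
    then show ?thesis using c_Im[of s] r_pos by auto
  qed
qed

lemma zone_outer: "sqn z = L \<Longrightarrow> zone (lift b z) = (0, 0)"
  by (simp add: zone_def lift_def)

lemma fst_lift [simp]: "fst (lift b z) = z"
  by (simp add: lift_def)

lemma zone_hole:
  assumes "s < M" "sqn (z - c s) = r"
  shows "zone (lift b z) = (1, s)"
proof -
  have "sqn (z - c s) < 2 * r" using assms r_pos by simp
  note near = near_hole[OF assms(1) this]
  have "(THE s. s < M \<and> sqn (z - c s) = r) = s"
    by (rule the_equality) (use assms near(2) in \<open>simp, metis less_irrefl\<close>)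
  moreover have "sqn z \<noteq> L" using near(1) by simp
  ultimately show ?thesis using assms by (auto simp: zone_def)
qed

lemma zone_slit:
  assumes "s < M" "z \<in> isheet" "Re z = Re (c s) - r"
  shows "zone (lift b z) = (if b then 2 else 3, s)"
proof -
  have "(THE s. s < M \<and> Re z = Re (c s) - r) = s"
  proof (rule the_equality)
    fix s' assume "s' < M \<and> Re z = Re (c s') - r"
    then show "s' = s"
      by (cases rule: gap_cases[OF \<open>s < M\<close>, of s']) (use assms r_pos in auto)
  qed (use assms in simp)
  moreover have "sqn z \<noteq> L" "\<not> (\<exists>s<M. sqn (z - c s) = r)"
    using assms(2) by (auto simp: isheet_def)
  ultimately show ?thesis
    using ht_pos[OF assms(2)] by (simp add: zone_def) (simp add: lift_def)
qed

lemma slit_isheet: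
  assumes s: "s < M" and z: "Re z = Re (c s) - r" "Im (c s) + r < Im z" "Im z < L"
  shows "z \<in> isheet"
proof -
  have "r < sqn (z - c s')" if "s' < M" for s'
    by (cases rule: gap_cases[OF s that]) (use z r_pos in \<open>auto simp: less_sqn_iff\<close>)
  moreover have "sqn z < L"
    using z c_Re[OF s] c_Im[OF s] r_pos by (auto simp: sqn_def)
  ultimately show ?thesis by (simp add: isheet_def)
qed

lemma slit_facts:
  assumes s: "s < M" and z: "Re z = Re (c s) - r" "Im (c s) + r < Im z" "Im z < L"
  shows "z \<in> sheet - cut_sheet" "zone (lift b z) = (if b then 2 else 3, s)"
proof -
  have "z \<in> slit s" using z r_pos by (simp add: slit_def)
  then show "z \<in> sheet - cut_sheet"
    using s slit_isheet[OF assms] isheet_subset_sheet by (auto simp: cut_sheet_def)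
qed (rule zone_slit[OF s slit_isheet[OF assms] z(1)])

lemma outer_sheet: "sqn z = L \<Longrightarrow> z \<in> sheet"
  using near_outside[of z] r_pos by (auto simp: sheet_def intro: less_imp_le)

lemma hole_sheet:
  assumes "s < M" "sqn (z - c s) = r"
  shows "z \<in> sheet"
proof -
  have "sqn z < L" "\<And>s'. s' < M \<Longrightarrow> s' \<noteq> s \<Longrightarrow> r < sqn (z - c s')"
    using near_hole[OF assms(1), of z] assms(2) r_pos by auto
  then have "sqn z \<le> L" "\<And>s'. s' < M \<Longrightarrow> r \<le> sqn (z - c s')"
    using assms(2) by (force intro: less_imp_le)+
  then show ?thesis by (simp add: sheet_def)
qed

lemma hole_not_cut_sheet: "s < M \<Longrightarrow> sqn (z - c s) = r \<Longrightarrow> z \<notin> cut_sheet"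
  by (auto simp: cut_sheet_def isheet_def)

lemma outer_not_cut_sheet: "sqn z = L \<Longrightarrow> z \<notin> cut_sheet"
  by (auto simp: cut_sheet_def isheet_def)

lemma Outer_facts:
  assumes "j < M + 4"
  shows "sqn (hpos (Outer j)) = L" (is ?A) "coord (0, 0) (hpos (Outer j)) = mark (0, 0) j" (is ?B)
proof -
  have "?A \<and> ?B"
  proof (cases "j \<le> Suc M")
    case True
    show ?thesis using True L_pos abs_top_x[of j] by (simp add: perim_def sqn_def)
  next
    case False
    then have "j - M < 4" using assms by auto
    then show ?thesis using False corner_perim[OF L_pos, of "j - M"] by simp
  qed
  then show ?A ?B by blast+
qed

lemma vertex_facts:
  assumes "v \<in> HV"
  shows "hpos v \<in> sheet - cut_sheet" (is ?A) "zone (hloc v) = vzone v" (is ?B)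
    "coord (vzone v) (hpos v) = mark (vzone v) (vindex v)" (is ?C)
proof -
  have "?A \<and> ?B \<and> ?C"
  proof (cases v)
    case (Outer j)
    then have j: "j < M + 4" using assms by simp
    show ?thesis
      using Outer Outer_facts[OF j] outer_sheet zone_outer outer_not_cut_sheet
      by (auto simp: hloc_def simp del: hpos.simps coord.simps mark.simps)
  next
    case (Hole s i)
    then have s: "s < M" "i < 4" using assms by simp_all
    then have "sqn (hpos v - c s) = r" using corner_perim(1)[OF r_pos, of i] Hole by simp
    then show ?thesis
      using Hole s corner_perim(2)[OF r_pos s(2)] zone_hole[OF s(1)] hole_sheet[OF s(1)] hole_not_cut_sheet[OF s(1)]
      by (auto simp: hloc_def)
  next
    case (Mid b s)
    then have s: "s < M" using assms by simp
    have "Re (hpos v) = Re (c s) - r" "Im (c s) + r < Im (hpos v)" "Im (hpos v) < L"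
      using c_Im[OF s] r_pos Mid by auto
    from slit_facts[OF s this] show ?thesis using Mid by (simp add: hloc_def)
  qed
  then show ?A ?B ?C by blast+
qed

lemma OuterE_facts:
  assumes "j < M + 4" "0 < t" "t < 1"
  shows "sqn (eline (OuterE j) t) = L" (is ?A) "mark (0, 0) j < coord (0, 0) (eline (OuterE j) t)" (is ?B)
    "coord (0, 0) (eline (OuterE j) t) < mark (0, 0) (Suc j)" (is ?C)
proof -
  have "?A \<and> ?B \<and> ?C"
  proof (cases "j \<le> M")
    case True
    define x where "x = top_x j + t * (top_x (Suc j) - top_x j)"
    have e: "eline (OuterE j) t = Complex x L"
      using True by (simp add: eline_def linepath_coords x_def)
    have "0 < t * (top_x (Suc j) - top_x j)" "t * (top_x (Suc j) - top_x j) < top_x (Suc j) - top_x j"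
      using top_x_less[OF True] assms mult_strict_right_mono[of t 1 "top_x (Suc j) - top_x j"] by simp_all
    then have x: "top_x j < x" "x < top_x (Suc j)"
      unfolding x_def by linarith+
    show ?thesis using True x L_pos abs_top_x[of j] abs_top_x[of "Suc j"] by (simp add: e perim_def sqn_def)
  next
    case False
    define i where "i = j - M"
    have i: "i < 4" "1 \<le> i" "j = M + i" using False assms by (auto simp: i_def)
    have 1: "hpos (Outer j) = corner L i"
      using i by (cases "i = 1") (auto simp: top_x_def corner_def)
    have 2: "hpos (tgt (OuterE j)) = corner L (next4 i)"
      using i by (cases "i = 3") (auto simp: top_x_def corner_def)
    have "mark (0, 0) j = (2 * real i - 1) * L"
      using i by (cases "i = 1") (auto simp: top_x_def)
    moreover have "mark (0, 0) (Suc j) = (2 * real (Suc i) - 1) * L"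
      using i by simp
    ultimately show ?thesis
      using side_perim[OF L_pos i(1) assms(2,3)] by (simp add: eline_def 1 2 del: hpos.simps tgt.simps mark.simps)
  qed
  then show ?A ?B ?C by blast+
qed

text \<open>Together with \<open>vertex_facts\<close> this yields every disjointness claim about the
  skeleton: a vertex sits at a mark, the interior of an edge strictly between two consecutive marks
  of one zone, and marks are strictly increasing.\<close>

lemma edge_facts:
  assumes e: "e \<in> HE" and t: "0 < t" "t < 1"
  shows "eline e t \<in> sheet - cut_sheet" (is ?A) "zone (harc e t) = ezone e" (is ?B)
    "mark (ezone e) (eindex e) < coord (ezone e) (eline e t)" (is ?C)
    "coord (ezone e) (eline e t) < mark (ezone e) (Suc (eindex e))" (is ?D)
proof -
  have "?A \<and> ?B \<and> ?C \<and> ?D"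
  proof (cases e)
    case (OuterE j)
    then have j: "j < M + 4" using e by simp
    show ?thesis
      using OuterE OuterE_facts[OF j t] outer_sheet zone_outer outer_not_cut_sheet
      by (auto simp: harc_def simp del: hpos.simps coord.simps mark.simps)
  next
    case (HoleE s i)
    then have s: "s < M" "i < 4" using e by simp_all
    have eq: "eline e t - c s = linepath (corner r i) (corner r (next4 i)) t"
      using HoleE by (simp add: eline_def linepath_def algebra_simps)
    note f = side_perim[OF r_pos s(2) t, folded eq]
    show ?thesis
      using HoleE f zone_hole[OF s(1) f(1)] hole_sheet[OF s(1) f(1)] hole_not_cut_sheet[OF s(1) f(1)] s
      by (auto simp: harc_def)
  next
    case (LowE b s)
    then have s: "s < M" using e by simp
    define d where "d = (L - (Im (c s) + r)) / 2"
    have "0 < d" using c_Im[OF s] r_pos by (simp add: d_def)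
    then have d: "0 < t * d" "t * d < d" using t by simp_all
    have eq: "Re (eline e t) = Re (c s) - r" "Im (eline e t) = Im (c s) + r + t * d"
      using LowE by (simp_all add: eline_def linepath_coords corner_def d_def field_simps)
    have "2 * d = L - (Im (c s) + r)" by (simp add: d_def)
    then have y: "Im (c s) + r < Im (eline e t)" "Im (eline e t) < (Im (c s) + r + L) / 2" "Im (eline e t) < L"
      using eq(2) d by argo+
    show ?thesis
      using slit_facts[OF s eq(1) y(1,3)] y LowE by (cases b) (simp_all add: harc_def)
  next
    case (HighE b s)
    then have s: "s < M" using e by simp
    define d where "d = (L - (Im (c s) + r)) / 2"
    have "0 < d" using c_Im[OF s] r_pos by (simp add: d_def)
    then have d: "0 < t * d" "t * d < d" using t by simp_all
    have eq: "Re (eline e t) = Re (c s) - r" "Im (eline e t) = Im (c s) + r + d + t * d"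
      using HighE s by (simp_all add: eline_def linepath_coords top_x_def d_def field_simps)
    have "2 * d = L - (Im (c s) + r)" by (simp add: d_def)
    then have y: "Im (c s) + r < Im (eline e t)" "(Im (c s) + r + L) / 2 < Im (eline e t)" "Im (eline e t) < L"
      using eq(2) d by argo+
    show ?thesis
      using slit_facts[OF s eq(1) y(1,3)] y HighE by (cases b) (simp_all add: harc_def)
  qed
  then show ?A ?B ?C ?D by blast+
qed


lemma vzone_slit: "v \<in> HV \<Longrightarrow> fst (vzone v) \<le> 1 \<or> snd (vzone v) < M"
  by (cases v) auto

lemma ezone_slit: "e \<in> HE \<Longrightarrow> fst (ezone e) \<le> 1 \<or> snd (ezone e) < M"
  by (cases e) auto

lemma inj_mark: "fst \<zeta> \<le> 1 \<or> snd \<zeta> < M \<Longrightarrow> mark \<zeta> i < mark \<zeta> j \<longleftrightarrow> i < j"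
  using strict_mono_mark[of "fst \<zeta>" "snd \<zeta>"] by (simp add: strict_mono_less)

lemma vertex_eqI: "vzone v = vzone w \<Longrightarrow> vindex v = vindex w \<Longrightarrow> v = w"
  by (cases v; cases w) (auto split: if_splits)

lemma edge_eqI: "ezone e = ezone e' \<Longrightarrow> eindex e = eindex e' \<Longrightarrow> e = e'"
  by (cases e; cases e') (auto split: if_splits)

lemma hloc_cases: "hpos v \<in> sheet \<Longrightarrow> hloc v \<in> surf"
  by (auto simp: hloc_def lift_def surf_def)

lemma lift_up_eq_dn: "z \<in> sheet \<Longrightarrow> z \<notin> isheet \<Longrightarrow> lift b z = lift b' z"
  by (auto simp: lift_def up_eq_dn)

lemma lift_surf: "z \<in> sheet \<Longrightarrow> lift b z \<in> surf"
  by (auto simp: lift_def surf_def)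

lemma not_isheet_ends:
  "j < M + 4 \<Longrightarrow> hpos (Outer j) \<notin> isheet" "s < M \<Longrightarrow> i < 4 \<Longrightarrow> hpos (Hole s i) \<notin> isheet"
  using Outer_facts(1)[of j] corner_perim(1)[OF r_pos, of i]
  by (auto simp: isheet_def simp del: hpos.simps(1) intro!: exI[of _ s])

lemma eline_ends: "eline e 0 = hpos (src e)" "eline e 1 = hpos (tgt e)"
  by (simp_all add: eline_def linepath_0' linepath_1')

lemma HE_ends: "e \<in> HE \<Longrightarrow> src e \<in> HV" "e \<in> HE \<Longrightarrow> tgt e \<in> HV"
  by (cases e; auto)+

text \<open>Only the midpoints of slits lie in \<open>isheet\<close>. At all other vertices the two
  lifts agree, so an edge and its end need not be assigned to the same sheet.\<close>

lemma harc_ends: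
  assumes "e \<in> HE"
  shows "harc e 0 = hloc (src e)" "harc e 1 = hloc (tgt e)"
proof -
  have n: "hpos v \<notin> isheet" if "v \<in> HV" "\<And>b s. v \<noteq> Mid b s" for v
    using that not_isheet_ends by (cases v) auto
  have "lift (esheet e) (hpos v) = hloc v" if "v \<in> HV" "v \<in> {src e, tgt e}" for v
  proof (cases "\<exists>b s. v = Mid b s")
    case True
    then show ?thesis using that(2) by (cases e) (auto simp: hloc_def split: if_splits)
  next
    case False
    then show ?thesis
      using lift_up_eq_dn n[OF that(1)] vertex_facts(1)[OF that(1)] by (auto simp: hloc_def)
  qed
  then show "harc e 0 = hloc (src e)" "harc e 1 = hloc (tgt e)"
    using HE_ends[OF assms] by (auto simp: harc_def eline_ends)
qed

lemma eline_sheet: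
  assumes "e \<in> HE" "0 \<le> t" "t \<le> 1"
  shows "eline e t \<in> sheet - cut_sheet"
proof (cases "t = 0 \<or> t = 1")
  case True
  then show ?thesis using vertex_facts(1) HE_ends[OF assms(1)] eline_ends by metis
next
  case False
  then show ?thesis using edge_facts(1)[OF assms(1)] assms by auto
qed

lemma src_neq_tgt: "src e \<noteq> tgt e"
  by (cases e) auto

lemma inj_hloc: "inj_on hloc HV"
proof (rule inj_onI)
  fix v w assume vw: "v \<in> HV" "w \<in> HV" "hloc v = hloc w"
  then have z: "vzone v = vzone w" using vertex_facts(2) by metis
  have "hpos v = hpos w" using vw(3) by (metis fst_lift hloc_def)
  then have "mark (vzone v) (vindex v) = mark (vzone v) (vindex w)"
    using vertex_facts(3) vw z by metis
  then have "vindex v = vindex w"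
    using inj_mark[OF vzone_slit[OF vw(1)]] by (metis less_irrefl nat_neq_iff)
  then show "v = w" using z vertex_eqI by blast
qed

lemma arc_system_skeleton: "arc_system surf HV HE src tgt hloc harc"
proof
  show "finite HV" by (simp add: HV_def)
  show "src e \<in> HV" "tgt e \<in> HV" "src e \<noteq> tgt e" if "e \<in> HE" for e
    using HE_ends[OF that] src_neq_tgt by auto
  show "inj_on (\<lambda>e. {src e, tgt e}) HE"
  proof (rule inj_onI)
    fix e e' assume "e \<in> HE" "e' \<in> HE" "{src e, tgt e} = {src e', tgt e'}"
    then show "e = e'"
      by (cases e; cases e') (auto simp: doubleton_eq_iff split: if_splits)
  qed
  show "inj_on hloc HV" by (rule inj_hloc)
  show "hloc ` HV \<subseteq> surf"
    using vertex_facts(1) hloc_cases by blast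
  show "harc e 0 = hloc (src e)" "harc e 1 = hloc (tgt e)" if "e \<in> HE" for e
    using harc_ends[OF that] by auto
  show "continuous_on {0..1} (harc e)" for e
    unfolding harc_def lift_def eline_def
    by (cases "esheet e") (auto intro!: continuous_intros)
  show "inj_on (harc e) {0..1}" if e: "e \<in> HE" for e
  proof -
    have "hpos (src e) \<noteq> hpos (tgt e)"
    proof
      assume eq: "hpos (src e) = hpos (tgt e)"
      then have "eline e t = hpos (src e)" for t
        by (simp add: eline_def linepath_def algebra_simps flip: scaleR_add_left)
      then have "coord (ezone e) (eline e (1/2)) = coord (ezone e) (eline e (1/4))" by simp
      have "lift (esheet e) (hpos (src e)) = lift (esheet e) (hpos (tgt e))" using eq by simp
      then have "hloc (src e) = hloc (tgt e)"
        using harc_ends[OF e] by (simp add: harc_def eline_ends)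
      then show False
        using inj_hloc HE_ends[OF e] src_neq_tgt by (metis inj_onD)
    qed
    then have "inj_on (eline e) {0..1}"
      unfolding eline_def using inj_on_linepath by blast
    then show ?thesis
      unfolding inj_on_def harc_def by (metis fst_lift)
  qed
  show "harc e ` {0..1} \<subseteq> surf" if "e \<in> HE" for e
    using eline_sheet[OF that] lift_surf by (auto simp: harc_def)
  show "harc e t \<noteq> hloc v" if "e \<in> HE" "0 < t" "t < 1" "v \<in> HV" for e t v
  proof
    assume eq: "harc e t = hloc v"
    then have z: "ezone e = vzone v"
      using edge_facts(2) vertex_facts(2) that by metis
    have "eline e t = hpos v" using eq by (metis fst_lift harc_def hloc_def)
    then have "mark (ezone e) (eindex e) < mark (ezone e) (vindex v)"
      "mark (ezone e) (vindex v) < mark (ezone e) (Suc (eindex e))"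
      using edge_facts(3,4)[OF that(1-3)] vertex_facts(3)[OF that(4)] z by simp_all
    then show False
      unfolding inj_mark[OF ezone_slit[OF that(1)]] by simp
  qed
  show "harc e t \<noteq> harc e' u"
    if "e \<in> HE" "e' \<in> HE" "e \<noteq> e'" "0 < t" "t < 1" "0 < u" "u < 1" for e e' t u
  proof
    assume eq: "harc e t = harc e' u"
    then have z: "ezone e = ezone e'"
      using edge_facts(2) that by metis
    have "eline e t = eline e' u" using eq by (metis fst_lift harc_def)
    then have "mark (ezone e) (eindex e) < mark (ezone e) (Suc (eindex e'))"
      "mark (ezone e) (eindex e') < mark (ezone e) (Suc (eindex e))"
      using edge_facts(3,4)[OF that(1,4,5)] edge_facts(3,4)[OF that(2,6,7)] z by simp_all
    then have "eindex e = eindex e'"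
      unfolding inj_mark[OF ezone_slit[OF that(1)]] by simp
    from edge_eqI[OF z this] that(3) show False by contradiction
  qed
qed

sublocale skeleton: arc_system surf HV HE src tgt hloc harc
  by (rule arc_system_skeleton)

section \<open>Complement and faces of the skeleton\<close>

lemma top_interval:
  assumes "\<bar>x\<bar> \<le> L"
  obtains j where "j \<le> M" "top_x j \<le> x" "x \<le> top_x (Suc j)"
proof -
  have "\<exists>j\<le>M. top_x j \<le> x \<and> x \<le> top_x (Suc j)" if "x \<le> top_x (Suc n)" "n \<le> M" for n
    using that
  proof (induction n)
    case 0
    have "top_x 0 \<le> x" using assms by (simp add: top_x_def)
    with 0 show ?case by blast
  next
    case (Suc n)
    show ?case
    proof (cases "x \<le> top_x (Suc n)")
      case True
      then show ?thesis using Suc.IH Suc.prems by simp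
    next
      case False
      then show ?thesis using Suc.prems by (intro exI[of _ "Suc n"]) simp
    qed
  qed
  moreover have "x \<le> top_x (Suc M)" using assms by (simp add: top_x_def)
  ultimately show thesis using that by blast
qed

lemma harc_image: "harc e ` {0..1} = lift (esheet e) ` closed_segment (hpos (src e)) (hpos (tgt e))"
  unfolding harc_def eline_def linepath_image_01[symmetric] by (simp add: image_image)

text \<open>The choice of \<open>b\<close> matters only on the slits: elsewhere a point of the sheet
  outside \<open>cut_sheet\<close> is on the boundary, where both lifts coincide.\<close>

lemma skeleton_cover:
  assumes "z \<in> sheet" "z \<notin> cut_sheet"
  shows "\<exists>e\<in>HE. z \<in> closed_segment (hpos (src e)) (hpos (tgt e)) \<and> (z \<in> isheet \<longrightarrow> esheet e = b)"
proof -
  consider "sqn z = L" | s where "s < M" "sqn (z - c s) = r" | "z \<in> isheet"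
    using assms(1) by (force simp: isheet_def sheet_def)
  then show ?thesis
  proof cases
    case 1
    then have n: "z \<notin> isheet" by (simp add: isheet_def)
    obtain i where i: "i < 4" "z \<in> closed_segment (corner L i) (corner L (next4 i))"
      using square_sides[OF 1] .
    show ?thesis
    proof (cases "i = 0")
      case True
      then have z: "Im z = L" "\<bar>Re z\<bar> \<le> L"
        using i L_pos by (auto simp: corner_def segment_horizontal)
      obtain j where "j \<le> M" "top_x j \<le> Re z" "Re z \<le> top_x (Suc j)"
        using top_interval[OF z(2)] .
      then show ?thesis
        using z n by (intro bexI[of _ "OuterE j"]) (auto simp: segment_horizontal)
    next
      case False
      have "hpos (Outer (M + i)) = corner L i"
        using False by (cases "i = 1") (auto simp: top_x_def corner_def)
      moreover have "hpos (tgt (OuterE (M + i))) = corner L (next4 i)"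
        using i False by (cases "i = 3") (auto simp: top_x_def corner_def)
      ultimately show ?thesis
        using i n by (intro bexI[of _ "OuterE (M + i)"]) (simp_all del: hpos.simps tgt.simps(1))
    qed
  next
    case (2 s)
    then have n: "z \<notin> isheet" by (auto simp: isheet_def)
    obtain i where i: "i < 4" "z - c s \<in> closed_segment (corner r i) (corner r (next4 i))"
      using square_sides[OF 2(2)] .
    then have "c s + (z - c s) \<in> closed_segment (c s + corner r i) (c s + corner r (next4 i))"
      by (simp only: closed_segment_translation_eq)
    then show ?thesis
      using i n 2(1) by (intro bexI[of _ "HoleE s i"]) auto
  next
    case 3
    then obtain s where s: "s < M" "Re z = Re (c s) - r" "Im (c s) \<le> Im z"
      using assms(2) by (auto simp: cut_sheet_def slit_def)
    have "r < sqn (z - c s)" "sqn z < L" using 3 s by (auto simp: isheet_def)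
    then have y: "Im (c s) + r < Im z" "Im z < L"
      using s r_pos by (auto simp: sqn_def)
    have z: "z = Complex (Re (c s) - r) (Im z)" using s by (simp add: complex_eq_iff)
    show ?thesis
    proof (cases "Im z \<le> (Im (c s) + r + L) / 2")
      case True
      then have "z \<in> closed_segment (hpos (Hole s 0)) (hpos (Mid b s))"
        using y s by (simp add: corner_def closed_segment_same_Re closed_segment_eq_real_ivl)
      then show ?thesis using s by (intro bexI[of _ "LowE b s"]) auto
    next
      case False
      then have "z \<in> closed_segment (hpos (Mid b s)) (hpos (Outer (Suc s)))"
        using y s by (simp add: top_x_def closed_segment_same_Re closed_segment_eq_real_ivl)
      then show ?thesis using s by (intro bexI[of _ "HighE b s"]) auto
    qed
  qed
qed

lemma skeleton_complement:
  "surf - drawing skeleton.gr hloc skeleton.\<gamma> = up ` cut_sheet \<union> dn ` cut_sheet" (is "?A = ?B")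
proof
  show "?A \<subseteq> ?B"
  proof
    fix p assume p: "p \<in> ?A"
    then obtain b z where z: "z \<in> sheet" "p = lift b z"
      by (auto simp: surf_def lift_def) metis+
    have "z \<in> cut_sheet"
    proof (rule ccontr)
      assume "z \<notin> cut_sheet"
      then obtain e where e: "e \<in> HE" "z \<in> closed_segment (hpos (src e)) (hpos (tgt e))"
        "z \<in> isheet \<longrightarrow> esheet e = b"
        using skeleton_cover[OF z(1)] by blast
      then have "p = lift (esheet e) z"
        using z lift_up_eq_dn by (cases "z \<in> isheet") auto
      then have "p \<in> harc e ` {0..1}" using e by (auto simp: harc_image)
      then show False using p e(1) by (auto simp: skeleton.drawing_eq)
    qed
    then show "p \<in> ?B" using z by (auto simp: lift_def)
  qed
  show "?B \<subseteq> ?A"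
  proof -
    have "fst p \<notin> cut_sheet" if d: "p \<in> drawing skeleton.gr hloc skeleton.\<gamma>" for p
    proof -
      consider v where "v \<in> HV" "p = hloc v" | e t where "e \<in> HE" "0 \<le> t" "t \<le> 1" "p = harc e t"
        using d by (auto simp: skeleton.drawing_eq)
      then show ?thesis
        using vertex_facts(1) eline_sheet by cases (simp_all add: hloc_def harc_def)
    qed
    moreover have "?B \<subseteq> surf"
      using cut_sheet_subset isheet_subset_sheet unfolding surf_def by blast
    moreover have "fst p \<in> cut_sheet" if "p \<in> ?B" for p using that by auto
    ultimately show ?thesis by blast
  qed
qed

lemma slit_lift_disc:
  "subtopology (top_of_set surf) (lift b ` cut_sheet) homeomorphic_space top_of_set (ball (0::complex) 1)"
proof -
  have sub: "cut_sheet \<subseteq> sheet" using cut_sheet_subset isheet_subset_sheet by blast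
  have "lift b ` cut_sheet homeomorphic cut_sheet"
    using homeomorphism_up[OF sub, THEN homeomorphism_symD]
      homeomorphism_dn[OF sub, THEN homeomorphism_symD]
    unfolding homeomorphic_def lift_def by (cases b) auto
  then have "lift b ` cut_sheet homeomorphic ball (0::complex) 1"
    using cut_sheet_disc homeomorphic_trans by blast
  moreover have "lift b ` cut_sheet \<subseteq> surf" using sub lift_surf by blast
  ultimately show ?thesis
    using homeomorphic_space_top_of_set unfolding homeomorphic_def
    by (auto simp: subtopology_subtopology Int_absorb1)
qed

lemma faces_skeleton:
  "faces (top_of_set surf) skeleton.gr hloc skeleton.\<gamma> = {up ` cut_sheet, dn ` cut_sheet}"
proof -
  have sub: "cut_sheet \<subseteq> sheet" using cut_sheet_subset isheet_subset_sheet by blast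
  let ?C = "up ` cut_sheet \<union> dn ` cut_sheet"
  have X: "subtopology (top_of_set surf) (topspace (top_of_set surf) - drawing skeleton.gr hloc skeleton.\<gamma>)
      = top_of_set ?C"
    using skeleton_complement sub by (auto simp: subtopology_subtopology surf_def intro!: arg_cong[of _ _ top_of_set])
  have "up ` cut_sheet = ?C \<inter> (\<lambda>p. Re (snd p)) -` {0<..}" "dn ` cut_sheet = ?C \<inter> (\<lambda>p. Re (snd p)) -` {..<0}"
    using ht_pos cut_sheet_subset by (fastforce dest: less_asym)+
  moreover have "openin (top_of_set ?C) (?C \<inter> (\<lambda>p. Re (snd p)) -` {0<..})"
    "openin (top_of_set ?C) (?C \<inter> (\<lambda>p. Re (snd p)) -` {..<0})"
    by (auto intro!: continuous_openin_preimage_gen continuous_intros)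
  moreover have "up ` cut_sheet \<inter> dn ` cut_sheet = {}"
    using cut_sheet_subset sub up_eq_dn_iff by blast
  moreover have "connected (up ` cut_sheet)" "connected (dn ` cut_sheet)"
    by (auto intro!: connected_continuous_image connected_cut_sheet continuous_intros)
  ultimately show ?thesis
    unfolding faces_def X using cut_sheet_ne
    by (intro connected_components_of_two_open)
      (auto simp: connectedin_subtopology connectedin_iff_connected)
qed

text \<open>There are \<open>7 * M + 4\<close> vertices, \<open>9 * M + 4\<close> edges and 2 faces,
  hence the Euler characteristic is \<open>2 - 2 * M\<close>.\<close>

lemma euler_genus_surf: "has_euler_genus (top_of_set surf) (2 * M)"
proof (rule has_euler_genusI)
  have "up ` cut_sheet \<noteq> dn ` cut_sheet"
  proof -
    obtain z where z: "z \<in> cut_sheet" using cut_sheet_ne by blast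
    then have "up z \<notin> dn ` cut_sheet"
      using up_eq_dn_iff cut_sheet_subset isheet_subset_sheet by blast
    then show ?thesis using z by blast
  qed
  then show "int (card (verts skeleton.gr)) - int (card (edges skeleton.gr)) +
      int (card (faces (top_of_set surf) skeleton.gr hloc skeleton.\<gamma>)) = 2 - int (2 * M)"
    using card_HV card_HE skeleton.card_edges by (simp add: faces_skeleton) (simp add: arc_graph_def)
  show "cellular_embedding (top_of_set surf) skeleton.gr hloc skeleton.\<gamma>"
    unfolding cellular_embedding_def faces_skeleton
    using skeleton.embedded slit_lift_disc[of True] slit_lift_disc[of False] by (auto simp: lift_def)
qed

end

section \<open>Renaming, minors and apex vertices\<close>

lemma set_map_cyclically_consecutive:
  assumes "\<Omega> \<noteq> []" "cyclically_consecutive \<Omega> S"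
  shows "cyclically_consecutive (map f \<Omega>) (f ` S)"
proof -
  obtain i l where S: "S = (\<lambda>j. \<Omega> ! ((i + j) mod length \<Omega>)) ` {..<l}"
    using assms(2) by (auto simp: cyclically_consecutive_def)
  have "f ` S = (\<lambda>j. map f \<Omega> ! ((i + j) mod length (map f \<Omega>))) ` {..<l}"
    unfolding S image_image using assms(1) by (intro image_cong refl) simp
  then show ?thesis unfolding cyclically_consecutive_def by blast
qed

lemma circular_decomposition_map_graph:
  assumes inj: "inj f" and ne: "\<Omega> \<noteq> []" and C: "circular_decomposition G \<Omega> C"
  shows "circular_decomposition (map_graph f G) (map f \<Omega>) (\<lambda>w. f ` C (inv f w))"
  unfolding circular_decomposition_def
proof (intro conjI ballI)
  fix u assume "u \<in> verts (map_graph f G)"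
  then obtain u0 where u: "u0 \<in> verts G" "u = f u0" by (auto simp: map_graph_def)
  have "{w \<in> set (map f \<Omega>). u \<in> f ` C (inv f w)} = f ` {w \<in> set \<Omega>. u0 \<in> C w}"
    using inj u(2) by (auto simp: inj_eq)
  moreover have "cyclically_consecutive \<Omega> {w \<in> set \<Omega>. u0 \<in> C w}"
    using C u(1) by (simp add: circular_decomposition_def)
  ultimately show "cyclically_consecutive (map f \<Omega>) {w \<in> set (map f \<Omega>). u \<in> f ` C (inv f w)}"
    using set_map_cyclically_consecutive[OF ne] by simp
  obtain w where "w \<in> set \<Omega>" "u0 \<in> C w"
    using C u(1) by (auto simp: circular_decomposition_def)
  then show "\<exists>w\<in>set (map f \<Omega>). u \<in> f ` C (inv f w)"
    using inj u(2) by (intro bexI[of _ "f w"]) auto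
next
  fix e assume "e \<in> edges (map_graph f G)"
  then obtain e0 where e: "e0 \<in> edges G" "e = f ` e0" by (auto simp: map_graph_def)
  then obtain w where "w \<in> set \<Omega>" "e0 \<subseteq> C w"
    using C by (auto simp: circular_decomposition_def)
  then show "\<exists>w\<in>set (map f \<Omega>). e \<subseteq> f ` C (inv f w)"
    using inj e(2) by (intro bexI[of _ "f w"]) auto
next
  fix w assume "w \<in> set (map f \<Omega>)"
  then obtain w0 where "w0 \<in> set \<Omega>" "w = f w0" by auto
  then show "w \<in> f ` C (inv f w)" "f ` C (inv f w) \<subseteq> verts (map_graph f G)"
    using C inj by (auto simp: circular_decomposition_def map_graph_def)
qed

lemma vortex_width_le:
  assumes "circular_decomposition G \<Omega> C" "\<Omega> \<noteq> []" "\<And>w. w \<in> set \<Omega> \<Longrightarrow> card (C w) \<le> Suc k"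
  shows "vortex_width G \<Omega> \<le> k"
proof -
  have "vortex_width G \<Omega> \<le> decomposition_width \<Omega> C"
    unfolding vortex_width_def using assms(1) by (intro Least_le) auto
  also have "Max ((\<lambda>w. card (C w)) ` set \<Omega>) \<le> Suc k"
    using assms(2,3) by (subst Max_le_iff) auto
  then have "decomposition_width \<Omega> C \<le> k"
    by (simp add: decomposition_width_def)
  finally show ?thesis .
qed

lemma is_vortex_map_graph:
  "inj f \<Longrightarrow> is_vortex G \<Omega> \<Longrightarrow> is_vortex (map_graph f G) (map f \<Omega>)"
  by (auto simp: is_vortex_def simple_graph_map_graph distinct_map inj_on_subset)
    (auto simp: map_graph_def)

lemma disc_for_vortex_map_graph:
  assumes inj: "inj f" and d: "disc_for_vortex G0 loc \<gamma> \<Omega> \<phi>"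
  shows "disc_for_vortex (map_graph f G0) (loc \<circ> inv f) (\<gamma> \<circ> (`) (inv f)) (map f \<Omega>) \<phi>"
proof -
  have "(loc \<circ> inv f) ` f ` A = loc ` A" for A
    using inj by (auto simp: image_iff)
  then have "(loc \<circ> inv f) ` verts (map_graph f G0) = loc ` verts G0"
    "(loc \<circ> inv f) ` set (map f \<Omega>) = loc ` set \<Omega>"
    by (simp_all add: map_graph_def)
  moreover have "(loc \<circ> inv f) (map f \<Omega> ! j) = loc (\<Omega> ! j)" if "j < length \<Omega>" for j
    using that inj by simp
  ultimately show ?thesis
    using d unfolding disc_for_vortex_def drawing_map_graph[OF inj] length_map
    by (simp del: o_apply)
qed

text \<open>Two conveniences: the construction may use any vertex type, which \<open>f\<close>
  renames, and a decomposition with bags of at most \<open>k + 1\<close> vertices takes the place of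
  the minimum in \<open>vortex_width\<close>.\<close>

lemma almost_embeddableI:
  fixes f :: "'u \<Rightarrow> 'v" and X :: "(complex \<times> complex) topology"
  assumes inj: "inj f"
    and "surface X" "has_euler_genus X h" "h \<le> g"
    and emb: "embedded_graph X G0 loc \<gamma>" and "q \<le> p"
    and vortex: "\<And>i. i < q \<Longrightarrow> is_vortex (Gs i) (\<Omega>s i)"
    and decomp: "\<And>i. i < q \<Longrightarrow> circular_decomposition (Gs i) (\<Omega>s i) (C i)"
    and width: "\<And>i w. i < q \<Longrightarrow> w \<in> set (\<Omega>s i) \<Longrightarrow> card (C i w) \<le> Suc k"
    and disj: "\<And>i j. i < q \<Longrightarrow> j < q \<Longrightarrow> i \<noteq> j \<Longrightarrow> verts (Gs i) \<inter> verts (Gs j) = {}"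
    and perim: "\<And>i. i < q \<Longrightarrow> verts (Gs i) \<inter> verts G0 = set (\<Omega>s i)"
    and discs: "\<And>i. i < q \<Longrightarrow> closed_disc X (\<phi>s i)"
      "\<And>i j. i < q \<Longrightarrow> j < q \<Longrightarrow> i \<noteq> j \<Longrightarrow> \<phi>s i ` cball 0 1 \<inter> \<phi>s j ` cball 0 1 = {}"
      "\<And>i. i < q \<Longrightarrow> disc_for_vortex G0 loc \<gamma> (\<Omega>s i) (\<phi>s i)"
    and G: "G = \<lparr>verts = verts G0 \<union> (\<Union>i<q. verts (Gs i)), edges = edges G0 \<union> (\<Union>i<q. edges (Gs i))\<rparr>"
  shows "map_graph f G \<in> almost_embeddable g p k"
proof -
  let ?G0 = "map_graph f G0" and ?Gs = "\<lambda>i. map_graph f (Gs i)" and ?\<Omega>s = "\<lambda>i. map f (\<Omega>s i)"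
  let ?loc = "loc \<circ> inv f" and ?\<gamma> = "\<gamma> \<circ> (`) (inv f)"
  have vw: "vortex_width (?Gs i) (?\<Omega>s i) \<le> k" if "i < q" for i
  proof (rule vortex_width_le)
    have ne: "\<Omega>s i \<noteq> []" using vortex[OF that] by (simp add: is_vortex_def)
    show "circular_decomposition (?Gs i) (?\<Omega>s i) (\<lambda>w. f ` C i (inv f w))"
      by (rule circular_decomposition_map_graph[OF inj ne decomp[OF that]])
    show "?\<Omega>s i \<noteq> []" using ne by simp
    fix w assume "w \<in> set (?\<Omega>s i)"
    then have "inv f w \<in> set (\<Omega>s i)" using inj by force
    moreover have "card (f ` A) = card A" for A
      using inj by (intro card_image inj_on_subset[OF inj]) simp
    ultimately show "card (f ` C i (inv f w)) \<le> Suc k"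
      using width[OF \<open>i < q\<close>] by simp
  qed
  show ?thesis
    unfolding almost_embeddable_def mem_Collect_eq
  proof (intro exI conjI allI impI)
    show "embedded_graph X ?G0 ?loc ?\<gamma>" by (rule embedded_graph_map_graph[OF inj emb])
    show "map_graph f G = \<lparr>verts = verts ?G0 \<union> (\<Union>i<q. verts (?Gs i)),
      edges = edges ?G0 \<union> (\<Union>i<q. edges (?Gs i))\<rparr>"
      by (simp add: G map_graph_def image_Un image_UN)
  next
    fix i j assume "i < q" "j < q" "i \<noteq> j"
    then show "verts (?Gs i) \<inter> verts (?Gs j) = {}"
      using disj image_Int[OF inj] by (metis graph.select_convs(1) image_empty map_graph_def)
  next
    fix i assume "i < q"
    then show "verts (?Gs i) \<inter> verts ?G0 = set (?\<Omega>s i)"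
      using perim[OF \<open>i < q\<close>] image_Int[OF inj, of "verts (Gs i)" "verts G0"]
      by (simp add: map_graph_def)
  next
    fix i assume i: "i < q"
    show "is_vortex (?Gs i) (?\<Omega>s i)" by (rule is_vortex_map_graph[OF inj vortex[OF i]])
    show "vortex_width (?Gs i) (?\<Omega>s i) \<le> k" by (rule vw[OF i])
    show "disc_for_vortex ?G0 ?loc ?\<gamma> (?\<Omega>s i) (\<phi>s i)"
      by (rule disc_for_vortex_map_graph[OF inj discs(3)[OF i]])
  qed (use assms(2-4) \<open>q \<le> p\<close> discs(1,2) in simp_all)
qed

section \<open>Branch sets and apex vertices\<close>

lemma connected_in_singleton: "x \<in> verts G \<Longrightarrow> connected_in G {x}"
  by (simp add: connected_in_def)

lemma connected_in_Un:
  assumes A: "connected_in G A" and B: "connected_in G B" and xy: "x \<in> A" "y \<in> B" "{x, y} \<in> edges G"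
  shows "connected_in G (A \<union> B)"
proof -
  let ?R = "\<lambda>S. {(u, v). u \<in> S \<and> v \<in> S \<and> {u, v} \<in> edges G}"
  have mono: "(?R A)\<^sup>* \<subseteq> (?R (A \<union> B))\<^sup>*" "(?R B)\<^sup>* \<subseteq> (?R (A \<union> B))\<^sup>*"
    by (intro rtrancl_mono; auto)+
  have A': "(u, v) \<in> (?R (A \<union> B))\<^sup>*" if "u \<in> A" "v \<in> A" for u v
    using A that mono(1) unfolding connected_in_def by blast
  have B': "(u, v) \<in> (?R (A \<union> B))\<^sup>*" if "u \<in> B" "v \<in> B" for u v
    using B that mono(2) unfolding connected_in_def by blast
  have "(x, y) \<in> ?R (A \<union> B)" "(y, x) \<in> ?R (A \<union> B)"
    using xy by (auto simp: insert_commute)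
  then have "(u, v) \<in> (?R (A \<union> B))\<^sup>*" "(v, u) \<in> (?R (A \<union> B))\<^sup>*" if "u \<in> A" "v \<in> B" for u v
    using A'[OF that(1) xy(1)] A'[OF xy(1) that(1)] B'[OF that(2) xy(2)] B'[OF xy(2) that(2)]
    by (meson r_into_rtrancl rtrancl_trans)+
  then show ?thesis
    using A B A' B' unfolding connected_in_def by auto
qed

lemma connected_in_star:
  assumes "finite I" "connected_in G A"
    and "\<And>i. i \<in> I \<Longrightarrow> connected_in G (B i) \<and> (\<exists>x\<in>A. \<exists>y\<in>B i. {x, y} \<in> edges G)"
  shows "connected_in G (A \<union> (\<Union>i\<in>I. B i))"
  using assms
proof (induction I)
  case (insert i I)
  then obtain x y where "x \<in> A" "y \<in> B i" "{x, y} \<in> edges G" by blast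
  moreover have "connected_in G (A \<union> (\<Union>i\<in>I. B i))" "connected_in G (B i)"
    using insert by auto
  ultimately have "connected_in G ((A \<union> (\<Union>i\<in>I. B i)) \<union> B i)"
    by (metis connected_in_Un UnI1)
  then show ?case by (simp add: Un_ac)
qed simp

lemma connected_in_path:
  assumes "\<And>j. j \<le> n \<Longrightarrow> connected_in G (B j)"
    and "\<And>j. j < n \<Longrightarrow> \<exists>x\<in>B j. \<exists>y\<in>B (Suc j). {x, y} \<in> edges G"
  shows "connected_in G (\<Union>j\<le>n. B j)"
  using assms
proof (induction n)
  case (Suc n)
  obtain x y where "x \<in> B n" "y \<in> B (Suc n)" "{x, y} \<in> edges G"
    using Suc.prems(2)[of n] by blast
  then have "connected_in G ((\<Union>j\<le>n. B j) \<union> B (Suc n))"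
    using Suc by (intro connected_in_Un[of _ _ _ x y]) auto
  then show ?case by (simp add: atMost_Suc Un_commute)
qed simp

lemma connected_in_map_graph:
  assumes "connected_in G B"
  shows "connected_in (map_graph f G) (f ` B)"
proof -
  let ?R = "{(u, v). u \<in> B \<and> v \<in> B \<and> {u, v} \<in> edges G}"
  let ?R' = "{(u, v). u \<in> f ` B \<and> v \<in> f ` B \<and> {u, v} \<in> edges (map_graph f G)}"
  have "(f x, f y) \<in> ?R'\<^sup>*" if "(x, y) \<in> ?R\<^sup>*" for x y
    using that
  proof induction
    case (step y z)
    then have "(f y, f z) \<in> ?R'"
      by (auto simp: map_graph_def intro!: rev_image_eqI[of "{y, z}"])
    then show ?case using step.IH by (rule rtrancl_into_rtrancl[rotated])
  qed simp
  then show ?thesis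
    using assms unfolding connected_in_def by (auto simp: map_graph_def)
qed

lemma is_minor_map_graph:
  assumes "inj f" "is_minor H G"
  shows "is_minor H (map_graph f G)"
proof -
  obtain B where B: "\<forall>u\<in>verts H. connected_in G (B u)"
    "\<forall>u\<in>verts H. \<forall>v\<in>verts H. u \<noteq> v \<longrightarrow> B u \<inter> B v = {}"
    "\<forall>u v. {u, v} \<in> edges H \<longrightarrow> (\<exists>x\<in>B u. \<exists>y\<in>B v. {x, y} \<in> edges G)"
    using assms(2) by (auto simp: is_minor_def)
  show ?thesis
    unfolding is_minor_def
  proof (intro exI[of _ "\<lambda>u. f ` B u"] conjI ballI allI impI)
    fix u v assume "{u, v} \<in> edges H"
    then obtain x y where "x \<in> B u" "y \<in> B v" "{x, y} \<in> edges G" using B(3) by blast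
    moreover from this(3) have "f ` {x, y} \<in> edges (map_graph f G)"
      unfolding map_graph_def by (metis graph.select_convs(2) image_eqI)
    ultimately show "\<exists>x\<in>f ` B u. \<exists>y\<in>f ` B v. {x, y} \<in> edges (map_graph f G)"
      by auto
  next
    fix u v assume "u \<in> verts H" "v \<in> verts H" "u \<noteq> v"
    then show "f ` B u \<inter> f ` B v = {}"
      using B(2) image_Int[OF assms(1), of "B u" "B v"] by auto
  next
    fix u assume "u \<in> verts H"
    then show "connected_in (map_graph f G) (f ` B u)"
      using B(1) by (intro connected_in_map_graph) simp
  qed
qed

text \<open>The new vertices are numbered from \<open>N\<close> on, beyond all vertices of
  \<open>G\<close>, and are joined to everything; each of them is a branch set by itself.\<close>

lemma add_apex_vertices:
  fixes G :: "nat graph"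
  assumes G: "simple_graph G" "G \<in> almost_embeddable g p k" and minor: "is_minor (complete_graph n) G"
  shows "\<exists>G' :: nat graph. G' \<in> apex_almost_embeddable g p k a \<and> is_minor (complete_graph (a + n)) G'"
proof -
  have "finite (verts G)" using G(1) by (simp add: simple_graph_def)
  from finite_nat_bounded[OF this] obtain N where N: "verts G \<subseteq> {..<N}" ..
  define A where "A = {N..<N + a}"
  define G' where "G' = \<lparr>verts = verts G \<union> A,
    edges = edges G \<union> {{x, y} | x y. x \<in> A \<and> y \<in> verts G \<union> A \<and> x \<noteq> y}\<rparr>"
  have disj: "verts G \<inter> A = {}" using N by (auto simp: A_def)
  have sub: "e \<subseteq> verts G" if "e \<in> edges G" for e
    using that G(1) by (simp add: simple_graph_def)
  have del: "delete_verts G' A = G"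
  proof -
    have "verts G' - A = verts G" using disj by (auto simp: G'_def)
    moreover have "{e \<in> edges G'. e \<inter> A = {}} = edges G"
    proof (intro equalityI subsetI)
      fix e assume "e \<in> edges G"
      then show "e \<in> {e \<in> edges G'. e \<inter> A = {}}"
        using disj sub[of e] by (auto simp: G'_def)
    qed (auto simp: G'_def)
    ultimately show ?thesis by (simp add: delete_verts_def)
  qed
  have "simple_graph G'"
    using G(1) unfolding simple_graph_def G'_def A_def by (auto dest: bspec)
  moreover have "A \<subseteq> verts G'" "card A \<le> a" by (simp_all add: G'_def A_def)
  ultimately have "G' \<in> apex_almost_embeddable g p k a"
    using del G(2) by (auto simp: apex_almost_embeddable_def)
  moreover have "is_minor (complete_graph (a + n)) G'"
  proof -
    have verts: "u \<in> verts (complete_graph n) \<longleftrightarrow> u < n" for u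
      by (simp add: complete_graph_def)
    obtain B where B: "\<And>u. u < n \<Longrightarrow> connected_in G (B u)"
      "\<And>u v. u < n \<Longrightarrow> v < n \<Longrightarrow> u \<noteq> v \<Longrightarrow> B u \<inter> B v = {}"
      "\<And>u v. {u, v} \<in> edges (complete_graph n) \<Longrightarrow> \<exists>x\<in>B u. \<exists>y\<in>B v. {x, y} \<in> edges G"
      using minor unfolding is_minor_def Ball_def verts by blast
    define B' where "B' u = (if u < n then B u else {N + (u - n)})" for u
    have conn: "connected_in G' (B u)" if "u < n" for u
    proof -
      have "{(x, y). x \<in> B u \<and> y \<in> B u \<and> {x, y} \<in> edges G}\<^sup>* \<subseteq>
          {(x, y). x \<in> B u \<and> y \<in> B u \<and> {x, y} \<in> edges G'}\<^sup>*"
        by (intro rtrancl_mono) (auto simp: G'_def)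
      then show ?thesis
        using B(1)[OF that] unfolding connected_in_def by (auto simp: G'_def)
    qed
    have BG: "B u \<subseteq> verts G" "B u \<noteq> {}" if "u < n" for u
      using B(1)[OF that] by (auto simp: connected_in_def)
    have link: "\<exists>x\<in>B' u. \<exists>y\<in>B' v. {x, y} \<in> edges G'"
      if "u < a + n" "v < a + n" "u \<noteq> v" "\<not> u < n" for u v
    proof -
      have u: "N + (u - n) \<in> A" using that by (auto simp: A_def)
      obtain y where y: "y \<in> B' v" "y \<in> verts G \<union> A" "y \<noteq> N + (u - n)"
      proof (cases "v < n")
        case True
        then obtain y where "y \<in> B v" "y \<in> verts G" using BG[OF True] by blast
        then show thesis using that[of y] True disj u by (auto simp: B'_def)
      next
        case False
        then have "N + (v - n) \<in> A" "N + (v - n) \<noteq> N + (u - n)"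
          using \<open>u \<noteq> v\<close> \<open>v < a + n\<close> \<open>\<not> u < n\<close> by (auto simp: A_def)
        then show thesis
          using that[of "N + (v - n)"] False by (simp add: B'_def)
      qed
      then show ?thesis
        using u \<open>\<not> u < n\<close> by (intro bexI[of _ "N + (u - n)"] bexI[of _ y]) (auto simp: G'_def B'_def)
    qed
    show ?thesis
      unfolding is_minor_def
    proof (intro exI[of _ B'] conjI ballI allI impI)
      fix u assume "u \<in> verts (complete_graph (a + n))"
      then have "u < a + n" by (simp add: complete_graph_def)
      then show "connected_in G' (B' u)"
        using conn by (auto simp: B'_def G'_def A_def intro!: connected_in_singleton)
    next
      fix u v assume "u \<in> verts (complete_graph (a + n))" "v \<in> verts (complete_graph (a + n))" "u \<noteq> v"
      then have "u < a + n" "v < a + n" by (simp_all add: complete_graph_def)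
      moreover have "x \<notin> B w" if "w < n" "N \<le> x" for w x
        using BG(1)[OF that(1)] N that(2) by auto
      ultimately show "B' u \<inter> B' v = {}"
        using B(2)[of u v] \<open>u \<noteq> v\<close> by (auto simp: B'_def)
    next
      fix u v assume "{u, v} \<in> edges (complete_graph (a + n))"
      then have uv: "u < a + n" "v < a + n" "u \<noteq> v"
        by (auto simp: complete_graph_def doubleton_eq_iff)
      consider "u < n" "v < n" | "\<not> u < n" | "\<not> v < n" by blast
      then show "\<exists>x\<in>B' u. \<exists>y\<in>B' v. {x, y} \<in> edges G'"
      proof cases
        case 1
        then have "{u, v} \<in> edges (complete_graph n)" using uv by (auto simp: complete_graph_def)
        then show ?thesis using B(3)[of u v] 1 by (auto simp: B'_def G'_def)
      next
        case 2
        then show ?thesis using link uv by blast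
      next
        case 3
        then obtain y x where "y \<in> B' v" "x \<in> B' u" "{y, x} \<in> edges G'"
          using link[of v u] uv by blast
        then show ?thesis by (metis insert_commute)
      qed
    qed
  qed
  ultimately show ?thesis by blast
qed

section \<open>One vortex on a surface of large genus\<close>

text \<open>A radial map from the unit disc to the square \<open>sqn z \<le> 1\<close>, which takes
  the circle to the boundary of the square. It allows the disc of the vortex to be described in
  rectangular coordinates.\<close>

definition squaring :: "complex \<Rightarrow> complex" where
  "squaring z = of_real (norm z / sqn z) * z"

lemma sqn_squaring: "sqn (squaring z) = norm z"
  unfolding squaring_def sqn_of_real_mult by (cases "z = 0") simp_all

lemma norm_squaring: "norm (squaring z) \<le> 2 * norm z"
  using norm_le_sqn[of "squaring z"] by (simp add: sqn_squaring)

lemma inj_squaring: "inj squaring"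
proof (rule injI)
  fix z w assume eq: "squaring z = squaring w"
  \<comment> \<open>The inverse is radial too: it rescales \<open>w\<close> by
    \<open>sqn w / norm w\<close>.\<close>
  have inv: "of_real (sqn (squaring u) / norm (squaring u)) * squaring u = u" for u
  proof (cases "u = 0")
    case False
    then have n: "norm (squaring u) = norm u / sqn u * norm u"
      unfolding squaring_def norm_mult norm_of_real by simp
    show ?thesis
      using False unfolding sqn_squaring n by (simp add: squaring_def)
  qed (simp add: squaring_def)
  show "z = w" using inv[of z] inv[of w] eq by simp
qed

lemma continuous_on_squaring: "continuous_on A squaring"
proof -
  have "isCont squaring z" for z
  proof (cases "z = 0")
    case True
    have "(squaring \<longlongrightarrow> 0) (at 0)"
    proof (rule tendsto_0_le[of "\<lambda>z. z" _ _ 2])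
      show "\<forall>\<^sub>F z in at 0. norm (squaring z) \<le> norm z * 2"
        using norm_squaring by (simp add: mult.commute)
    qed (rule tendsto_ident_at)
    then show ?thesis using True by (simp add: isCont_def squaring_def)
  next
    case False
    have "continuous_on (- {0}) squaring"
      unfolding squaring_def by (auto intro!: continuous_intros)
    then show ?thesis
      using False by (simp add: continuous_on_eq_continuous_at open_delete open_Compl)
  qed
  then show ?thesis by (simp add: continuous_at_imp_continuous_on)
qed

text \<open>The angle \<open>pi / 2 - arctan \<xi>\<close> is the direction of the vector
  \<open>(\<xi>, 1)\<close>, and \<open>squaring\<close> preserves directions.\<close>

lemma squaring_cis_top:
  assumes "\<bar>\<xi>\<bar> \<le> 1"
  shows "squaring (cis (pi / 2 - arctan \<xi>)) = Complex \<xi> 1"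
proof -
  have s: "0 < sqrt (1 + \<xi>\<^sup>2)" by (simp add: add_pos_nonneg)
  have c: "cis (pi / 2 - arctan \<xi>) = of_real (1 / sqrt (1 + \<xi>\<^sup>2)) * Complex \<xi> 1"
    by (simp add: complex_eq_iff cos_diff sin_diff sin_arctan cos_arctan)
  have "sqn (Complex \<xi> 1) = 1" using assms by (simp add: sqn_def)
  then have "sqn (cis (pi / 2 - arctan \<xi>)) = 1 / sqrt (1 + \<xi>\<^sup>2)"
    unfolding c sqn_of_real_mult using s by simp
  then have "squaring (cis (pi / 2 - arctan \<xi>)) = of_real (sqrt (1 + \<xi>\<^sup>2)) * cis (pi / 2 - arctan \<xi>)"
    by (simp add: squaring_def)
  also have "\<dots> = Complex \<xi> 1"
    unfolding c using s by (simp flip: of_real_mult mult.assoc)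
  finally show ?thesis .
qed

lemma squaring_cnj: "squaring (cnj z) = cnj (squaring z)"
  by (simp add: squaring_def sqn_def)

lemma squaring_cis_bottom:
  assumes "\<bar>\<xi>\<bar> \<le> 1"
  shows "squaring (cis (3 * pi / 2 + arctan \<xi>)) = Complex \<xi> (-1)"
proof -
  have "3 * pi / 2 + arctan \<xi> = - (pi / 2 - arctan \<xi>) + 2 * pi" by simp
  then have "cis (3 * pi / 2 + arctan \<xi>) = cis (- (pi / 2 - arctan \<xi>)) * cis (2 * pi)"
    by (simp only: cis_mult)
  also have "\<dots> = cnj (cis (pi / 2 - arctan \<xi>))"
    by (simp add: cis_cnj)
  finally have "squaring (cis (3 * pi / 2 + arctan \<xi>)) = cnj (squaring (cis (pi / 2 - arctan \<xi>)))"
    by (simp only: squaring_cnj)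
  then show ?thesis
    unfolding squaring_cis_top[OF assms] by (simp add: complex_eq_iff)
qed

section \<open>The edges through the holes\<close>

datatype gvertex = A nat | B nat | TA nat | TB nat

instance gvertex :: countable by countable_datatype

locale ribbons =
  fixes m k :: nat
  assumes m_pos: "0 < m" and k_pos: "0 < k"
begin

text \<open>The \<open>n\<close>-th edge passes through the hole \<open>n div K = i * m + j\<close>, where it joins the groups \<open>A\<^sub>i\<close>
  and \<open>B\<^sub>j\<close>; its remainder \<open>n mod K = t * k + s\<close> encodes the two tracks. The centre of the hole \<open>\<sigma>\<close>
  lies on the vertical line \<open>x = X \<sigma>\<close> and on the line \<open>x - y = X (trp \<sigma>)\<close> of slope 1.\<close>

definition K :: nat where "K = k * k"
definition N :: nat where "N = m * m * K"
definition K' :: real where "K' = real K"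
definition W :: real where "W = 4 * K' * real (m * m)"
definition trp :: "nat \<Rightarrow> nat" where "trp \<sigma> = (\<sigma> mod m) * m + \<sigma> div m"
definition X :: "nat \<Rightarrow> real" where "X \<sigma> = 4 * K' * real \<sigma>"
definition ctr :: "nat \<Rightarrow> complex" where "ctr \<sigma> = Complex (X \<sigma>) (X \<sigma> - X (trp \<sigma>))"

lemma K_pos: "0 < K" using k_pos by (simp add: K_def)

lemma K'_pos: "1 \<le> K'" using K_pos by (simp add: K'_def)

lemma N_pos: "0 < N" using K_pos m_pos by (simp add: N_def)

lemma trp_less: "\<sigma> < m * m \<Longrightarrow> trp \<sigma> < m * m"
proof -
  assume "\<sigma> < m * m"
  then have "\<sigma> div m < m" "Suc (\<sigma> mod m) \<le> m"
    using m_pos by (simp_all add: less_mult_imp_div_less Suc_leI)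
  then have "trp \<sigma> < Suc (\<sigma> mod m) * m" "Suc (\<sigma> mod m) * m \<le> m * m"
    by (simp_all only: mult_le_mono1) (simp add: trp_def)
  then show ?thesis by linarith
qed

lemma trp_trp: "\<sigma> < m * m \<Longrightarrow> trp (trp \<sigma>) = \<sigma>"
  using m_pos by (simp add: trp_def less_mult_imp_div_less)

lemma X_gap: "\<sigma> < \<tau> \<Longrightarrow> X \<sigma> + 4 * K' \<le> X \<tau>"
proof -
  assume "\<sigma> < \<tau>"
  then have "real \<sigma> + 1 \<le> real \<tau>" by linarith
  then have "4 * K' * (real \<sigma> + 1) \<le> 4 * K' * real \<tau>"
    using K'_pos by (intro mult_left_mono) auto
  then show ?thesis by (simp add: X_def algebra_simps)
qed

lemma X_range: "0 \<le> X \<sigma>" "\<sigma> < m * m \<Longrightarrow> X \<sigma> \<le> W - 4 * K'"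
  using K'_pos X_gap[of \<sigma> "m * m"] by (auto simp: X_def W_def)

lemma W_ge: "4 * K' \<le> W"
  using m_pos X_range[of 0] by (simp add: X_def)

text \<open>The half-side \<open>3 * W\<close> is generous: the legs turn at heights between
  \<open>- W\<close> and \<open>W\<close>, the diagonal lines need abscissas between
  \<open>- 2 * W\<close> and \<open>W\<close>, and a strip of height \<open>W\<close> at the bottom
  remains for the disc of the vortex.\<close>

lemma holes: "square_holes (m * m) (3 * W) K' ctr"
proof
  show "0 < K'" "K' < 3 * W" using K'_pos W_ge by auto
next
  fix \<sigma> assume s: "\<sigma> < m * m"
  show "\<bar>Re (ctr \<sigma>)\<bar> + 2 * K' \<le> 3 * W" "\<bar>Im (ctr \<sigma>)\<bar> + 2 * K' \<le> 3 * W"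
    using X_range[of \<sigma>] X_range[of "trp \<sigma>"] s trp_less[OF s] K'_pos by (auto simp: ctr_def)
next
  fix \<sigma> \<tau> :: nat assume "\<sigma> < \<tau>"
  then show "Re (ctr \<sigma>) + 3 * K' \<le> Re (ctr \<tau>)"
    using X_gap[of \<sigma> \<tau>] K'_pos by (simp add: ctr_def)
qed

sublocale square_holes "m * m" "3 * W" K' ctr by (rule holes)

text \<open>The half-side \<open>K'\<close> of a hole makes room for its \<open>K\<close> lines at
  unit distance; they arrive at the right half of its lower side.\<close>

definition pos :: "nat \<Rightarrow> real" where "pos n = X (n div K) + real (n mod K)"

text \<open>The rank of the \<open>n\<close>-th edge when holes are sorted by \<open>(j, i)\<close>
  instead of \<open>(i, j)\<close>.\<close>

definition \<beta> :: "nat \<Rightarrow> nat" where "\<beta> n = trp (n div K) * K + n mod K"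

lemma div_K: "n < N \<Longrightarrow> n div K < m * m"
  by (simp add: N_def less_mult_imp_div_less)

lemma mod_K: "real (n mod K) < K'"
  using K_pos by (simp add: K'_def)

lemma \<beta>_div_mod: "\<beta> n div K = trp (n div K)" "\<beta> n mod K = n mod K"
  using K_pos by (simp_all add: \<beta>_def)

lemma \<beta>_less: "n < N \<Longrightarrow> \<beta> n < N"
proof -
  assume "n < N"
  then have "\<beta> n div K < m * m" using trp_less[OF div_K] by (simp add: \<beta>_div_mod)
  then show ?thesis unfolding div_less_iff_less_mult[OF K_pos] N_def .
qed

lemma inj_\<beta>: "inj_on \<beta> {..<N}"
proof (rule inj_onI)
  fix n n' assume n: "n \<in> {..<N}" "n' \<in> {..<N}" "\<beta> n = \<beta> n'"
  then have "trp (n div K) = trp (n' div K)" "n mod K = n' mod K"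
    using \<beta>_div_mod by metis+
  then have "n div K = n' div K"
    using trp_trp[OF div_K] n by (metis lessThan_iff)
  then show "n = n'" using \<open>n mod K = n' mod K\<close> by (metis div_mult_mod_eq)
qed

lemma strict_mono_pos: "strict_mono pos"
proof (rule strict_monoI)
  fix n n' :: nat assume "n < n'"
  then have "n div K \<le> n' div K" by (simp add: div_le_mono)
  show "pos n < pos n'"
  proof (cases "n div K = n' div K")
    case True
    have "n mod K < n' mod K"
      using \<open>n < n'\<close> True by (metis div_mult_mod_eq nat_add_left_cancel_less)
    then show ?thesis using True by (simp add: pos_def)
  next
    case False
    then have "X (n div K) + 4 * K' \<le> X (n' div K)"
      using \<open>n div K \<le> n' div K\<close> by (intro X_gap) simp
    then show ?thesis using mod_K[of n] K'_pos by (simp add: pos_def)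
  qed
qed

lemma pos_eq_iff: "pos n = pos n' \<longleftrightarrow> n = n'"
  using strict_mono_pos by (simp add: strict_mono_eq)

lemma pos_range: "0 \<le> pos n" "n < N \<Longrightarrow> pos n \<le> W - 3 * K'"
  using X_range[of "n div K"] div_K[of n] mod_K[of n] by (auto simp: pos_def)

text \<open>Height at which the \<open>n\<close>-th edge changes from the upper to the lower sheet.\<close>

definition hgt :: "nat \<Rightarrow> real" where
  "hgt n = X (n div K) - X (trp (n div K)) - K'"

lemma hgt_range: "n < N \<Longrightarrow> - W \<le> hgt n" "n < N \<Longrightarrow> hgt n \<le> W"
  using X_range[of "n div K"] X_range[of "trp (n div K)"] div_K[of n] trp_less[OF div_K[of n]] K'_pos
  by (auto simp: hgt_def)

definition vert :: "nat \<Rightarrow> real \<Rightarrow> complex" where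
  "vert n y = Complex (pos n) y"

text \<open>The edges turn on the lower side of a hole, \<open>K'\<close> below its centre. The
  shift by \<open>K'\<close> makes up for this: \<open>vert n\<close> and
  \<open>diag (\<beta> n)\<close> meet at height \<open>hgt n\<close>.\<close>

definition diag :: "nat \<Rightarrow> real \<Rightarrow> complex" where
  "diag n y = Complex (pos n + K' + y) y"

lemma vert_inj [simp]: "vert n y = vert n y' \<longleftrightarrow> y = y'" and diag_inj [simp]: "diag n y = diag n y' \<longleftrightarrow> y = y'"
  by (auto simp: vert_def diag_def)

lemma continuous_on_vert [continuous_intros]: "continuous_on S f \<Longrightarrow> continuous_on S (\<lambda>t. vert n (f t))"
  and continuous_on_diag [continuous_intros]: "continuous_on S f \<Longrightarrow> continuous_on S (\<lambda>t. diag n (f t))"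
  unfolding vert_def diag_def Complex_eq by (intro continuous_intros; assumption)+

lemma vert_diag: "vert n (hgt n) = diag (\<beta> n) (hgt n)"
  by (simp add: vert_def diag_def hgt_def pos_def \<beta>_div_mod)

text \<open>A vertical line crosses the shadow of its own hole only, and it stays below that hole up
  to the turning point.\<close>

lemma vert_isheet:
  assumes n: "n < N" and y: "- 2 * W \<le> y" "y < hgt n"
  shows "vert n y \<in> isheet"
proof -
  have "K' < sqn (vert n y - ctr \<sigma>)" if s: "\<sigma> < m * m" for \<sigma>
  proof -
    consider "\<sigma> = n div K" | "\<sigma> < n div K" | "n div K < \<sigma>" by linarith
    then show ?thesis
    proof cases
      case 1
      then show ?thesis using y by (simp add: less_sqn_iff vert_def ctr_def hgt_def) linarith
    next
      case 2
      then show ?thesis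
        using X_gap[OF 2] K'_pos by (simp add: less_sqn_iff vert_def ctr_def pos_def)
    next
      case 3
      then show ?thesis
        using X_gap[OF 3] K'_pos mod_K[of n] by (simp add: less_sqn_iff vert_def ctr_def pos_def)
    qed
  qed
  moreover have "sqn (vert n y) < 3 * W"
    using pos_range[of n] hgt_range[OF n] n y W_ge K'_pos by (simp add: sqn_def vert_def abs_less_iff)
  ultimately show ?thesis by (simp add: isheet_def)
qed

lemma diag_isheet:
  assumes n: "n < N" and y: "- 2 * W \<le> y" "y < hgt n"
  shows "diag (\<beta> n) y \<in> isheet"
proof -
  have "K' < sqn (diag (\<beta> n) y - ctr \<sigma>)" if s: "\<sigma> < m * m" for \<sigma>
  proof (cases "\<sigma> = n div K")
    case True
    then show ?thesis using y by (simp add: less_sqn_iff diag_def ctr_def hgt_def) linarith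
  next
    case False
    then have "trp \<sigma> \<noteq> trp (n div K)"
      using trp_trp[OF s] trp_trp[OF div_K[OF n]] by metis
    then consider "trp \<sigma> < trp (n div K)" | "trp (n div K) < trp \<sigma>" by linarith
    \<comment> \<open>If \<open>x - y\<close> differs from its value at the centre by more than
      \<open>2 * K'\<close>, then one of the coordinates differs by more than \<open>K'\<close>. The
      spacing \<open>4 * K'\<close> is made for this: in the second case the remainder and the shift
      together use up less than \<open>2 * K'\<close> of it.\<close>
    then have "2 * K' < \<bar>Re (diag (\<beta> n) y - ctr \<sigma>) - Im (diag (\<beta> n) y - ctr \<sigma>)\<bar>"
    proof cases
      case 1
      then show ?thesis
        using X_gap[OF 1] K'_pos by (simp add: diag_def ctr_def pos_def \<beta>_div_mod)
    next
      case 2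
      then show ?thesis
        using X_gap[OF 2] K'_pos mod_K[of n] by (simp add: diag_def ctr_def pos_def \<beta>_div_mod)
    qed
    then show ?thesis unfolding less_sqn_iff by linarith
  qed
  moreover have "sqn (diag (\<beta> n) y) < 3 * W"
    using pos_range[of "\<beta> n"] hgt_range[OF n] \<beta>_less[OF n] y W_ge K'_pos
    by (simp add: sqn_def diag_def abs_less_iff)
  ultimately show ?thesis by (simp add: isheet_def)
qed

lemma turn_sheet:
  assumes n: "n < N"
  shows "vert n (hgt n) \<in> sheet" "vert n (hgt n) \<notin> isheet"
proof -
  have "sqn (vert n (hgt n) - ctr (n div K)) = K'"
    using mod_K[of n] by (simp add: sqn_def vert_def ctr_def hgt_def pos_def)
  then show "vert n (hgt n) \<in> sheet" "vert n (hgt n) \<notin> isheet"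
    using hole_sheet[OF div_K[OF n]] div_K[OF n] by (auto simp: isheet_def)
qed

definition up_leg :: "nat \<Rightarrow> real \<Rightarrow> complex \<times> complex" where
  "up_leg n t = up (vert n (linepath (- 2 * W) (hgt n) t))"

definition dn_leg :: "nat \<Rightarrow> real \<Rightarrow> complex \<times> complex" where
  "dn_leg n t = dn (diag (\<beta> n) (linepath (hgt n) (- 2 * W) t))"

definition edge_path :: "nat \<Rightarrow> real \<Rightarrow> complex \<times> complex" where
  "edge_path n = up_leg n +++ dn_leg n"

lemma W_pos: "0 < W" using W_ge K'_pos by linarith

text \<open>This strip below all holes is kept for the disc of the vortex; the edges end on its
  upper side.\<close>

lemma low_isheet: "\<bar>x\<bar> \<le> 2 * W \<Longrightarrow> - 3 * W < y \<Longrightarrow> y \<le> - 2 * W \<Longrightarrow> Complex x y \<in> isheet"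
  and low_sheet: "\<bar>x\<bar> \<le> 2 * W \<Longrightarrow> - 3 * W \<le> y \<Longrightarrow> y \<le> - 2 * W \<Longrightarrow> Complex x y \<in> sheet"
proof -
  have far: "K' < \<bar>y - Im (ctr \<sigma>)\<bar>" if "y \<le> - 2 * W" "\<sigma> < m * m" for \<sigma>
    using that X_range[of \<sigma>] X_range[of "trp \<sigma>"] trp_less[of \<sigma>] W_pos K'_pos by (simp add: ctr_def)
  show "Complex x y \<in> isheet" if "\<bar>x\<bar> \<le> 2 * W" "- 3 * W < y" "y \<le> - 2 * W"
  proof -
    have "\<bar>x\<bar> < 3 * W" "\<bar>y\<bar> < 3 * W" using that W_pos by auto
    then show ?thesis using far[OF that(3)] unfolding isheet_def less_sqn_iff by (simp add: sqn_def)
  qed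
  show "Complex x y \<in> sheet" if "\<bar>x\<bar> \<le> 2 * W" "- 3 * W \<le> y" "y \<le> - 2 * W"
    using that far W_pos less_imp_le by (intro sheetI) (auto simp: abs_le_iff)
qed

lemma hgt_gt: "n < N \<Longrightarrow> - 2 * W < hgt n"
  using hgt_range(1)[of n] W_pos by linarith

lemma leg_sheet:
  assumes "n < N" "- 2 * W \<le> y" "y \<le> hgt n"
  shows "vert n y \<in> sheet" "diag (\<beta> n) y \<in> sheet"
  using vert_isheet[OF assms(1,2)] diag_isheet[OF assms(1,2)] turn_sheet[OF assms(1)] assms(3)
    isheet_subset_sheet vert_diag by (cases "y = hgt n"; auto)+

text \<open>Points of different sheets coincide only on the boundary, and a leg reaches the boundary
  only where it turns.\<close>

lemma legs_meet:
  assumes n: "n < N" "n' < N" and y: "- 2 * W \<le> y" "y \<le> hgt n" "- 2 * W \<le> y'" "y' \<le> hgt n'"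
    and eq: "up (vert n y) = dn (diag (\<beta> n') y')"
  shows "n = n'" "y = hgt n"
proof -
  have *: "vert n y = diag (\<beta> n') y'" "vert n y \<notin> isheet"
    using eq up_eq_dn_iff[OF leg_sheet(1)[OF n(1) y(1,2)]] by auto
  then show "y = hgt n"
    using vert_isheet[OF n(1) y(1)] y(2) by force
  have "y' = hgt n'"
    using * diag_isheet[OF n(2) y(3)] y(4) by force
  then have "vert n y = vert n' y'" using *(1) vert_diag by simp
  then show "n = n'" by (simp add: vert_def pos_eq_iff)
qed

lemma linepath_real:
  fixes a b t :: real
  assumes "a < b" "0 \<le> t" "t \<le> 1"
  shows "a \<le> linepath a b t" "linepath a b t \<le> b" "0 < t \<Longrightarrow> a < linepath a b t"
proof -
  have eq: "linepath a b t = a + t * (b - a)" by (simp add: linepath_def algebra_simps)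
  have "0 \<le> t * (b - a)" "t * (b - a) \<le> b - a"
    using assms mult_right_mono[of t 1 "b - a"] by simp_all
  then show "a \<le> linepath a b t" "linepath a b t \<le> b" unfolding eq by linarith+
  show "a < linepath a b t" if "0 < t" unfolding eq using assms that by simp
qed

lemma linepath_reverse_real: "linepath (a::real) b t = linepath b a (1 - t)"
  by (simp add: linepath_def)

lemma up_leg_range:
  assumes "n < N" "0 \<le> t" "t \<le> 1"
  shows "\<exists>y. - 2 * W \<le> y \<and> y \<le> hgt n \<and> (0 < t \<longrightarrow> - 2 * W < y) \<and> up_leg n t = up (vert n y)"
  using linepath_real[OF hgt_gt[OF assms(1)] assms(2,3)] by (auto simp: up_leg_def)

lemma dn_leg_range:
  assumes "n < N" "0 \<le> t" "t \<le> 1"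
  shows "\<exists>y. - 2 * W \<le> y \<and> y \<le> hgt n \<and> (t < 1 \<longrightarrow> - 2 * W < y) \<and> dn_leg n t = dn (diag (\<beta> n) y)"
  using linepath_real[OF hgt_gt[OF assms(1)], of "1 - t"] assms(2,3)
  unfolding dn_leg_def linepath_reverse_real[of "hgt n"] by auto

lemma edge_path_range:
  assumes "n < N" "0 \<le> t" "t \<le> 1"
  shows "\<exists>y. - 2 * W \<le> y \<and> y \<le> hgt n \<and> (0 < t \<longrightarrow> t < 1 \<longrightarrow> - 2 * W < y) \<and>
    (edge_path n t = up (vert n y) \<or> edge_path n t = dn (diag (\<beta> n) y))"
proof (cases "t \<le> 1 / 2")
  case True
  then show ?thesis
    using up_leg_range[OF assms(1), of "2 * t"] assms by (force simp: edge_path_def joinpaths_def)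
next
  case False
  then show ?thesis
    using dn_leg_range[OF assms(1), of "2 * t - 1"] assms by (force simp: edge_path_def joinpaths_def)
qed

lemma arc_edge_path:
  assumes n: "n < N"
  shows "arc (edge_path n)"
  unfolding edge_path_def
proof (rule arc_join)
  have inj: "linepath a b t = linepath a b u \<longleftrightarrow> t = u" if "a \<noteq> b" for a b t u :: real
  proof -
    have "linepath a b x = a + x * (b - a)" for x by (simp add: linepath_def algebra_simps)
    then show ?thesis using that by simp
  qed
  show "arc (up_leg n)"
    unfolding arc_def path_def up_leg_def
    using inj[of "- 2 * W" "hgt n"] hgt_gt[OF n]
    by (auto simp: inj_on_def intro!: continuous_intros)
  show "arc (dn_leg n)"
    unfolding arc_def path_def dn_leg_def
    using inj[of "hgt n" "- 2 * W"] hgt_gt[OF n]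
    by (auto simp: inj_on_def intro!: continuous_intros)
  show eq: "pathfinish (up_leg n) = pathstart (dn_leg n)"
    using turn_sheet[OF n] vert_diag[of n] up_eq_dn
    by (simp add: pathfinish_def pathstart_def up_leg_def dn_leg_def linepath_def)
  show "path_image (up_leg n) \<inter> path_image (dn_leg n) \<subseteq> {pathstart (dn_leg n)}"
  proof
    fix p assume "p \<in> path_image (up_leg n) \<inter> path_image (dn_leg n)"
    then obtain t u where t: "0 \<le> t" "t \<le> 1" "p = up_leg n t" and u: "0 \<le> u" "u \<le> 1" "p = dn_leg n u"
      by (auto simp: path_image_def)
    obtain y where y: "- 2 * W \<le> y" "y \<le> hgt n" "p = up (vert n y)"
      using up_leg_range[OF n t(1,2)] t(3) by blast
    obtain y' where y': "- 2 * W \<le> y'" "y' \<le> hgt n" "p = dn (diag (\<beta> n) y')"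
      using dn_leg_range[OF n u(1,2)] u(3) by blast
    have "p = up (vert n (hgt n))"
      using legs_meet(2)[OF n n y(1,2) y'(1,2)] y(3) y'(3) by simp
    then show "p \<in> {pathstart (dn_leg n)}"
      unfolding eq[symmetric] by (simp add: pathfinish_def up_leg_def linepath_def)
  qed
qed

definition rim :: "gvertex set" where
  "rim = A ` {..<N} \<union> B ` {..<N}"

fun gloc :: "gvertex \<Rightarrow> complex \<times> complex" where
  "gloc (A n) = up (vert n (- 2 * W))"
| "gloc (B n) = dn (diag n (- 2 * W))"
| "gloc _ = undefined"

lemma foot_isheet:
  assumes "n < N"
  shows "vert n (- 2 * W) \<in> isheet" "diag n (- 2 * W) \<in> isheet"
  using pos_range[of n] assms W_pos W_ge K'_pos
  by (auto simp: vert_def diag_def intro!: low_isheet)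

lemma foot_neq: "n < N \<Longrightarrow> up (vert n (- 2 * W)) \<noteq> dn z"
  using foot_isheet(1)[of n] isheet_subset_sheet up_eq_dn_iff by blast

lemma arc_system_ribbons: "arc_system surf rim {..<N} A (B \<circ> \<beta>) gloc edge_path"
proof
  show "finite rim" by (simp add: rim_def)
  show "A n \<in> rim" "(B \<circ> \<beta>) n \<in> rim" "A n \<noteq> (B \<circ> \<beta>) n"
    if "n \<in> {..<N}" for n
    using that \<beta>_less by (auto simp: rim_def)
  show "inj_on (\<lambda>n. {A n, (B \<circ> \<beta>) n}) {..<N}"
    by (auto simp: inj_on_def doubleton_eq_iff)
  show "inj_on gloc rim"
    using foot_neq foot_neq[THEN not_sym]
    by (auto simp: inj_on_def rim_def vert_def diag_def pos_eq_iff)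
  show "gloc ` rim \<subseteq> surf"
  proof -
    have "vert n (- 2 * W) \<in> sheet" "diag n (- 2 * W) \<in> sheet" if "n < N" for n
      using foot_isheet[OF that] isheet_subset_sheet by auto
    then show ?thesis by (auto simp: rim_def surf_def)
  qed
  show "continuous_on {0..1} (edge_path n)" "inj_on (edge_path n) {0..1}" if "n \<in> {..<N}" for n
    using arc_edge_path[of n] that by (auto simp: arc_def path_def)
  show "edge_path n ` {0..1} \<subseteq> surf" if "n \<in> {..<N}" for n
  proof
    fix p assume "p \<in> edge_path n ` {0..1}"
    then obtain t where "0 \<le> t" "t \<le> 1" "p = edge_path n t" by auto
    then show "p \<in> surf"
      using edge_path_range[of n t] leg_sheet[of n] that by (auto simp: surf_def)
  qed
  show "edge_path n 0 = gloc (A n)" "edge_path n 1 = gloc ((B \<circ> \<beta>) n)" if "n \<in> {..<N}" for n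
    by (simp_all add: edge_path_def joinpaths_def up_leg_def dn_leg_def linepath_def)
  show "edge_path n t \<noteq> gloc v" if "n \<in> {..<N}" "0 < t" "t < 1" "v \<in> rim" for n t v
  proof -
    have "Im (fst (edge_path n t)) > - 2 * W"
      using edge_path_range[of n t] that by (auto simp: vert_def diag_def)
    moreover have "Im (fst (gloc v)) = - 2 * W"
      using that(4) by (auto simp: rim_def vert_def diag_def)
    ultimately show ?thesis by auto
  qed
  show "edge_path n t \<noteq> edge_path n' u"
    if h: "n \<in> {..<N}" "n' \<in> {..<N}" "n \<noteq> n'" "0 < t" "t < 1" "0 < u" "u < 1" for n n' t u
  proof
    assume eq: "edge_path n t = edge_path n' u"
    obtain y where y: "- 2 * W \<le> y" "y \<le> hgt n"
      "edge_path n t = up (vert n y) \<or> edge_path n t = dn (diag (\<beta> n) y)"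
      using edge_path_range[of n t] h by auto
    obtain y' where y': "- 2 * W \<le> y'" "y' \<le> hgt n'"
      "edge_path n' u = up (vert n' y') \<or> edge_path n' u = dn (diag (\<beta> n') y')"
      using edge_path_range[of n' u] h by auto
    have n: "n < N" "n' < N" using h by auto
    \<comment> \<open>Legs in one sheet lie on parallel lines, which coincide only for the same
      edge; for legs in different sheets \<open>legs_meet\<close> decides.\<close>
    consider "vert n y = vert n' y'" | "diag (\<beta> n) y = diag (\<beta> n') y'"
      | "up (vert n y) = dn (diag (\<beta> n') y')" | "up (vert n' y') = dn (diag (\<beta> n) y)"
      using y(3) y'(3) eq up_inj dn_inj by metis
    then show False
    proof cases
      case 1
      then show False using h(3) by (simp add: vert_def pos_eq_iff)
    next
      case 2
      then have "pos (\<beta> n) = pos (\<beta> n')" by (auto simp: diag_def)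
      then have "\<beta> n = \<beta> n'" by (simp add: pos_eq_iff)
      then show False using inj_\<beta> h(1-3) by (meson inj_onD)
    next
      case 3
      then show False using legs_meet(1)[OF n y(1,2) y'(1,2)] h(3) by blast
    next
      case 4
      then show False using legs_meet(1)[OF n(2,1) y'(1,2) y(1,2)] h(3) by blast
    qed
  qed
qed

sublocale outer: arc_system surf rim "{..<N}" A "B \<circ> \<beta>" gloc edge_path
  by (rule arc_system_ribbons)

section \<open>The disc of the vortex\<close>

definition disc_point :: "complex \<Rightarrow> complex" where
  "disc_point w = Complex (2 * W * Re w) (- 3 * W + W * \<bar>Im w\<bar>)"

text \<open>The square is folded along the real axis, which goes to the lower side of the outer
  square, where the sheets are glued. Its halves fill the bottom strip of the two sheets, and its
  upper and lower sides come to lie at height \<open>- 2 * W\<close>.\<close>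

definition disc_map :: "complex \<Rightarrow> complex \<times> complex" where
  "disc_map z = (if - Im (squaring z) \<le> 0 then up (disc_point (squaring z)) else dn (disc_point (squaring z)))"

lemma disc_point_sheet:
  assumes "sqn w \<le> 1"
  shows "disc_point w \<in> sheet" "Im w \<noteq> 0 \<Longrightarrow> disc_point w \<in> isheet"
    "Im w = 0 \<Longrightarrow> disc_point w \<notin> isheet"
proof -
  have w: "\<bar>Re w\<bar> \<le> 1" "\<bar>Im w\<bar> \<le> 1" using assms by (auto simp: sqn_def)
  have x: "\<bar>2 * W * Re w\<bar> \<le> 2 * W" using w(1) W_pos by (simp add: abs_mult)
  have y: "W * \<bar>Im w\<bar> \<le> W" "0 \<le> W * \<bar>Im w\<bar>" using w(2) W_pos by simp_all
  show "disc_point w \<in> sheet" unfolding disc_point_def using x y by (intro low_sheet) auto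
  show "disc_point w \<in> isheet" if "Im w \<noteq> 0"
  proof -
    have "0 < W * \<bar>Im w\<bar>" using that W_pos by simp
    then show ?thesis unfolding disc_point_def using x y by (intro low_isheet) auto
  qed
  show "disc_point w \<notin> isheet" if "Im w = 0"
    using that W_pos by (auto simp: isheet_def disc_point_def sqn_def)
qed

lemma closed_disc_map: "closed_disc (top_of_set surf) disc_map"
  unfolding closed_disc_def
proof (rule embedding_map_compact)
  have le: "sqn (squaring z) \<le> 1" if "z \<in> cball 0 1" for z
    using that by (simp add: sqn_squaring)
  have cont: "continuous_on S (\<lambda>z. disc_point (squaring z))" for S
    unfolding disc_point_def Complex_eq
    by (intro continuous_intros continuous_on_squaring)
  show "continuous_on (cball 0 1) disc_map"
    unfolding disc_map_def
  proof (rule continuous_on_cases_le)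
    fix z :: complex assume "z \<in> cball 0 1" "- Im (squaring z) = 0"
    then show "up (disc_point (squaring z)) = dn (disc_point (squaring z))"
      using disc_point_sheet[OF le] by (intro up_eq_dn) auto
  qed (intro continuous_intros cont continuous_on_squaring)+
  show "inj_on disc_map (cball 0 1)"
  proof (rule inj_onI)
    fix z w assume zw: "z \<in> cball 0 1" "w \<in> cball 0 1" "disc_map z = disc_map w"
    have "fst (disc_map u) = disc_point (squaring u)" for u by (simp add: disc_map_def)
    then have p: "disc_point (squaring z) = disc_point (squaring w)" using zw(3) by metis
    then have eq: "Re (squaring z) = Re (squaring w)" "\<bar>Im (squaring z)\<bar> = \<bar>Im (squaring w)\<bar>"
      using W_pos by (auto simp: disc_point_def)
    have "Im (squaring z) = Im (squaring w)"
    proof (rule ccontr)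
      assume n: "Im (squaring z) \<noteq> Im (squaring w)"
      then have "Im (squaring z) \<noteq> 0" using eq(2) by auto
      then have "disc_point (squaring z) \<in> isheet"
        using disc_point_sheet(2)[OF le[OF zw(1)]] by simp
      then have "up (disc_point (squaring z)) \<noteq> dn (disc_point (squaring z))"
        using up_eq_dn_iff isheet_subset_sheet by blast
      then show False
        using zw(3) n eq(2) p by (auto simp: disc_map_def split: if_splits)
    qed
    then have "squaring z = squaring w" using eq(1) by (simp add: complex_eq_iff)
    then show "z = w" using inj_squaring by (simp add: inj_eq)
  qed
  show "disc_map ` cball 0 1 \<subseteq> surf"
    using disc_point_sheet(1)[OF le] by (auto simp: disc_map_def surf_def)
qed simp

text \<open>Counterclockwise order: the upper side of the unfolded square carries the
  \<open>A n\<close> and is passed from right to left, the lower side carries the \<open>B n\<close>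
  and is passed from left to right.\<close>

definition perimeter :: "gvertex list" where
  "perimeter = rev (map A [0..<N]) @ map B [0..<N]"

lemma set_perimeter: "set perimeter = rim"
  by (auto simp: perimeter_def rim_def)

lemma length_perimeter: "length perimeter = 2 * N"
  by (simp add: perimeter_def)

lemma perimeter_nth: "j < 2 * N \<Longrightarrow> perimeter ! j = (if j < N then A (N - 1 - j) else B (j - N))"
  by (auto simp: perimeter_def nth_append rev_nth)

text \<open>The abscissas of \<open>A n\<close> and \<open>B n\<close> divided by
  \<open>2 * W\<close> are the values \<open>\<xi>\<close> of \<open>squaring_cis_top\<close> and
  \<open>squaring_cis_bottom\<close>.\<close>

definition angle :: "nat \<Rightarrow> real" where
  "angle j = (if j < N then pi / 2 - arctan (pos (N - 1 - j) / (2 * W))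
     else 3 * pi / 2 + arctan ((pos (j - N) + K' - 2 * W) / (2 * W)))"

lemma angle_ranges:
  "j < N \<Longrightarrow> 0 < angle j \<and> angle j < pi" "\<not> j < N \<Longrightarrow> pi < angle j \<and> angle j < 2 * pi"
  using arctan_lbound arctan_ubound by (auto simp: angle_def field_simps)
    (smt (verit, best) arctan_lbound arctan_ubound)+

lemma strict_mono_angle: "strict_mono_on {..<2 * N} angle"
proof (rule strict_mono_onI)
  fix i j assume ij: "i \<in> {..<2 * N}" "j \<in> {..<2 * N}" "i < j"
  consider "j < N" | "i < N" "\<not> j < N" | "\<not> i < N" using ij by linarith
  then show "angle i < angle j"
  proof cases
    case 1
    then have "pos (N - 1 - j) < pos (N - 1 - i)"
      using ij strict_mono_pos by (simp add: strict_mono_less)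
    then show ?thesis
      using 1 ij W_pos by (simp add: angle_def arctan_less_iff divide_strict_right_mono)
  next
    case 2
    then show ?thesis using angle_ranges(1)[of i] angle_ranges(2)[of j] by linarith
  next
    case 3
    then have "pos (i - N) < pos (j - N)"
      using ij strict_mono_pos by (simp add: strict_mono_less)
    then show ?thesis
      using 3 ij W_pos by (simp add: angle_def arctan_less_iff divide_strict_right_mono)
  qed
qed

lemma gloc_angle:
  assumes "j < 2 * N"
  shows "gloc (perimeter ! j) = disc_map (cis (angle j))"
proof (cases "j < N")
  case True
  define \<xi> where "\<xi> = pos (N - 1 - j) / (2 * W)"
  have "\<bar>\<xi>\<bar> \<le> 1"
    using pos_range[of "N - 1 - j"] N_pos W_pos K'_pos by (simp add: \<xi>_def divide_le_eq)
  then have "squaring (cis (angle j)) = Complex \<xi> 1"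
    using True squaring_cis_top by (simp add: angle_def \<xi>_def)
  then show ?thesis
    using True assms W_pos by (simp add: perimeter_nth disc_map_def disc_point_def vert_def \<xi>_def)
next
  case False
  define \<xi> where "\<xi> = (pos (j - N) + K' - 2 * W) / (2 * W)"
  have "j - N < N" using assms False by linarith
  then have "\<bar>\<xi>\<bar> \<le> 1"
    using pos_range[of "j - N"] W_pos K'_pos by (simp add: \<xi>_def abs_le_iff divide_le_eq le_divide_eq)
  then have "squaring (cis (angle j)) = Complex \<xi> (-1)"
    using False squaring_cis_bottom by (simp add: angle_def \<xi>_def)
  then show ?thesis
    using False assms W_pos by (simp add: perimeter_nth disc_map_def disc_point_def diag_def \<xi>_def)
qed

text \<open>Height \<open>- 2 * W\<close> separates drawing and disc: the edges stay strictly above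
  it except at their ends, and the open disc is strictly below it.\<close>

lemma drawing_low:
  assumes "p \<in> drawing outer.gr gloc outer.\<gamma>"
  shows "- 2 * W \<le> Im (fst p)" "Im (fst p) = - 2 * W \<Longrightarrow> p \<in> gloc ` rim"
proof -
  have "- 2 * W \<le> Im (fst p) \<and> (Im (fst p) = - 2 * W \<longrightarrow> p \<in> gloc ` rim)"
  proof (cases "p \<in> gloc ` rim")
    case True
    then show ?thesis by (auto simp: rim_def vert_def diag_def)
  next
    case False
    then obtain n t where nt: "n < N" "0 \<le> t" "t \<le> 1" "p = edge_path n t"
      using assms by (auto simp: outer.drawing_eq)
    then have "t \<noteq> 0" "t \<noteq> 1"
      using False outer.arc_ends outer.ends by (metis imageI lessThan_iff)+
    then have "- 2 * W < Im (fst p)"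
      using edge_path_range[OF nt(1-3)] nt by (auto simp: vert_def diag_def)
    then show ?thesis by simp
  qed
  then show "- 2 * W \<le> Im (fst p)" "Im (fst p) = - 2 * W \<Longrightarrow> p \<in> gloc ` rim" by auto
qed

lemma disc_for_perimeter: "disc_for_vortex outer.gr gloc outer.\<gamma> perimeter disc_map"
  unfolding disc_for_vortex_def
proof (intro conjI)
  have im: "Im (fst (disc_map z)) \<le> - 3 * W + W * norm z" for z
  proof -
    have "W * \<bar>Im (squaring z)\<bar> \<le> W * norm z"
      using W_pos abs_Im_le_sqn[of "squaring z"] by (intro mult_left_mono) (simp_all add: sqn_squaring)
    then show ?thesis by (auto simp: disc_map_def disc_point_def)
  qed
  show "disc_map ` ball 0 1 \<inter> drawing outer.gr gloc outer.\<gamma> = {}"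
  proof -
    have "Im (fst (disc_map z)) < - 2 * W" if "z \<in> ball 0 1" for z
    proof -
      have "W * norm z < W" using that W_pos by simp
      then show ?thesis using im[of z] by linarith
    qed
    then show ?thesis using drawing_low(1) by fastforce
  qed
  show "disc_map ` sphere 0 1 \<inter> drawing outer.gr gloc outer.\<gamma> \<subseteq> gloc ` verts outer.gr"
  proof
    fix p assume p: "p \<in> disc_map ` sphere 0 1 \<inter> drawing outer.gr gloc outer.\<gamma>"
    then obtain z where "norm z = 1" "p = disc_map z" by auto
    then have "Im (fst p) \<le> - 2 * W" using im[of z] by simp
    then show "p \<in> gloc ` verts outer.gr"
      using drawing_low[of p] p by (simp add: arc_graph_def)
  qed
  have "gloc ` set perimeter \<subseteq> disc_map ` sphere 0 1"
  proof
    fix p assume "p \<in> gloc ` set perimeter"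
    then obtain j where "j < 2 * N" "p = gloc (perimeter ! j)"
      by (auto simp: in_set_conv_nth length_perimeter)
    then show "p \<in> disc_map ` sphere 0 1" using gloc_angle by auto
  qed
  then show "disc_map ` sphere 0 1 \<inter> gloc ` verts outer.gr = gloc ` set perimeter"
    by (auto simp: arc_graph_def set_perimeter)
  show "\<exists>\<theta>. strict_mono_on {..<length perimeter} \<theta> \<and>
    (\<forall>j<length perimeter. 0 \<le> \<theta> j \<and> \<theta> j < 2 * pi \<and> gloc (perimeter ! j) = disc_map (cis (\<theta> j)))"
  proof (intro exI[of _ angle] conjI allI impI)
    fix j assume "j < length perimeter"
    then show "0 \<le> angle j" "angle j < 2 * pi" "gloc (perimeter ! j) = disc_map (cis (angle j))"
      using angle_ranges[of j] gloc_angle[of j] pi_gt_zero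
      by (cases "j < N"; simp add: length_perimeter; linarith)+
  qed (use strict_mono_angle in \<open>simp add: length_perimeter\<close>)
qed

end

section \<open>The vortex and its decomposition\<close>

lemma div_eq_interval:
  fixes c :: nat
  assumes "0 < c"
  shows "{n. n div c = g} = {g * c..<Suc g * c}"
proof (intro equalityI subsetI)
  fix n assume "n \<in> {n. n div c = g}"
  then show "n \<in> {g * c..<Suc g * c}"
    using div_times_less_eq_dividend[of n c] dividend_less_div_times[OF assms, of n] by auto
next
  fix n assume "n \<in> {g * c..<Suc g * c}"
  then show "n \<in> {n. n div c = g}"
    using div_nat_eqI[of c g n] by (simp add: mult.commute)
qed

lemma cyclically_consecutive_slice:
  assumes "S = (\<lambda>j. \<Omega> ! (i + j)) ` {..<l}" "i + l \<le> length \<Omega>"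
  shows "cyclically_consecutive \<Omega> S"
  unfolding cyclically_consecutive_def assms(1)
  using assms(2) by (intro exI[of _ i] exI[of _ l] image_cong) auto

context ribbons
begin

text \<open>\<open>\<beta>\<close> keeps remainders and transposes the hole \<open>(i, j)\<close>.
  So \<open>A n\<close> belongs to group \<open>i\<close>, whereas its partner
  \<open>B (\<beta> n)\<close> belongs to group \<open>j\<close>.\<close>

definition track_A :: "nat \<Rightarrow> nat" where "track_A n = n div K div m * k + n mod K div k"
definition track_B :: "nat \<Rightarrow> nat" where "track_B n = n div K div m * k + n mod K mod k"

text \<open>A track is a single vertex \<open>TA x\<close> or \<open>TB x\<close>, adjacent to the
  rim vertices that it serves and contained in all bags of its group.\<close>

definition hub :: "gvertex graph" where
  "hub = \<lparr>verts = rim \<union> TA ` {..<m * k} \<union> TB ` {..<m * k},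
     edges = (\<lambda>n. {A n, TA (track_A n)}) ` {..<N} \<union> (\<lambda>n. {B n, TB (track_B n)}) ` {..<N}\<rparr>"

fun bag :: "gvertex \<Rightarrow> gvertex set" where
  "bag (A n) = insert (A n) (TA ` {x. x div k = n div K div m})"
| "bag (B n) = insert (B n) (TB ` {x. x div k = n div K div m})"
| "bag _ = {}"

lemma mod_K_div: "n mod K div k < k" "n mod K mod k < k"
  using K_pos k_pos by (simp_all add: K_def less_mult_imp_div_less)

lemma group_less: "n < N \<Longrightarrow> n div K div m < m"
  using div_K[of n] by (simp add: less_mult_imp_div_less)

lemma track_less: "n < N \<Longrightarrow> track_A n < m * k" "n < N \<Longrightarrow> track_B n < m * k"
proof -
  have *: "g * k + t < m * k" if "g < m" "t < k" for g t
  proof -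
    have "g * k + t < Suc g * k" using that by simp
    also have "\<dots> \<le> m * k" using that(1) by (intro mult_le_mono1) simp
    finally show ?thesis .
  qed
  show "n < N \<Longrightarrow> track_A n < m * k" "n < N \<Longrightarrow> track_B n < m * k"
    unfolding track_A_def track_B_def using * group_less mod_K_div by blast+
qed

lemma track_div: "track_A n div k = n div K div m" "track_B n div k = n div K div m"
  using k_pos mod_K_div[of n] by (simp_all add: track_A_def track_B_def)

lemma consecutive_A:
  assumes "a \<le> b" "b \<le> N"
  shows "cyclically_consecutive perimeter (A ` {a..<b})"
proof (rule cyclically_consecutive_slice)
  have "{a..<b} = (\<lambda>j. b - 1 - j) ` {..<b - a}"
  proof (intro equalityI subsetI)
    fix x assume "x \<in> {a..<b}"
    then show "x \<in> (\<lambda>j. b - 1 - j) ` {..<b - a}"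
      by (intro image_eqI[of _ _ "b - 1 - x"]) auto
  qed auto
  then show "A ` {a..<b} = (\<lambda>j. perimeter ! (N - b + j)) ` {..<b - a}"
    using assms by (auto simp: perimeter_nth image_image intro!: image_cong)
  show "N - b + (b - a) \<le> length perimeter" using assms by (simp add: length_perimeter)
qed

lemma consecutive_B:
  assumes "a \<le> b" "b \<le> N"
  shows "cyclically_consecutive perimeter (B ` {a..<b})"
proof (rule cyclically_consecutive_slice)
  have "{a..<b} = (+) a ` {..<b - a}"
    using assms(1) image_add_atLeastLessThan[of a 0 "b - a"] by (simp add: lessThan_atLeast0)
  then show "B ` {a..<b} = (\<lambda>j. perimeter ! (N + a + j)) ` {..<b - a}"
    using assms by (auto simp: perimeter_nth image_image intro!: image_cong)
  show "N + a + (b - a) \<le> length perimeter" using assms by (simp add: length_perimeter)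
qed

text \<open>The group depends on \<open>n\<close> divided by \<open>K * m\<close> only, so its
  members are consecutive on the rim.\<close>

lemma group_interval:
  "{n. n div K div m = g} = {g * (K * m)..<Suc g * (K * m)}"
proof -
  have "0 < K * m" using K_pos m_pos by simp
  from div_eq_interval[OF this, of g] show ?thesis by (simp add: div_mult2_eq)
qed

lemma circular_decomposition_hub: "circular_decomposition hub perimeter bag"
  unfolding circular_decomposition_def
proof (intro conjI ballI)
  fix w assume "w \<in> set perimeter"
  then obtain n where n: "n < N" "w = A n \<or> w = B n"
    by (auto simp: set_perimeter rim_def)
  have "x < m * k" if "x div k = n div K div m" for x
    using that group_less[OF n(1)] k_pos by (simp add: div_less_iff_less_mult[symmetric])
  then show "w \<in> bag w" "bag w \<subseteq> verts hub"
    using n by (auto simp: hub_def rim_def)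
next
  fix u assume u: "u \<in> verts hub"
  have first: "Suc g * (K * m) \<le> N" "{n. n < N \<and> n div K div m = g} = {g * (K * m)..<Suc g * (K * m)}"
    if "g < m" for g
  proof -
    have "Suc g * (K * m) \<le> m * (K * m)" using that by (intro mult_le_mono1) simp
    then show N: "Suc g * (K * m) \<le> N" by (simp add: N_def mult_ac)
    show "{n. n < N \<and> n div K div m = g} = {g * (K * m)..<Suc g * (K * m)}"
      using group_interval[of g] N by (auto simp del: mult_Suc)
  qed
  consider n where "n < N" "u = A n" | n where "n < N" "u = B n"
    | x where "x < m * k" "u = TA x" | x where "x < m * k" "u = TB x"
    using u by (auto simp: hub_def rim_def)
  then have "(\<exists>w\<in>set perimeter. u \<in> bag w) \<and> cyclically_consecutive perimeter {w \<in> set perimeter. u \<in> bag w}"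
  proof cases
    case (1 n)
    then have "{w \<in> set perimeter. u \<in> bag w} = A ` {n..<Suc n}"
      by (auto simp: set_perimeter rim_def)
    then show ?thesis using consecutive_A[of n "Suc n"] 1 by (auto simp: set_perimeter rim_def)
  next
    case (2 n)
    then have "{w \<in> set perimeter. u \<in> bag w} = B ` {n..<Suc n}"
      by (auto simp: set_perimeter rim_def)
    then show ?thesis using consecutive_B[of n "Suc n"] 2 by (auto simp: set_perimeter rim_def)
  next
    case (3 x)
    define g where "g = x div k"
    have g: "g < m" using 3 by (simp add: g_def less_mult_imp_div_less)
    have "{w \<in> set perimeter. u \<in> bag w} = A ` {n. n < N \<and> n div K div m = g}"
      using 3 by (auto simp: set_perimeter rim_def g_def)
    then have "{w \<in> set perimeter. u \<in> bag w} = A ` {g * (K * m)..<Suc g * (K * m)}"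
      unfolding first(2)[OF g] .
    moreover have "A (g * (K * m)) \<in> A ` {g * (K * m)..<Suc g * (K * m)}"
      using K_pos m_pos by simp
    ultimately show ?thesis using consecutive_A[OF _ first(1)[OF g]] by auto
  next
    case (4 x)
    define g where "g = x div k"
    have g: "g < m" using 4 by (simp add: g_def less_mult_imp_div_less)
    have "{w \<in> set perimeter. u \<in> bag w} = B ` {n. n < N \<and> n div K div m = g}"
      using 4 by (auto simp: set_perimeter rim_def g_def)
    then have "{w \<in> set perimeter. u \<in> bag w} = B ` {g * (K * m)..<Suc g * (K * m)}"
      unfolding first(2)[OF g] .
    moreover have "B (g * (K * m)) \<in> B ` {g * (K * m)..<Suc g * (K * m)}"
      using K_pos m_pos by simp
    ultimately show ?thesis using consecutive_B[OF _ first(1)[OF g]] by auto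
  qed
  then show "\<exists>w\<in>set perimeter. u \<in> bag w" "cyclically_consecutive perimeter {w \<in> set perimeter. u \<in> bag w}"
    by blast+
next
  fix e assume "e \<in> edges hub"
  then obtain n where "n < N" "e = {A n, TA (track_A n)} \<or> e = {B n, TB (track_B n)}"
    by (auto simp: hub_def)
  then show "\<exists>w\<in>set perimeter. e \<subseteq> bag w"
    using track_div[of n] by (auto simp: set_perimeter rim_def intro: bexI[of _ "A n"] bexI[of _ "B n"])
qed

lemma card_bag: "w \<in> set perimeter \<Longrightarrow> card (bag w) \<le> Suc k"
proof -
  have "card {x. x div k = g} = k" for g using k_pos by (simp add: div_eq_interval)
  moreover have "finite {x. x div k = g}" for g using k_pos by (simp add: div_eq_interval)
  moreover have "card (TA ` S) = card S" "card (TB ` S) = card S" for S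
    by (auto intro!: card_image inj_onI)
  ultimately show "w \<in> set perimeter \<Longrightarrow> card (bag w) \<le> Suc k"
    by (auto simp: set_perimeter rim_def card_insert_if)
qed

lemma is_vortex_hub: "is_vortex hub perimeter"
proof -
  have "distinct perimeter"
    by (auto simp: perimeter_def distinct_map inj_on_def)
  moreover have "simple_graph hub"
    using track_less by (auto simp: simple_graph_def hub_def rim_def)
  moreover have "perimeter \<noteq> []" using N_pos length_perimeter by auto
  ultimately show ?thesis
    by (auto simp: is_vortex_def set_perimeter hub_def)
qed

section \<open>The complete minor of the ribbon graph\<close>

definition ribbon_graph :: "gvertex graph" where
  "ribbon_graph = \<lparr>verts = verts outer.gr \<union> verts hub, edges = edges outer.gr \<union> edges hub\<rparr>"

lemma almost_embeddable_ribbon_graph: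
  assumes "2 * (m * m) \<le> g" "1 \<le> p"
  shows "map_graph (to_nat :: gvertex \<Rightarrow> nat) ribbon_graph \<in> almost_embeddable g p k"
  by (rule almost_embeddableI[OF _ surface_surf euler_genus_surf assms(1) outer.embedded assms(2),
        of to_nat "\<lambda>_. hub" "\<lambda>_. perimeter" "\<lambda>_. bag" k "\<lambda>_. disc_map"])
    (use is_vortex_hub circular_decomposition_hub card_bag closed_disc_map disc_for_perimeter in
      \<open>auto simp: ribbon_graph_def set_perimeter hub_def arc_graph_def rim_def\<close>)

lemma simple_ribbon_graph: "simple_graph ribbon_graph"
  using is_vortex_hub outer.simple_gr by (auto simp: simple_graph_def ribbon_graph_def is_vortex_def)

text \<open>Two stars around track vertices. An edge through the hole \<open>(i, i)\<close> that
  carries the same track on both sides joins them.\<close>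

definition branch :: "nat \<Rightarrow> gvertex set" where
  "branch u = (insert (TA u) (A ` {n. n < N \<and> track_A n = u})) \<union>
     (insert (TB u) (B ` {n. n < N \<and> track_B n = u}))"

lemma ribbon_index:
  assumes "i < m" "i' < m" "t < k" "t' < k"
  obtains n where "n < N" "track_A n = i * k + t" "\<beta> n < N" "track_B (\<beta> n) = i' * k + t'"
    "{A n, B (\<beta> n)} \<in> edges ribbon_graph"
proof -
  have less: "a * c + b < d * c" if "a < d" "b < c" for a b c d :: nat
  proof -
    have "a * c + b < Suc a * c" using that by simp
    also have "\<dots> \<le> d * c" using that(1) by (intro mult_le_mono1) simp
    finally show ?thesis .
  qed
  define q where "q = t * k + t'"
  have q: "q < K" "q div k = t" "q mod k = t'"
    using less[OF assms(3,4)] assms k_pos by (simp_all add: q_def K_def)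
  define n where "n = (i * m + i') * K + q"
  have n: "n div K = i * m + i'" "n mod K = q" using q(1) by (simp_all add: n_def)
  have "n < N" using less[OF less[OF assms(1,2)] q(1)] by (simp add: n_def N_def)
  moreover have "track_A n = i * k + t" using n q assms by (simp add: track_A_def)
  moreover have "\<beta> n < N" using \<beta>_less calculation(1) by blast
  moreover have "track_B (\<beta> n) = i' * k + t'"
    using n q assms by (simp add: track_B_def \<beta>_div_mod trp_def)
  moreover have "{A n, B (\<beta> n)} \<in> edges ribbon_graph"
    using \<open>n < N\<close> by (auto simp: ribbon_graph_def arc_graph_def)
  ultimately show thesis using that by blast
qed

lemma is_minor_ribbon_graph: "is_minor (complete_graph (k * m)) ribbon_graph"
  unfolding is_minor_def
proof (intro exI[of _ branch] conjI ballI allI impI)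
  have link: "\<exists>n. n < N \<and> track_A n = u \<and> \<beta> n < N \<and> track_B (\<beta> n) = v \<and> {A n, B (\<beta> n)} \<in> edges ribbon_graph"
    if "u < k * m" "v < k * m" for u v
  proof -
    have "u div k < m" "v div k < m" "u mod k < k" "v mod k < k"
      using that k_pos by (simp_all add: less_mult_imp_div_less mult.commute)
    then show ?thesis
      using ribbon_index[of "u div k" "v div k" "u mod k" "v mod k"] by (metis div_mult_mod_eq)
  qed
  {
    fix u assume "u \<in> verts (complete_graph (k * m))"
    then have u: "u < k * m" by (simp add: complete_graph_def)
    have V: "TA u \<in> verts ribbon_graph" "TB u \<in> verts ribbon_graph"
      "\<And>n. n < N \<Longrightarrow> A n \<in> verts ribbon_graph" "\<And>n. n < N \<Longrightarrow> B n \<in> verts ribbon_graph"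
      using u by (auto simp: ribbon_graph_def hub_def rim_def mult.commute)
    have A: "connected_in ribbon_graph ({TA u} \<union> (\<Union>n\<in>{n. n < N \<and> track_A n = u}. {A n}))"
      by (rule connected_in_star)
        (use V in \<open>auto intro!: connected_in_singleton simp: ribbon_graph_def hub_def insert_commute\<close>)
    have B: "connected_in ribbon_graph ({TB u} \<union> (\<Union>n\<in>{n. n < N \<and> track_B n = u}. {B n}))"
      by (rule connected_in_star)
        (use V in \<open>auto intro!: connected_in_singleton simp: ribbon_graph_def hub_def insert_commute\<close>)
    obtain n where n: "n < N" "track_A n = u" "\<beta> n < N" "track_B (\<beta> n) = u"
      "{A n, B (\<beta> n)} \<in> edges ribbon_graph"
      using link[OF u u] by blast
    have "connected_in ribbon_graph (({TA u} \<union> (\<Union>n\<in>{n. n < N \<and> track_A n = u}. {A n})) \<union>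
        ({TB u} \<union> (\<Union>n\<in>{n. n < N \<and> track_B n = u}. {B n})))"
      by (rule connected_in_Un[OF A B _ _ n(5)]) (use n in auto)
    moreover have "({TA u} \<union> (\<Union>n\<in>{n. n < N \<and> track_A n = u}. {A n})) \<union>
        ({TB u} \<union> (\<Union>n\<in>{n. n < N \<and> track_B n = u}. {B n})) = branch u"
      by (auto simp: branch_def)
    ultimately show "connected_in ribbon_graph (branch u)" by simp
  }
  show "branch u \<inter> branch v = {}" if "u \<noteq> v" for u v
    using that by (auto simp: branch_def)
  fix u v assume "{u, v} \<in> edges (complete_graph (k * m))"
  then have "u < k * m" "v < k * m" by (auto simp: complete_graph_def doubleton_eq_iff)
  then obtain n where "n < N" "track_A n = u" "\<beta> n < N" "track_B (\<beta> n) = v"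
    "{A n, B (\<beta> n)} \<in> edges ribbon_graph"
    using link by blast
  then show "\<exists>x\<in>branch u. \<exists>y\<in>branch v. {x, y} \<in> edges ribbon_graph"
    by (auto simp: branch_def)
qed

end

theorem complete_minor_one_vortex:
  assumes "0 < m" "0 < k" "1 \<le> p" "2 * m\<^sup>2 \<le> g"
  shows "\<exists>G :: nat graph. simple_graph G \<and> G \<in> almost_embeddable g p k \<and>
    is_minor (complete_graph (k * m)) G"
proof -
  interpret ribbons m k using assms by unfold_locales
  have inj: "inj (to_nat :: gvertex \<Rightarrow> nat)" by simp
  show ?thesis
    using almost_embeddable_ribbon_graph simple_graph_map_graph[OF inj simple_ribbon_graph]
      is_minor_map_graph[OF inj is_minor_ribbon_graph] assms(3,4)
    by (metis power2_eq_square)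
qed

section \<open>Many vortices on the sphere\<close>

datatype port = East nat | North nat | West nat | South nat

instance port :: countable by countable_datatype

locale crossings =
  fixes m k :: nat
  assumes m_pos: "0 < m" and k_pos: "0 < k"
begin

text \<open>The ports of a crossing, counterclockwise from the east. North and south ports with the same
  number lie on one vertical line, east and west ports on one horizontal line.\<close>

definition ports :: "port list" where
  "ports = map East [0..<k] @ map North [0..<k] @ rev (map West [0..<k]) @ rev (map South [0..<k])"

fun place :: "port \<Rightarrow> nat" where
  "place (East t) = t" | "place (North t) = k + t"
| "place (West t) = 3 * k - 1 - t" | "place (South t) = 4 * k - 1 - t"

lemma set_ports: "set ports = East ` {..<k} \<union> North ` {..<k} \<union> West ` {..<k} \<union> South ` {..<k}"
  by (auto simp: ports_def)

lemma length_ports: "length ports = 4 * k"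
  by (simp add: ports_def)

lemma distinct_ports: "distinct ports"
  by (auto simp: ports_def distinct_map inj_on_def)

lemma ports_nth:
  assumes "p < 4 * k"
  shows "ports ! p = (if p < k then East p else if p < 2 * k then North (p - k)
     else if p < 3 * k then West (3 * k - 1 - p) else South (4 * k - 1 - p))"
proof -
  consider "p < k" | "\<not> p < k" "p < 2 * k" | "\<not> p < 2 * k" "p < 3 * k" | "\<not> p < 3 * k" by linarith
  then show ?thesis
    using assms by cases (auto simp: ports_def nth_append rev_nth)
qed

lemma place: "x \<in> set ports \<Longrightarrow> place x < 4 * k" "x \<in> set ports \<Longrightarrow> ports ! place x = x"
  by (auto simp: set_ports ports_nth)

text \<open>Each line passes the crossing along a run of consecutive ports, which starts at
  \<open>run_start\<close>. The tracks with the higher numbers pass on one side and those with the lower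
  numbers on the other side, so that half of the tracks of either line meet at each corner.\<close>

fun run_start :: "port \<Rightarrow> nat" where
  "run_start (East t) = t" | "run_start (South t) = 4 * k - 1 - t"
| "run_start (West t) = (if k div 2 \<le> t then t else 3 * k - 1 - t)"
| "run_start (North t) = (if k div 2 \<le> t then k + t else 4 * k - 1 - t)"

fun run_length :: "port \<Rightarrow> nat" where
  "run_length (East t) = 1" | "run_length (South t) = 1"
| "run_length (West t) = (if k div 2 \<le> t then 3 * k - 2 * t else k + 2 * t + 2)"
| "run_length (North t) = (if k div 2 \<le> t then 3 * k - 2 * t else k + 2 * t + 2)"

text \<open>The last disjunct is for runs that continue beyond the end of the list of ports.\<close>

definition covers :: "port \<Rightarrow> nat \<Rightarrow> bool" where
  "covers x p \<longleftrightarrow> run_start x \<le> p \<and> p < run_start x + run_length x \<or> p + 4 * k < run_start x + run_length x"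

text \<open>\<open>North t\<close> and \<open>West t\<close> serve as the tracks themselves: each
  spreads over a long run of bags that reaches its partner \<open>South t\<close> or
  \<open>East t\<close>, which is in one bag only.\<close>

definition crossing :: "port graph" where
  "crossing = \<lparr>verts = set ports,
     edges = (\<lambda>t. {North t, South t}) ` {..<k} \<union> (\<lambda>t. {West t, East t}) ` {..<k} \<union>
       (\<lambda>(t, s). {North t, West s}) ` ({..<k} \<times> {..<k})\<rparr>"

definition bag :: "port \<Rightarrow> port set" where
  "bag w = {x \<in> set ports. covers x (place w)}"

lemma covers_iff:
  assumes "t < k" "p < 4 * k"
  shows "covers (East t) p \<longleftrightarrow> p = t"
    and "covers (South t) p \<longleftrightarrow> p + t + 1 = 4 * k"
    and "covers (West t) p \<longleftrightarrow> (if k div 2 \<le> t then t \<le> p \<and> p + t < 3 * k else 3 * k \<le> p + t + 1 \<or> p \<le> t)"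
    and "covers (North t) p \<longleftrightarrow> (if k div 2 \<le> t then k + t \<le> p \<and> p + t < 4 * k else 4 * k \<le> p + t + 1 \<or> p \<le> k + t)"
  using assms by (auto simp: covers_def)

lemma run_bounds: "x \<in> set ports \<Longrightarrow> run_start x < 4 * k" "x \<in> set ports \<Longrightarrow> run_start x + run_length x \<le> 8 * k"
  by (auto simp: set_ports)

lemma consecutive_run:
  assumes x: "x \<in> set ports"
  shows "cyclically_consecutive ports {w \<in> set ports. x \<in> bag w}"
proof -
  let ?n = "4 * k"
  have "{w \<in> set ports. x \<in> bag w} = (\<lambda>j. ports ! ((run_start x + j) mod length ports)) ` {..<run_length x}"
  proof (intro equalityI subsetI)
    fix w assume "w \<in> {w \<in> set ports. x \<in> bag w}"
    then have w: "w \<in> set ports" "covers x (place w)" by (auto simp: bag_def)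
    show "w \<in> (\<lambda>j. ports ! ((run_start x + j) mod length ports)) ` {..<run_length x}"
    proof (cases "run_start x \<le> place w \<and> place w < run_start x + run_length x")
      case True
      then show ?thesis
        using place[OF w(1)] by (intro image_eqI[of _ _ "place w - run_start x"]) (auto simp: length_ports)
    next
      case False
      then have "place w + ?n < run_start x + run_length x" using w(2) by (auto simp: covers_def)
      then show ?thesis
        using place[OF w(1)] run_bounds[OF x]
        by (intro image_eqI[of _ _ "place w + ?n - run_start x"]) (auto simp: length_ports)
    qed
  next
    fix w assume "w \<in> (\<lambda>j. ports ! ((run_start x + j) mod length ports)) ` {..<run_length x}"
    then obtain j where j: "j < run_length x" "w = ports ! ((run_start x + j) mod ?n)"
      by (auto simp: length_ports)
    have lt: "(run_start x + j) mod ?n < ?n" using k_pos by simp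
    then have w: "w \<in> set ports" using j(2) by (simp add: length_ports)
    have "ports ! place w = ports ! ((run_start x + j) mod ?n)" using place(2)[OF w] j(2) by simp
    then have p: "place w = (run_start x + j) mod ?n"
      using nth_eq_iff_index_eq[OF distinct_ports] place(1)[OF w] lt by (simp add: length_ports)
    have "covers x (place w)"
    proof (cases "run_start x + j < ?n")
      case True
      then show ?thesis using j p by (simp add: covers_def)
    next
      case False
      then have "(run_start x + j) mod ?n = run_start x + j - ?n"
        using run_bounds[OF x] j(1) by (simp add: mod_if)
      then show ?thesis using j p False by (simp add: covers_def)
    qed
    then show "w \<in> {w \<in> set ports. x \<in> bag w}" using w x by (simp add: bag_def)
  qed
  then show ?thesis unfolding cyclically_consecutive_def by blast
qed

lemma in_bag:
  "w \<in> set ports \<Longrightarrow> w \<in> bag w"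
  "t < k \<Longrightarrow> {North t, South t} \<subseteq> bag (South t)"
  "t < k \<Longrightarrow> {West t, East t} \<subseteq> bag (East t)"
  by (auto simp: bag_def set_ports covers_def)

lemma contact_bag:
  assumes "t < k" "s < k"
  shows "\<exists>w\<in>set ports. {North t, West s} \<subseteq> bag w"
proof -
  \<comment> \<open>The sides on which the two tracks pass single out the north-west, south-west,
    north-east and south-east corner, in this order; the witness is a port near that corner which
    both runs cover.\<close>
  consider "k div 2 \<le> t" "k div 2 \<le> s" | "k div 2 \<le> t" "s < k div 2" | "t < k div 2" "k div 2 \<le> s"
    | "t < k div 2" "s < k div 2" by linarith
  then show ?thesis
  proof cases
    case 1
    then show ?thesis using assms by (intro bexI[of _ "North (k - 1)"]) (auto simp: bag_def set_ports covers_def)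
  next
    case 2
    then show ?thesis using assms by (intro bexI[of _ "West s"]) (auto simp: bag_def set_ports covers_def)
  next
    case 3
    then show ?thesis using assms by (intro bexI[of _ "North t"]) (auto simp: bag_def set_ports covers_def)
  next
    case 4
    then show ?thesis using assms by (intro bexI[of _ "South t"]) (auto simp: bag_def set_ports covers_def)
  qed
qed

lemma circular_decomposition_crossing: "circular_decomposition crossing ports bag"
  unfolding circular_decomposition_def
proof (intro conjI ballI)
  fix e assume "e \<in> edges crossing"
  then consider t where "t < k" "e = {North t, South t}" | t where "t < k" "e = {West t, East t}"
    | t s where "t < k" "s < k" "e = {North t, West s}"
    by (auto simp: crossing_def)
  then show "\<exists>w\<in>set ports. e \<subseteq> bag w"
  proof cases
    case (1 t)
    then show ?thesis using in_bag(2)[of t] by (intro bexI[of _ "South t"]) (auto simp: set_ports)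
  next
    case (2 t)
    then show ?thesis using in_bag(3)[of t] by (intro bexI[of _ "East t"]) (auto simp: set_ports)
  next
    case (3 t s)
    then show ?thesis using contact_bag by simp
  qed
qed (use in_bag(1) consecutive_run in \<open>auto simp: crossing_def bag_def\<close>)

text \<open>At any place the passing tracks of one line all belong to its higher half or all to its
  lower half. That is at most \<open>k - k div 2\<close> tracks of either line, and twice this
  number is at most \<open>k + 1\<close>. In the east and south quarters the local port adds one,
  but there one of the lines is represented by its lower half, which has only \<open>k div 2\<close>
  tracks.\<close>

lemma card_bag:
  assumes "w \<in> set ports"
  shows "card (bag w) \<le> Suc k"
proof -
  define d where "d = k div 2"
  have d: "d + d \<le> k" "(k - d) + (k - d) \<le> Suc k" by (auto simp: d_def)
  define p where "p = place w"
  have p: "p < 4 * k" using place(1)[OF assms] by (simp add: p_def)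
  note iff = covers_iff[OF _ p, folded d_def]
  define Q R R' where "Q = {x \<in> East ` {..<k} \<union> South ` {..<k}. covers x p}"
    and "R = {t. t < k \<and> covers (West t) p}" and "R' = {t. t < k \<and> covers (North t) p}"
  have "bag w = Q \<union> West ` R \<union> North ` R'"
    by (auto simp: bag_def set_ports Q_def R_def R'_def p_def)
  then have "card (bag w) \<le> card (Q \<union> West ` R) + card (North ` R')"
    using card_Un_le by metis
  also have "\<dots> \<le> card Q + card (West ` R) + card (North ` R')"
    using card_Un_le by (intro add_mono) auto
  also have "\<dots> = card Q + card R + card R'"
    by (simp add: card_image inj_on_def)
  finally have le: "card (bag w) \<le> card Q + card R + card R'" .
  have fin: "card S \<le> d" if "S \<subseteq> {..<d}" for S using card_mono[OF _ that] by simp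
  have fin': "card S \<le> k - d" if "S \<subseteq> {d..<k} \<or> S \<subseteq> {..<d}" for S
    using that card_mono[of "{d..<k}" S] fin[of S] d(1) by auto
  have "R \<subseteq> {d..<k} \<or> R \<subseteq> {..<d}" and R: "3 * k \<le> p \<Longrightarrow> R \<subseteq> {..<d}"
    by (fastforce simp: R_def iff subset_iff split: if_splits)+
  moreover have "R' \<subseteq> {d..<k} \<or> R' \<subseteq> {..<d}" and R': "p < k \<Longrightarrow> R' \<subseteq> {..<d}"
    by (fastforce simp: R'_def iff subset_iff split: if_splits)+
  ultimately have "card R \<le> k - d" "card R' \<le> k - d" using fin' by auto
  moreover have "3 * k \<le> p \<Longrightarrow> card R \<le> d" "p < k \<Longrightarrow> card R' \<le> d" using R R' fin by auto
  moreover have "Q \<subseteq> {ports ! p}" and "k \<le> p \<Longrightarrow> p < 3 * k \<Longrightarrow> Q = {}"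
    using p by (auto simp: Q_def iff ports_nth)
  then have "card Q \<le> 1" "k \<le> p \<Longrightarrow> p < 3 * k \<Longrightarrow> card Q = 0"
    using card_mono[of "{ports ! p}" Q] by auto
  ultimately show ?thesis
    using le d by (cases "p < k"; cases "p < 3 * k") linarith+
qed

lemma is_vortex_crossing: "is_vortex crossing ports"
  using distinct_ports length_ports k_pos
  by (auto simp: is_vortex_def simple_graph_def crossing_def set_ports)

end

section \<open>Layout of the grid on the sphere\<close>

datatype link = Ver nat nat nat | Hor nat nat nat

context crossings
begin

text \<open>The double of a square without holes is the sphere; the whole grid is drawn in its upper
  sheet.\<close>

lemma sphere_holes: "square_holes 0 (3 * real m) 1 (\<lambda>_. 0)"
  by unfold_locales (use m_pos in auto)

sublocale square_holes 0 "3 * real m" 1 "\<lambda>_. 0" by (rule sphere_holes)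

lemma planar_iff: "z \<in> isheet \<longleftrightarrow> \<bar>Re z\<bar> < 3 * m \<and> \<bar>Im z\<bar> < 3 * m"
  by (simp add: isheet_def sqn_def)

text \<open>For \<open>t < k\<close> these angles lie strictly between 0 and \<open>pi / 4\<close>.
  Then every sine is smaller than every cosine, which keeps vertical and horizontal links from
  crossing.\<close>

definition \<delta> :: "nat \<Rightarrow> real" where "\<delta> t = pi / 4 * (real (Suc t) / real (Suc k))"
definition sn :: "nat \<Rightarrow> real" where "sn t = sin (\<delta> t)"
definition cs :: "nat \<Rightarrow> real" where "cs t = cos (\<delta> t)"

lemma \<delta>_range: "t < k \<Longrightarrow> 0 < \<delta> t" "t < k \<Longrightarrow> \<delta> t < pi / 4"
proof -
  have "0 < real (Suc t) / real (Suc k)" by simp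
  then show "0 < \<delta> t" unfolding \<delta>_def using pi_gt_zero by (intro mult_pos_pos) auto
  assume "t < k"
  then have "real (Suc t) / real (Suc k) < 1" by simp
  then have "pi / 4 * (real (Suc t) / real (Suc k)) < pi / 4 * 1"
    using pi_gt_zero by (intro mult_strict_left_mono) auto
  then show "\<delta> t < pi / 4" by (simp add: \<delta>_def)
qed

lemma \<delta>_less: "s < t \<Longrightarrow> \<delta> s < \<delta> t"
  by (simp add: \<delta>_def divide_strict_right_mono)

lemma sn_cs:
  assumes "t < k"
  shows "0 < sn t" "sn t < sqrt 2 / 2" "sqrt 2 / 2 < cs t" "cs t < 1" "(sn t)\<^sup>2 + (cs t)\<^sup>2 = 1"
proof -
  note d = \<delta>_range[OF assms]
  show "0 < sn t" unfolding sn_def using d by (intro sin_gt_zero) auto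
  show "sn t < sqrt 2 / 2"
    unfolding sn_def sin_45[symmetric] using d by (intro sin_monotone_2pi) auto
  show "sqrt 2 / 2 < cs t"
    unfolding cs_def cos_45[symmetric] using d by (intro cos_monotone_0_pi) auto
  have "cos (\<delta> t) < cos 0" using d by (intro cos_monotone_0_pi) auto
  then show "cs t < 1" by (simp add: cs_def)
  show "(sn t)\<^sup>2 + (cs t)\<^sup>2 = 1" by (simp add: sn_def cs_def)
qed

lemma sn_less: "s < t \<Longrightarrow> t < k \<Longrightarrow> sn s < sn t"
  unfolding sn_def using \<delta>_range[of s] \<delta>_range[of t] \<delta>_less[of s t]
  by (intro sin_monotone_2pi) auto

lemma sn_inj:
  assumes "s < k" "t < k"
  shows "sn s = sn t \<longleftrightarrow> s = t"
  using sn_less[of s t] sn_less[of t s] assms by (cases s t rule: linorder_cases) auto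

text \<open>South ports mirror the north ports and west ports the east ports; this is why
  \<open>ports\<close> lists them in reverse.\<close>

fun offset :: "port \<Rightarrow> complex" where
  "offset (East t) = Complex (cs t) (sn t)" | "offset (North t) = Complex (- sn t) (cs t)"
| "offset (West t) = Complex (- cs t) (sn t)" | "offset (South t) = Complex (- sn t) (- cs t)"

definition centre :: "nat \<Rightarrow> nat \<Rightarrow> complex" where
  "centre i j = Complex (3 * real i) (3 * real j)"

lemma norm_offset: "x \<in> set ports \<Longrightarrow> norm (offset x) = 1"
  using sn_cs(5) by (auto simp: set_ports cmod_def add.commute)

lemma offset_inj:
  assumes "x \<in> set ports" "y \<in> set ports" "offset x = offset y"
  shows "x = y"
proof -
  have s2: "0 < sqrt 2 / (2::real)" by simp
  have ne: "cs s \<noteq> - cs t" "cs s \<noteq> - sn t" "- sn s \<noteq> cs t" "- cs s \<noteq> cs t" "sn s \<noteq> cs t" "cs s \<noteq> sn t"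
    if "s < k" "t < k" for s t
    using sn_cs(1-3)[OF that(1)] sn_cs(1-3)[OF that(2)] s2 by linarith+
  have "cs t \<noteq> 0" if "t < k" for t using sn_cs(3)[OF that] s2 by linarith
  then show ?thesis
    by (cases x; cases y) (use assms ne in \<open>auto simp: set_ports sn_inj\<close>)
qed

definition pt :: "nat \<times> nat \<times> port \<Rightarrow> complex" where
  "pt v = (case v of (i, j, x) \<Rightarrow> centre i j + offset x)"

definition nodes :: "(nat \<times> nat \<times> port) set" where
  "nodes = {..<m} \<times> {..<m} \<times> set ports"

definition links :: "link set" where
  "links = (\<lambda>(i, j, t). Ver i j t) ` ({..<m} \<times> {..<m - 1} \<times> {..<k}) \<union>
     (\<lambda>(i, j, t). Hor i j t) ` ({..<m - 1} \<times> {..<m} \<times> {..<k})"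

fun lsrc :: "link \<Rightarrow> nat \<times> nat \<times> port" where
  "lsrc (Ver i j t) = (i, j, North t)" | "lsrc (Hor i j t) = (i, j, East t)"

fun ltgt :: "link \<Rightarrow> nat \<times> nat \<times> port" where
  "ltgt (Ver i j t) = (i, Suc j, South t)" | "ltgt (Hor i j t) = (Suc i, j, West t)"

definition lline :: "link \<Rightarrow> real \<Rightarrow> complex" where
  "lline e = linepath (pt (lsrc e)) (pt (ltgt e))"

lemma link_ends: "e \<in> links \<Longrightarrow> lsrc e \<in> nodes" "e \<in> links \<Longrightarrow> ltgt e \<in> nodes"
  by (auto simp: links_def nodes_def set_ports)

lemma link_cases:
  assumes "e \<in> links"
  obtains (Ver) i j t where "e = Ver i j t" "i < m" "Suc j < m" "t < k"
    | (Hor) i j t where "e = Hor i j t" "Suc i < m" "j < m" "t < k"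
  using assms by (auto simp: links_def)

lemma open_interval_affine:
  fixes a b t :: real
  assumes "a < b" "0 < t" "t < 1"
  shows "a < a + t * (b - a)" "a + t * (b - a) < b"
proof -
  have "0 < t * (b - a)" "t * (b - a) < b - a"
    using assms mult_strict_right_mono[of t 1 "b - a"] by simp_all
  then show "a < a + t * (b - a)" "a + t * (b - a) < b" by linarith+
qed

lemma Ver_line:
  assumes "t < k" "0 < u" "u < 1"
  shows "Re (lline (Ver i j t) u) = 3 * real i - sn t"
    "3 * real j + cs t < Im (lline (Ver i j t) u)" "Im (lline (Ver i j t) u) < 3 * real j + 3 - cs t"
proof -
  have c: "cs t < 1" by (rule sn_cs(4)[OF assms(1)])
  show "Re (lline (Ver i j t) u) = 3 * real i - sn t"
    by (simp add: lline_def linepath_coords pt_def centre_def)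
  have "Im (lline (Ver i j t) u) = (3 * real j + cs t) + u * ((3 * real j + 3 - cs t) - (3 * real j + cs t))"
    by (simp add: lline_def linepath_coords pt_def centre_def)
  then show "3 * real j + cs t < Im (lline (Ver i j t) u)" "Im (lline (Ver i j t) u) < 3 * real j + 3 - cs t"
    using open_interval_affine[of "3 * real j + cs t" "3 * real j + 3 - cs t" u] c assms(2,3) by simp_all
qed

lemma Hor_line:
  assumes "t < k" "0 < u" "u < 1"
  shows "Im (lline (Hor i j t) u) = 3 * real j + sn t"
    "3 * real i + cs t < Re (lline (Hor i j t) u)" "Re (lline (Hor i j t) u) < 3 * real i + 3 - cs t"
proof -
  have c: "cs t < 1" by (rule sn_cs(4)[OF assms(1)])
  show "Im (lline (Hor i j t) u) = 3 * real j + sn t"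
    by (simp add: lline_def linepath_coords pt_def centre_def)
  have "Re (lline (Hor i j t) u) = (3 * real i + cs t) + u * ((3 * real i + 3 - cs t) - (3 * real i + cs t))"
    by (simp add: lline_def linepath_coords pt_def centre_def)
  then show "3 * real i + cs t < Re (lline (Hor i j t) u)" "Re (lline (Hor i j t) u) < 3 * real i + 3 - cs t"
    using open_interval_affine[of "3 * real i + cs t" "3 * real i + 3 - cs t" u] c assms(2,3) by simp_all
qed

lemma grid_close:
  fixes i i' :: nat
  assumes "\<bar>3 * real i - 3 * real i'\<bar> < 3"
  shows "i = i'"
  using assms by linarith

lemma grid_close1:
  fixes i i' :: nat and y :: real
  assumes "3 * real i < y" "y < 3 * real i + 3" "\<bar>y - 3 * real i'\<bar> \<le> 1"
  shows "i' = i \<or> i' = Suc i"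
  using assms by linarith

text \<open>A vertical link within distance 1 of a centre would belong to one of the two nodes at
  its ends. Its horizontal distance from that centre is \<open>sn t\<close> and its vertical
  distance exceeds \<open>cs t\<close>, but the squares of \<open>sn t\<close> and
  \<open>cs t\<close> already add up to 1. Horizontal links are symmetric.\<close>

lemma line_avoids_disc:
  assumes "e \<in> links" "0 < u" "u < 1"
  shows "1 < norm (lline e u - centre i' j')"
proof (rule ccontr)
  assume "\<not> ?thesis"
  then have le: "norm (lline e u - centre i' j') \<le> 1" by simp
  then have le': "\<bar>Re (lline e u) - 3 * real i'\<bar> \<le> 1" "\<bar>Im (lline e u) - 3 * real j'\<bar> \<le> 1"
    using abs_Re_le_cmod[of "lline e u - centre i' j'"] abs_Im_le_cmod[of "lline e u - centre i' j'"]
    by (auto simp: centre_def)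
  have sq: "(Re (lline e u) - 3 * real i')\<^sup>2 + (Im (lline e u) - 3 * real j')\<^sup>2 \<le> 1"
    using power_le_one[OF _ le, of 2] by (simp add: cmod_power2 centre_def)
  from assms(1) show False
  proof (cases rule: link_cases)
    case (Ver i j t)
    note l = Ver_line[OF Ver(4) assms(2,3), where i = i and j = j, folded Ver(1)] and s = sn_cs[OF Ver(4)]
    have s2: "0 < sqrt 2 / (2::real)" by simp
    then have c: "0 < cs t" using s(3) by linarith
    have "i = i'" by (rule grid_close) (use le'(1) l(1) s s2 in linarith)
    moreover have "j' = j \<or> j' = Suc j"
      by (rule grid_close1[OF _ _ le'(2)]) (use l(2,3) c in linarith)+
    then have "cs t < \<bar>Im (lline e u) - 3 * real j'\<bar>" using l by auto
    then have "(cs t)\<^sup>2 < (Im (lline e u) - 3 * real j')\<^sup>2"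
      using s s2 by (metis abs_le_square_iff abs_of_pos less_trans linorder_not_le)
    ultimately show False using sq l(1) s(5) by simp
  next
    case (Hor i j t)
    note l = Hor_line[OF Hor(4) assms(2,3), where i = i and j = j, folded Hor(1)] and s = sn_cs[OF Hor(4)]
    have s2: "0 < sqrt 2 / (2::real)" by simp
    then have c: "0 < cs t" using s(3) by linarith
    have "j = j'" by (rule grid_close) (use le'(2) l(1) s s2 in linarith)
    moreover have "i' = i \<or> i' = Suc i"
      by (rule grid_close1[OF _ _ le'(1)]) (use l(2,3) c in linarith)+
    then have "cs t < \<bar>Re (lline e u) - 3 * real i'\<bar>" using l by auto
    then have "(cs t)\<^sup>2 < (Re (lline e u) - 3 * real i')\<^sup>2"
      using s s2 by (metis abs_le_square_iff abs_of_pos less_trans linorder_not_le)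
    ultimately show False using sq l(1) s(5) by simp
  qed
qed

lemma discs_apart:
  assumes "norm z \<le> 1" "norm w \<le> 1" "centre i j + z = centre i' j' + w"
  shows "i = i'" "j = j'"
proof -
  have "3 * real i + Re z = 3 * real i' + Re w" "3 * real j + Im z = 3 * real j' + Im w"
    using assms(3) by (auto simp: centre_def complex_eq_iff)
  moreover have "\<bar>Re z\<bar> \<le> 1" "\<bar>Im z\<bar> \<le> 1" "\<bar>Re w\<bar> \<le> 1" "\<bar>Im w\<bar> \<le> 1"
    using assms(1,2) abs_Re_le_cmod abs_Im_le_cmod order_trans by blast+
  ultimately show "i = i'" "j = j'" by (intro grid_close; linarith)+
qed

lemma disc_isheet:
  assumes "i < m" "j < m" "norm z \<le> 1"
  shows "centre i j + z \<in> isheet"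
proof -
  have "\<bar>Re z\<bar> \<le> 1" "\<bar>Im z\<bar> \<le> 1"
    using assms(3) abs_Re_le_cmod abs_Im_le_cmod order_trans by blast+
  moreover have "real i + 1 \<le> m" "real j + 1 \<le> m" "0 \<le> real i" "0 \<le> real j"
    using assms(1,2) by linarith+
  ultimately have "\<bar>3 * real i + Re z\<bar> < 3 * real m" "\<bar>3 * real j + Im z\<bar> < 3 * real m"
    by linarith+
  then show ?thesis by (simp add: planar_iff centre_def)
qed

lemma pt_isheet: "v \<in> nodes \<Longrightarrow> pt v \<in> isheet"
  using disc_isheet norm_offset by (auto simp: nodes_def pt_def)

lemma convex_isheet: "convex isheet"
proof -
  have "isheet = box (Complex (- 3 * m) (- 3 * m)) (Complex (3 * m) (3 * m))"
    by (auto simp: planar_iff in_box_complex_iff abs_less_iff)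
  then show ?thesis by (simp add: convex_box)
qed

lemma lline_isheet:
  assumes "e \<in> links" "0 \<le> u" "u \<le> 1"
  shows "lline e u \<in> isheet"
proof -
  have "lline e u \<in> closed_segment (pt (lsrc e)) (pt (ltgt e))"
    unfolding lline_def linepath_image_01[symmetric] using assms(2,3) by auto
  then show ?thesis
    using closed_segment_subset[OF pt_isheet pt_isheet convex_isheet] link_ends[OF assms(1)] by blast
qed

lemma inj_pt: "inj_on pt nodes"
proof (rule inj_onI)
  fix v w assume vw: "v \<in> nodes" "w \<in> nodes" "pt v = pt w"
  obtain i j x i' j' y where eq: "v = (i, j, x)" "w = (i', j', y)" using prod_cases3 by metis
  then have "i = i'" "j = j'"
    using discs_apart[of "offset x" "offset y"] vw norm_offset by (auto simp: nodes_def pt_def)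
  then show "v = w" using vw eq offset_inj by (auto simp: nodes_def pt_def)
qed

lemma lines_disjoint:
  assumes "e \<in> links" "e' \<in> links" "e \<noteq> e'" "0 < u" "u < 1" "0 < u'" "u' < 1"
  shows "lline e u \<noteq> lline e' u'"
proof
  assume eq: "lline e u = lline e' u'"
  have s2: "0 < sqrt 2 / (2::real)" by simp
  \<comment> \<open>A horizontal link stays more than \<open>cs t'\<close> away from every vertical
    line through centres, while a vertical link is at distance \<open>sn t\<close> from one of these
    lines.\<close>
  have mixed: False if "a = Ver i j t" "b = Hor i' j' t'" "t < k" "t' < k" "0 < x" "x < 1" "0 < y" "y < 1"
    "lline a x = lline b y" for a b i j t i' j' t' x y
  proof -
    note l = Ver_line[OF that(3,5,6), where i = i and j = j] Hor_line[OF that(4,7,8), where i = i' and j = j'] and s = sn_cs[OF that(3)] sn_cs[OF that(4)]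
    have "3 * real i' + cs t' < 3 * real i - sn t" "3 * real i - sn t < 3 * real i' + 3 - cs t'"
      using l that by simp_all
    then have "real i' < real i" "real i < real i' + 1" using s s2 by linarith+
    moreover from this(1) have "real (Suc i') \<le> real i" by simp
    ultimately show False by simp
  qed
  from assms(1) show False
  proof (cases rule: link_cases)
    case V: (Ver i j t)
    note l = Ver_line[OF V(4) assms(4,5), where i = i and j = j, folded V(1)] and s = sn_cs[OF V(4)]
    from assms(2) show False
    proof (cases rule: link_cases)
      case V': (Ver i' j' t')
      note l' = Ver_line[OF V'(4) assms(6,7), where i = i' and j = j', folded V'(1)] and s' = sn_cs[OF V'(4)]
      have "i = i'" by (rule grid_close) (use eq l(1) l'(1) s s' s2 in auto)
      moreover have "j = j'" by (rule grid_close) (use eq l l' s s' s2 in auto)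
      moreover have "sn t = sn t'" using calculation(1) eq l(1) l'(1) by simp
      ultimately show False using V V' assms(3) sn_inj by simp
    next
      case H': (Hor i' j' t')
      then show False using mixed[OF V(1) H'(1) V(4) H'(4) assms(4-7) eq] by simp
    qed
  next
    case H: (Hor i j t)
    note l = Hor_line[OF H(4) assms(4,5), where i = i and j = j, folded H(1)] and s = sn_cs[OF H(4)]
    from assms(2) show False
    proof (cases rule: link_cases)
      case V': (Ver i' j' t')
      then show False using mixed[OF V'(1) H(1) V'(4) H(4) assms(6,7,4,5)] eq by simp
    next
      case H': (Hor i' j' t')
      note l' = Hor_line[OF H'(4) assms(6,7), where i = i' and j = j', folded H'(1)] and s' = sn_cs[OF H'(4)]
      have "j = j'" by (rule grid_close) (use eq l(1) l'(1) s s' s2 in auto)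
      moreover have "i = i'" by (rule grid_close) (use eq l l' s s' s2 in auto)
      moreover have "sn t = sn t'" using calculation(1) eq l(1) l'(1) by simp
      ultimately show False using H H' assms(3) sn_inj by simp
    qed
  qed
qed

lemma lsrc_neq_ltgt: "lsrc e \<noteq> ltgt e"
  by (cases e) auto

abbreviation nloc :: "nat \<times> nat \<times> port \<Rightarrow> complex \<times> complex" where
  "nloc \<equiv> \<lambda>v. up (pt v)"

lemma up_surf: "z \<in> isheet \<Longrightarrow> up z \<in> surf"
  using isheet_subset_sheet unfolding surf_def by blast

lemma arc_system_grid: "arc_system surf nodes links lsrc ltgt nloc (\<lambda>e u. up (lline e u))"
proof
  show "finite nodes" by (simp add: nodes_def)
  show "lsrc e \<in> nodes" "ltgt e \<in> nodes" "lsrc e \<noteq> ltgt e" if "e \<in> links" for e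
    using link_ends[OF that] lsrc_neq_ltgt by auto
  show "inj_on (\<lambda>e. {lsrc e, ltgt e}) links"
  proof (rule inj_onI)
    fix e e' assume "{lsrc e, ltgt e} = {lsrc e', ltgt e'}"
    then show "e = e'" by (cases e; cases e') (auto simp: doubleton_eq_iff)
  qed
  show "inj_on nloc nodes"
    using inj_pt by (simp add: inj_on_def)
  show "nloc ` nodes \<subseteq> surf"
    using pt_isheet up_surf by blast
  show "continuous_on {0..1} (\<lambda>u. up (lline e u))" for e
    unfolding lline_def by (intro continuous_intros)
  show "inj_on (\<lambda>u. up (lline e u)) {0..1}" if "e \<in> links" for e
  proof -
    have "pt (lsrc e) \<noteq> pt (ltgt e)"
      using inj_pt link_ends[OF that] lsrc_neq_ltgt by (metis inj_onD)
    then show ?thesis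
      using inj_on_linepath[of "pt (lsrc e)" "pt (ltgt e)"] by (simp add: inj_on_def lline_def)
  qed
  show "(\<lambda>u. up (lline e u)) ` {0..1} \<subseteq> surf" if "e \<in> links" for e
    using lline_isheet[OF that] up_surf by auto
  show "up (lline e 0) = up (pt (lsrc e))" "up (lline e 1) = up (pt (ltgt e))" for e
    by (simp_all add: lline_def linepath_0' linepath_1')
  show "up (lline e u) \<noteq> up (pt v)" if "e \<in> links" "0 < u" "u < 1" "v \<in> nodes" for e u v
  proof -
    obtain i j x where v: "v = (i, j, x)" using prod_cases3 by metis
    then have "norm (pt v - centre i j) = 1" using that(4) norm_offset by (simp add: nodes_def pt_def)
    then show ?thesis using line_avoids_disc[OF that(1-3), of i j] by auto
  qed
  show "up (lline e u) \<noteq> up (lline e' u')"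
    if "e \<in> links" "e' \<in> links" "e \<noteq> e'" "0 < u" "u < 1" "0 < u'" "u' < 1" for e e' u u'
    using lines_disjoint[OF that] by simp
qed

sublocale grid: arc_system surf nodes links lsrc ltgt nloc "\<lambda>e u. up (lline e u)"
  by (rule arc_system_grid)

abbreviation grid_drawing :: "(complex \<times> complex) set" where
  "grid_drawing \<equiv> drawing grid.gr nloc grid.\<gamma>"

definition node :: "nat \<Rightarrow> port \<Rightarrow> nat \<times> nat \<times> port" where
  "node q x = (q div m, q mod m, x)"

lemma inj_node: "inj (node q)"
  by (auto simp: inj_def node_def)

definition node_disc :: "nat \<Rightarrow> complex \<Rightarrow> complex \<times> complex" where
  "node_disc q z = up (centre (q div m) (q mod m) + z)"

lemma node_range: "q < m * m \<Longrightarrow> q div m < m" "q mod m < m"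
  using m_pos by (simp_all add: less_mult_imp_div_less)

lemma closed_node_disc:
  assumes "q < m * m"
  shows "closed_disc (top_of_set surf) (node_disc q)"
  unfolding closed_disc_def
proof (rule embedding_map_compact)
  show "node_disc q ` cball 0 1 \<subseteq> surf"
    using disc_isheet[OF node_range(1)[OF assms] node_range(2)] up_surf by (auto simp: node_disc_def)
qed (auto simp: node_disc_def inj_on_def intro!: continuous_intros)

lemma node_discs_disjoint:
  assumes "q < m * m" "q' < m * m" "q \<noteq> q'"
  shows "node_disc q ` cball 0 1 \<inter> node_disc q' ` cball 0 1 = {}"
proof (rule ccontr)
  assume "\<not> ?thesis"
  then obtain z w where "z \<in> cball 0 1" "w \<in> cball 0 1" "node_disc q z = node_disc q' w"
    by blast
  then have "q div m = q' div m" "q mod m = q' mod m"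
    using discs_apart[of z w "q div m" "q mod m" "q' div m" "q' mod m"] by (simp_all add: node_disc_def)
  then show False using assms(3) by (metis div_mult_mod_eq)
qed

text \<open>The interiors of links avoid the closed disc, and the ports of other nodes lie in other
  discs.\<close>

lemma drawing_in_disc:
  assumes p: "p \<in> grid_drawing" "p = node_disc q z" "norm z \<le> 1"
  obtains x where "x \<in> set ports" "p = up (pt (node q x))" "z = offset x"
proof -
  have "p \<in> nloc ` nodes"
  proof (rule ccontr)
    assume n: "p \<notin> nloc ` nodes"
    then obtain e u where e: "e \<in> links" "0 \<le> u" "u \<le> 1" "p = up (lline e u)"
      using p(1) by (auto simp: grid.drawing_eq)
    then have "u \<noteq> 0" "u \<noteq> 1"
      using n grid.arc_ends grid.ends by (metis imageI)+
    then have "1 < norm (lline e u - centre (q div m) (q mod m))"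
      using e by (intro line_avoids_disc) auto
    moreover have "lline e u = centre (q div m) (q mod m) + z"
      using e(4) p(2) by (simp add: node_disc_def)
    ultimately show False using p(3) by simp
  qed
  then obtain i j x where v: "x \<in> set ports" "p = up (centre i j + offset x)"
    by (auto simp: nodes_def pt_def)
  then have eq: "centre i j + offset x = centre (q div m) (q mod m) + z"
    using p(2) by (simp add: node_disc_def)
  have "i = q div m" "j = q mod m"
    using discs_apart[OF _ p(3) eq] norm_offset[OF v(1)] by auto
  then show thesis using that[OF v(1)] v(2) eq by (simp add: node_def pt_def)
qed

definition port_angle :: "nat \<Rightarrow> real" where
  "port_angle p = (if p < k then \<delta> p else if p < 2 * k then pi / 2 + \<delta> (p - k)
     else if p < 3 * k then pi - \<delta> (3 * k - 1 - p) else 3 * pi / 2 - \<delta> (4 * k - 1 - p))"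

lemma offset_cis: "p < 4 * k \<Longrightarrow> offset (ports ! p) = cis (port_angle p)"
proof -
  have eq: "3 * pi / 2 = pi + pi / 2" by simp
  have "cos (3 * pi / 2) = 0" "sin (3 * pi / 2) = - 1"
    unfolding eq by (simp_all only: cos_add sin_add) simp_all
  then show "p < 4 * k \<Longrightarrow> offset (ports ! p) = cis (port_angle p)"
    by (auto simp: ports_nth port_angle_def complex_eq_iff sn_def cs_def cos_add sin_add cos_diff sin_diff)
qed

lemma port_angle_bounds:
  "p < k \<Longrightarrow> 0 < port_angle p \<and> port_angle p < pi / 4"
  "k \<le> p \<Longrightarrow> p < 2 * k \<Longrightarrow> pi / 2 < port_angle p \<and> port_angle p < 3 * pi / 4"
  "2 * k \<le> p \<Longrightarrow> p < 3 * k \<Longrightarrow> 3 * pi / 4 < port_angle p \<and> port_angle p < pi"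
  "3 * k \<le> p \<Longrightarrow> p < 4 * k \<Longrightarrow> 5 * pi / 4 < port_angle p \<and> port_angle p < 3 * pi / 2"
proof -
  show "p < k \<Longrightarrow> 0 < port_angle p \<and> port_angle p < pi / 4"
    using \<delta>_range[of p] by (simp add: port_angle_def)
  show "pi / 2 < port_angle p \<and> port_angle p < 3 * pi / 4" if "k \<le> p" "p < 2 * k"
  proof -
    have "p - k < k" "port_angle p = pi / 2 + \<delta> (p - k)" using that by (auto simp: port_angle_def)
    then show ?thesis using \<delta>_range[of "p - k"] by simp
  qed
  show "3 * pi / 4 < port_angle p \<and> port_angle p < pi" if "2 * k \<le> p" "p < 3 * k"
  proof -
    have "3 * k - 1 - p < k" "port_angle p = pi - \<delta> (3 * k - 1 - p)" using that by (auto simp: port_angle_def)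
    then show ?thesis using \<delta>_range[of "3 * k - 1 - p"] by simp
  qed
  show "5 * pi / 4 < port_angle p \<and> port_angle p < 3 * pi / 2" if "3 * k \<le> p" "p < 4 * k"
  proof -
    have "4 * k - 1 - p < k" "port_angle p = 3 * pi / 2 - \<delta> (4 * k - 1 - p)"
      using that by (auto simp: port_angle_def)
    then show ?thesis using \<delta>_range[of "4 * k - 1 - p"] by simp
  qed
qed

lemma port_angle_range:
  assumes "p < 4 * k"
  shows "0 \<le> port_angle p" "port_angle p < 2 * pi"
proof -
  consider "p < k" | "k \<le> p" "p < 2 * k" | "2 * k \<le> p" "p < 3 * k" | "3 * k \<le> p" by linarith
  then have "0 \<le> port_angle p \<and> port_angle p < 2 * pi"
    using assms pi_gt_zero by cases (use port_angle_bounds[of p] in \<open>simp; linarith\<close>)+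
  then show "0 \<le> port_angle p" "port_angle p < 2 * pi" by auto
qed

lemma strict_mono_port_angle: "strict_mono_on {..<4 * k} port_angle"
proof (rule strict_mono_onI)
  fix p q assume pq: "p \<in> {..<4 * k}" "q \<in> {..<4 * k}" "p < q"
  have u1: "p < k \<Longrightarrow> port_angle p < pi / 2"
    using port_angle_bounds(1)[of p] pi_gt_zero by linarith
  then have u2: "p < 2 * k \<Longrightarrow> port_angle p < 3 * pi / 4"
    using port_angle_bounds(2)[of p] pi_gt_zero by (cases "p < k") linarith+
  then have u3: "p < 3 * k \<Longrightarrow> port_angle p < pi"
    using port_angle_bounds(3)[of p] pi_gt_zero by (cases "p < 2 * k") linarith+
  have l3: "3 * k \<le> q \<Longrightarrow> pi < port_angle q"
    using port_angle_bounds(4)[of q] pq pi_gt_zero by simp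
  then have l2: "2 * k \<le> q \<Longrightarrow> 3 * pi / 4 < port_angle q"
    using port_angle_bounds(3)[of q] pi_gt_zero by (cases "q < 3 * k") linarith+
  then have l1: "k \<le> q \<Longrightarrow> pi / 2 < port_angle q"
    using port_angle_bounds(2)[of q] pi_gt_zero by (cases "q < 2 * k") linarith+
  \<comment> \<open>The four quarters have disjoint ranges of angles; inside a quarter the
    monotonicity of \<open>\<delta>\<close> decides.\<close>
  consider "q < k" | "p < k" "k \<le> q" | "k \<le> p" "q < 2 * k" | "p < 2 * k" "2 * k \<le> q"
    | "2 * k \<le> p" "q < 3 * k" | "p < 3 * k" "3 * k \<le> q" | "3 * k \<le> p" by linarith
  then show "port_angle p < port_angle q"
  proof cases
    case 1
    then show ?thesis using pq \<delta>_less by (simp add: port_angle_def)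
  next
    case 2
    then show ?thesis using u1 l1 by simp
  next
    case 3
    then show ?thesis using pq \<delta>_less[of "p - k" "q - k"] by (simp add: port_angle_def)
  next
    case 4
    then show ?thesis using u2 l2 by simp
  next
    case 5
    then show ?thesis using pq \<delta>_less[of "3 * k - 1 - q" "3 * k - 1 - p"] by (simp add: port_angle_def)
  next
    case 6
    then show ?thesis using u3 l3 by simp
  next
    case 7
    then show ?thesis using pq \<delta>_less[of "4 * k - 1 - q" "4 * k - 1 - p"] by (simp add: port_angle_def)
  qed
qed

lemma disc_for_node:
  assumes q: "q < m * m"
  shows "disc_for_vortex grid.gr nloc grid.\<gamma> (map (node q) ports) (node_disc q)"
  unfolding disc_for_vortex_def
proof (intro conjI)
  have sub: "nloc ` nodes \<subseteq> grid_drawing"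
    by (auto simp: grid.drawing_eq)
  have vg: "verts grid.gr = nodes" by (simp add: arc_graph_def)
  have in_nodes: "node q x \<in> nodes" if "x \<in> set ports" for x
    using that node_range(1)[OF q] node_range(2)[of q] by (simp add: node_def nodes_def)
  have on_disc: "up (pt (node q x)) = node_disc q (offset x)" for x
    by (simp add: node_disc_def node_def pt_def)
  show "node_disc q ` ball 0 1 \<inter> grid_drawing = {}"
  proof (rule ccontr)
    assume "\<not> ?thesis"
    then obtain z where z: "norm z < 1" "node_disc q z \<in> grid_drawing" by auto
    then obtain x where "x \<in> set ports" "z = offset x"
      using drawing_in_disc[OF z(2) refl] by auto
    then show False using z(1) norm_offset by simp
  qed
  have *: "node_disc q ` sphere 0 1 \<inter> grid_drawing
    \<subseteq> nloc ` set (map (node q) ports)"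
  proof
    fix p assume p: "p \<in> node_disc q ` sphere 0 1 \<inter> grid_drawing"
    then obtain z where "norm z = 1" "p = node_disc q z" by auto
    then obtain x where "x \<in> set ports" "p = up (pt (node q x))"
      using drawing_in_disc[of p q z] p by auto
    then show "p \<in> nloc ` set (map (node q) ports)" by auto
  qed
  show "node_disc q ` sphere 0 1 \<inter> grid_drawing \<subseteq> nloc ` verts grid.gr"
    using * in_nodes unfolding vg by auto
  show "node_disc q ` sphere 0 1 \<inter> nloc ` verts grid.gr = nloc ` set (map (node q) ports)"
  proof
    show "node_disc q ` sphere 0 1 \<inter> nloc ` verts grid.gr \<subseteq> nloc ` set (map (node q) ports)"
      using * sub unfolding vg by blast
    show "nloc ` set (map (node q) ports) \<subseteq> node_disc q ` sphere 0 1 \<inter> nloc ` verts grid.gr"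
      using in_nodes norm_offset on_disc unfolding vg by auto
  qed
  show "\<exists>\<theta>. strict_mono_on {..<length (map (node q) ports)} \<theta> \<and>
    (\<forall>j<length (map (node q) ports). 0 \<le> \<theta> j \<and> \<theta> j < 2 * pi \<and>
      up (pt (map (node q) ports ! j)) = node_disc q (cis (\<theta> j)))"
  proof (intro exI[of _ port_angle] conjI allI impI)
    fix j assume "j < length (map (node q) ports)"
    then have j: "j < 4 * k" by (simp add: length_ports)
    show "0 \<le> port_angle j" "port_angle j < 2 * pi" using port_angle_range[OF j] by auto
    show "up (pt (map (node q) ports ! j)) = node_disc q (cis (port_angle j))"
      using j offset_cis[OF j] by (simp add: length_ports on_disc)
  qed (use strict_mono_port_angle in \<open>simp add: length_ports\<close>)
qed


section \<open>The complete minor of the grid graph\<close>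

abbreviation "node_vortex q \<equiv> map_graph (node q) crossing"

definition grid_graph :: "(nat \<times> nat \<times> port) graph" where
  "grid_graph = \<lparr>verts = verts grid.gr \<union> (\<Union>q<m * m. verts (node_vortex q)),
     edges = edges grid.gr \<union> (\<Union>q<m * m. edges (node_vortex q))\<rparr>"

lemma node_in_nodes: "q < m * m \<Longrightarrow> x \<in> set ports \<Longrightarrow> node q x \<in> nodes"
  using node_range by (simp add: node_def nodes_def)

lemma verts_node_vortex: "verts (node_vortex q) = node q ` set ports"
  by (simp add: map_graph_def crossing_def)

lemma verts_grid: "verts grid.gr = nodes"
  by (simp add: arc_graph_def)

lemma node_neq: "q \<noteq> q' \<Longrightarrow> node q x \<noteq> node q' y"
  by (metis node_def prod.inject div_mult_mod_eq)

lemma almost_embeddable_grid_graph: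
  assumes "m * m \<le> p"
  shows "map_graph (to_nat :: nat \<times> nat \<times> port \<Rightarrow> nat) grid_graph \<in> almost_embeddable g p k"
proof (rule almost_embeddableI[OF _ surface_surf euler_genus_surf _ grid.embedded assms])
  show "2 * 0 \<le> g" by simp
  show "inj (to_nat :: nat \<times> nat \<times> port \<Rightarrow> nat)" by simp
  fix q assume q: "q < m * m"
  show "is_vortex (node_vortex q) (map (node q) ports)"
    by (rule is_vortex_map_graph[OF inj_node is_vortex_crossing])
  have "ports \<noteq> []" using is_vortex_crossing by (simp add: is_vortex_def)
  then show "circular_decomposition (node_vortex q) (map (node q) ports) (\<lambda>w. node q ` bag (inv (node q) w))"
    by (rule circular_decomposition_map_graph[OF inj_node _ circular_decomposition_crossing])
  show "card (node q ` bag (inv (node q) w)) \<le> Suc k" if "w \<in> set (map (node q) ports)" for w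
  proof -
    obtain x where "x \<in> set ports" "w = node q x" using \<open>w \<in> _\<close> by auto
    then have "card (bag (inv (node q) w)) \<le> Suc k" using card_bag inj_node by simp
    moreover have "finite (bag (inv (node q) w))" by (simp add: bag_def)
    ultimately show ?thesis using card_image_le order_trans by blast
  qed
  show "verts (node_vortex q) \<inter> verts grid.gr = set (map (node q) ports)"
    using node_in_nodes[OF q] unfolding verts_node_vortex verts_grid by auto
  show "closed_disc (top_of_set surf) (node_disc q)" by (rule closed_node_disc[OF q])
  show "disc_for_vortex grid.gr nloc grid.\<gamma> (map (node q) ports) (node_disc q)"
    by (rule disc_for_node[OF q])
  fix q' assume "q' < m * m" "q \<noteq> q'"
  then show "verts (node_vortex q) \<inter> verts (node_vortex q') = {}"
    "node_disc q ` cball 0 1 \<inter> node_disc q' ` cball 0 1 = {}"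
    using node_neq node_discs_disjoint[OF q] unfolding verts_node_vortex by auto
qed (rule grid_graph_def)

lemma simple_grid_graph: "simple_graph grid_graph"
proof -
  have "simple_graph (node_vortex q)" for q
    using is_vortex_map_graph[OF inj_node is_vortex_crossing] by (simp add: is_vortex_def)
  then show ?thesis
    using grid.simple_gr unfolding simple_graph_def grid_graph_def by auto blast+
qed

lemma grid_graph_vertex: "i < m \<Longrightarrow> j < m \<Longrightarrow> x \<in> set ports \<Longrightarrow> (i, j, x) \<in> verts grid_graph"
  by (simp add: grid_graph_def verts_grid) (simp add: nodes_def)

lemma crossing_edge:
  assumes "i < m" "j < m" "{x, y} \<in> edges crossing"
  shows "{(i, j, x), (i, j, y)} \<in> edges grid_graph"
proof -
  have "i * m + j < m * m"
  proof -
    have "i * m + j < Suc i * m" using assms(2) by simp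
    also have "\<dots> \<le> m * m" using assms(1) by (intro mult_le_mono1) simp
    finally show ?thesis .
  qed
  moreover have "node (i * m + j) ` {x, y} \<in> edges (node_vortex (i * m + j))"
    using assms(3) by (simp only: map_graph_def graph.simps imageI)
  moreover have "node (i * m + j) ` {x, y} = {(i, j, x), (i, j, y)}"
    using assms(2) by (simp add: node_def)
  ultimately show ?thesis unfolding grid_graph_def by auto
qed

lemma link_edge: "e \<in> links \<Longrightarrow> {lsrc e, ltgt e} \<in> edges grid_graph"
  by (auto simp: grid_graph_def arc_graph_def)

definition column_part :: "nat \<Rightarrow> nat \<Rightarrow> nat \<Rightarrow> (nat \<times> nat \<times> port) set" where
  "column_part i t j = {(i, j, North t), (i, j, South t)}"

definition row_part :: "nat \<Rightarrow> nat \<Rightarrow> nat \<Rightarrow> (nat \<times> nat \<times> port) set" where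
  "row_part i t j = {(j, i, West t), (j, i, East t)}"

text \<open>The column and the row of \<open>u\<close> touch at the diagonal node
  \<open>(u div k, u div k)\<close>; the branch sets of \<open>u\<close> and \<open>v\<close> touch
  at the node \<open>(u div k, v div k)\<close>.\<close>

definition branch :: "nat \<Rightarrow> (nat \<times> nat \<times> port) set" where
  "branch u = (\<Union>j\<le>m - 1. column_part (u div k) (u mod k) j) \<union> (\<Union>j\<le>m - 1. row_part (u div k) (u mod k) j)"

lemma connected_in_edge:
  "x \<in> verts G \<Longrightarrow> y \<in> verts G \<Longrightarrow> {x, y} \<in> edges G \<Longrightarrow> connected_in G {x, y}"
  using connected_in_Un[OF connected_in_singleton connected_in_singleton, of x G y x y] by (simp add: insert_commute)

lemma connected_lines:
  assumes "i < m" "t < k"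
  shows "connected_in grid_graph (\<Union>j\<le>m - 1. column_part i t j)"
    and "connected_in grid_graph (\<Union>j\<le>m - 1. row_part i t j)"
proof -
  have "connected_in grid_graph (column_part i t j)" "connected_in grid_graph (row_part i t j)"
    if "j \<le> m - 1" for j
    unfolding column_part_def row_part_def using assms that m_pos
    by (intro connected_in_edge grid_graph_vertex crossing_edge; force simp: set_ports crossing_def)+
  moreover have "Ver i j t \<in> links" "Hor j i t \<in> links" if "j < m - 1" for j
    using assms that by (force simp: links_def)+
  then have "\<exists>x\<in>column_part i t j. \<exists>y\<in>column_part i t (Suc j). {x, y} \<in> edges grid_graph"
    "\<exists>x\<in>row_part i t j. \<exists>y\<in>row_part i t (Suc j). {x, y} \<in> edges grid_graph" if "j < m - 1" for j
    using link_edge[of "Ver i j t"] link_edge[of "Hor j i t"] that by (auto simp: column_part_def row_part_def)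
  ultimately show "connected_in grid_graph (\<Union>j\<le>m - 1. column_part i t j)"
    "connected_in grid_graph (\<Union>j\<le>m - 1. row_part i t j)"
    by (intro connected_in_path; simp)+
qed

lemma is_minor_grid_graph: "is_minor (complete_graph (k * m)) grid_graph"
  unfolding is_minor_def
proof (intro exI[of _ branch] conjI ballI allI impI)
  have index: "u div k < m" "u mod k < k" if "u < k * m" for u
    using that k_pos by (simp_all add: less_mult_imp_div_less mult.commute)
  have contact: "\<exists>x\<in>\<Union>j\<le>m - 1. column_part (u div k) (u mod k) j. \<exists>y\<in>\<Union>j\<le>m - 1. row_part (v div k) (v mod k) j.
      {x, y} \<in> edges grid_graph" if "u < k * m" "v < k * m" for u v
  proof -
    have "{(u div k, v div k, North (u mod k)), (u div k, v div k, West (v mod k))} \<in> edges grid_graph"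
      using index[OF that(1)] index[OF that(2)] by (intro crossing_edge) (auto simp: crossing_def)
    moreover have "v div k \<le> m - 1" "u div k \<le> m - 1"
      using index[OF that(1)] index[OF that(2)] by auto
    ultimately show ?thesis
      by (intro bexI[of _ "(u div k, v div k, North (u mod k))"] bexI[of _ "(u div k, v div k, West (v mod k))"])
        (auto simp: column_part_def row_part_def)
  qed
  {
    fix u assume "u \<in> verts (complete_graph (k * m))"
    then have u: "u < k * m" by (simp add: complete_graph_def)
    obtain x y where "x \<in> (\<Union>j\<le>m - 1. column_part (u div k) (u mod k) j)"
      "y \<in> (\<Union>j\<le>m - 1. row_part (u div k) (u mod k) j)" "{x, y} \<in> edges grid_graph"
      using contact[OF u u] by blast
    then show "connected_in grid_graph (branch u)"
      unfolding branch_def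
      by (rule connected_in_Un[OF connected_lines, rotated 4]) (use index[OF u] in auto)
  }
  show "branch u \<inter> branch v = {}" if "u \<noteq> v" for u v
  proof -
    have "u div k \<noteq> v div k \<or> u mod k \<noteq> v mod k" using that by (metis div_mult_mod_eq)
    then show ?thesis by (auto simp: branch_def column_part_def row_part_def)
  qed
  fix u v assume "{u, v} \<in> edges (complete_graph (k * m))"
  then have "u < k * m" "v < k * m" by (auto simp: complete_graph_def doubleton_eq_iff)
  from contact[OF this] show "\<exists>x\<in>branch u. \<exists>y\<in>branch v. {x, y} \<in> edges grid_graph"
    unfolding branch_def by blast
qed

end

theorem complete_minor_sphere:
  assumes "0 < m" "0 < k" "m\<^sup>2 \<le> p"
  shows "\<exists>G :: nat graph. simple_graph G \<and> G \<in> almost_embeddable g p k \<and>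
    is_minor (complete_graph (k * m)) G"
proof -
  interpret crossings m k using assms by unfold_locales
  have inj: "inj (to_nat :: nat \<times> nat \<times> port \<Rightarrow> nat)" by simp
  show ?thesis
    using almost_embeddable_grid_graph simple_graph_map_graph[OF inj simple_grid_graph]
      is_minor_map_graph[OF inj is_minor_grid_graph] assms(3)
    by (metis power2_eq_square)
qed

section \<open>The bound\<close>

lemma complete_minor_bound:
  assumes "1 \<le> p" "0 < k"
  shows "\<exists>n G. 1 / 4 * real k * sqrt (real (p + g)) \<le> real n \<and> simple_graph (G :: nat graph) \<and>
    G \<in> almost_embeddable g p k \<and> is_minor (complete_graph n) G"
proof -
  have bound: "1 / 4 * real k * sqrt (real (p + g)) \<le> real (k * m)" if "p + g \<le> 16 * m\<^sup>2" for m
  proof -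
    have "real (p + g) \<le> (4 * real m)\<^sup>2"
      using of_nat_mono[OF that, where 'a = real] by (simp add: power_mult_distrib)
    then have "sqrt (real (p + g)) \<le> 4 * real m"
      by (intro real_le_lsqrt) auto
    then have "1 / 4 * real k * sqrt (real (p + g)) \<le> 1 / 4 * real k * (4 * real m)"
      by (intro mult_left_mono) auto
    then show ?thesis by simp
  qed
  define m where "m = floor_sqrt p"
  have m: "m\<^sup>2 \<le> p" "p < (Suc m)\<^sup>2" "1 \<le> m"
    using assms(1) floor_sqrt_power2_le[of p] Suc_floor_sqrt_power2_gt[of p] mono_floor_sqrt'[of 1 p]
    by (auto simp: m_def)
  show ?thesis
  proof (cases "p + g \<le> 16 * m\<^sup>2")
    case True
    then show ?thesis
      using complete_minor_sphere[of m k p g] bound m assms by (metis less_le_trans zero_less_one)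
  next
    case False
    define m' where "m' = floor_sqrt (g div 2)"
    have "Suc m \<le> 2 * m" using m(3) by simp
    then have "(Suc m)\<^sup>2 \<le> (2 * m)\<^sup>2" by (rule power_mono) simp
    then have "p < 4 * m\<^sup>2" using m(2) by (simp add: power_mult_distrib)
    moreover have "1 \<le> m\<^sup>2" using m(3) by simp
    \<comment> \<open>\<open>16 * m^2 < p + g\<close> and \<open>p < 4 * m^2\<close> leave more than
      \<open>3 * p\<close> and more than \<open>12 * m^2\<close> for \<open>g\<close>.\<close>
    ultimately have g: "3 * p < g" "12 < g" using False by linarith+
    have m': "m'\<^sup>2 \<le> g div 2" "g div 2 < (Suc m')\<^sup>2"
      using floor_sqrt_power2_le[of "g div 2"] Suc_floor_sqrt_power2_gt[of "g div 2"] by (auto simp: m'_def)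
    \<comment> \<open>From here on rounding costs at most a factor 3/2:
      \<open>g < 2 * (m' + 1)^2\<close>, which is at most \<open>9 / 2 * m'^2\<close>, and
      \<open>3 * p < g\<close>; so \<open>p + g\<close> is even below
      \<open>6 * m'^2\<close>.\<close>
    have "2 \<le> m'"
    proof (rule ccontr)
      assume "\<not> 2 \<le> m'"
      then have "(Suc m')\<^sup>2 \<le> 2\<^sup>2" by (intro power_mono) auto
      then show False using m'(2) g(2) by simp
    qed
    then have "2 * Suc m' \<le> 3 * m'" by simp
    then have "(2 * Suc m')\<^sup>2 \<le> (3 * m')\<^sup>2" by (rule power_mono) simp
    then have "4 * (Suc m')\<^sup>2 \<le> 9 * m'\<^sup>2" unfolding power_mult_distrib by simp
    then have "p + g \<le> 16 * m'\<^sup>2" using m'(2) g(1) by linarith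
    moreover have "2 * m'\<^sup>2 \<le> g" using m'(1) by linarith
    ultimately show ?thesis
      using complete_minor_one_vortex[of m' k p g] bound \<open>2 \<le> m'\<close> assms by (metis less_le_trans pos2)
  qed
qed

theorem theorem17:
  fixes g a p k :: nat
  assumes "p \<ge> 1" and "k \<ge> 2"
  shows "\<exists>n::nat. real n \<ge> real a + 1 / 4 * real k * sqrt (real (p + g)) \<and>
           (\<exists>G :: nat graph. G \<in> apex_almost_embeddable g p k a \<and>
              is_minor (complete_graph n) G)"
proof -
  obtain n G where n: "1 / 4 * real k * sqrt (real (p + g)) \<le> real n"
    and G: "simple_graph (G :: nat graph)" "G \<in> almost_embeddable g p k" "is_minor (complete_graph n) G"
    using complete_minor_bound[of p k g] assms by auto
  from add_apex_vertices[OF G, of a] n show ?thesis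
    by (intro exI[of _ "a + n"]) simp
qed

end
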